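(* Let $G$ be a discrete group with Kazhdan's property (T), let $S\subseteq G$ be a finite symmetric generating set with $e\in S$, and let $\phi$ be a normalized positive definite function on $G$ associated with a finite-dimensional unitary irreducible representation $\sigma$ of $G$. For every $0<\delta<1$ there exists $\varepsilon_{\phi,\delta}>0$ such that for every unitary representation $\pi$ of $G$ on a Hilbert space $\mathcal{H}$, and every unit vector $x\in\mathcal{H}$ that is $(\pi,\phi,\varepsilon_{\phi,\delta})$-good, there exists a unit vector $x'\in\mathcal{H}$ with $\|x-x'\|\leq\delta$ such that the restriction of $\pi$ to the linear span of $\pi(G)x'$ is isomorphic (unitarily equivalent) to $\sigma$.
   Context: A discrete group $G$ is a Kazhdan group (has property (T)) if every unitary representation of $G$ that almost has invariant vectors (i.e. for every finite $F\subset G$ and every $\varepsilon>0$ there is a unit vector $\xi$ with $\max_{g\in F}\|\pi(g)\xi-\xi\|<\varepsilon$) has a non-zero invariant vector. A normalized positive definite function $\phi$ on $G$ is associated with a unitary representation $\sigma$ of $G$ on $\mathcal{H}_\sigma$ if $\phi(g)=\langle\sigma(g)v,v\rangle$ for all $g\in G$, for some unit vector $v\in\mathcal{H}_\sigma$. For a unitary representation $\pi$ of $G$ on $\mathcal{H}$ and $\xi\in\mathcal{H}$, put $\phi_{\pi,\xi}(g)=\langle\pi(g)\xi,\xi\rangle$ for $g\in G$. For $k\ge 1$, $S^k$ denotes the set of products of $k$ elements of $S$ (the ball of radius $k$ centered at the identity $e$). Definition of good vectors: let $\phi$ be a normalized positive definite function on $G$ associated with a unitary irreducible representation $\sigma$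 of finite dimension $d$, let $\pi$ be a unitary representation of $G$ on $\mathcal{H}$, and let $\varepsilon>0$. A unit vector $\xi\in\mathcal{H}$ is $(\pi,\phi,\varepsilon)$-good if $|\phi_{\pi,\xi}(s)-\phi(s)|<\varepsilon$ for every $s\in S^{2d^2+1}$. *)

theory Defs
  imports Complex_Main "HOL-Library.Function_Algebras" "HOL-Algebra.Generated_Groups"
begin

text \<open>
  A Hilbert space is a linear subspace \<open>carrier H\<close> of some ambient complex vector space, with an
  inner product on that subspace for which it is complete. Taking the subspace to be the whole
  ambient space gives every complex Hilbert space; letting it vary gives spaces of different
  dimension inside one type. Addition is that of the ambient type. The inner product is linear in
  its first argument, and its values outside the carrier are irrelevant.
\<close>

record 'h hilbert = "'h partial_object" +
  smul :: "complex \<Rightarrow> 'h \<Rightarrow> 'h"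
  ip :: "'h \<Rightarrow> 'h \<Rightarrow> complex"

definition hnorm :: "'h hilbert \<Rightarrow> 'h \<Rightarrow> real" where
  "hnorm H v = sqrt (Re (ip H v v))"

locale complex_hilbert_space = vector_space "smul H"
  for H :: "'h::ab_group_add hilbert" +
  assumes subspace_carrier: "subspace (carrier H)"
    and ip_add_left: "\<And>u v w. \<lbrakk>u \<in> carrier H; v \<in> carrier H; w \<in> carrier H\<rbrakk>
          \<Longrightarrow> ip H (u + v) w = ip H u w + ip H v w"
    and ip_smul_left: "\<And>c u v. \<lbrakk>u \<in> carrier H; v \<in> carrier H\<rbrakk>
          \<Longrightarrow> ip H (smul H c u) v = c * ip H u v"
    and ip_cnj: "\<And>u v. \<lbrakk>u \<in> carrier H; v \<in> carrier H\<rbrakk> \<Longrightarrow> ip H v u = cnj (ip H u v)"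
    and ip_pos: "\<And>v. \<lbrakk>v \<in> carrier H; v \<noteq> 0\<rbrakk> \<Longrightarrow> 0 < Re (ip H v v)"
    and complete: "\<And>X :: nat \<Rightarrow> 'h. \<lbrakk>\<And>n. X n \<in> carrier H;
            \<forall>e>0. \<exists>N. \<forall>m\<ge>N. \<forall>n\<ge>N. hnorm H (X m - X n) < e\<rbrakk>
          \<Longrightarrow> \<exists>l\<in>carrier H. (\<lambda>n. hnorm H (X n - l)) \<longlonglongrightarrow> 0"

definition finite_dimensional :: "'h::ab_group_add hilbert \<Rightarrow> bool" where
  "finite_dimensional H \<longleftrightarrow> (\<exists>B. finite B \<and> module.span (smul H) B = carrier H)"

abbreviation hdim :: "'h::ab_group_add hilbert \<Rightarrow> nat" where
  "hdim H \<equiv> vector_space.dim (smul H) (carrier H)"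

definition closed_subspace :: "'h::ab_group_add hilbert \<Rightarrow> 'h set \<Rightarrow> bool" where
  "closed_subspace H W \<longleftrightarrow> module.subspace (smul H) W \<and> W \<subseteq> carrier H \<and>
     (\<forall>(X :: nat \<Rightarrow> 'h) l. (\<forall>n. X n \<in> W) \<and> l \<in> carrier H \<and>
        (\<lambda>n. hnorm H (X n - l)) \<longlonglongrightarrow> 0 \<longrightarrow> l \<in> W)"

definition unitary_map ::
  "'h::ab_group_add hilbert \<Rightarrow> 'k::ab_group_add hilbert \<Rightarrow> ('h \<Rightarrow> 'k) \<Rightarrow> bool" where
  "unitary_map H K T \<longleftrightarrow> bij_betw T (carrier H) (carrier K) \<and>
     (\<forall>u\<in>carrier H. \<forall>v\<in>carrier H. T (u + v) = T u + T v) \<and>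
     (\<forall>c. \<forall>v\<in>carrier H. T (smul H c v) = smul K c (T v)) \<and>
     (\<forall>u\<in>carrier H. \<forall>v\<in>carrier H. ip K (T u) (T v) = ip H u v)"

definition unitary_rep ::
  "('g, 'm) monoid_scheme \<Rightarrow> 'h::ab_group_add hilbert \<Rightarrow> ('g \<Rightarrow> 'h \<Rightarrow> 'h) \<Rightarrow> bool" where
  "unitary_rep G H \<pi> \<longleftrightarrow> complex_hilbert_space H \<and>
     (\<forall>g\<in>carrier G. unitary_map H H (\<pi> g)) \<and>
     (\<forall>v\<in>carrier H. \<pi> \<one>\<^bsub>G\<^esub> v = v) \<and>
     (\<forall>g\<in>carrier G. \<forall>h\<in>carrier G. \<forall>v\<in>carrier H. \<pi> (g \<otimes>\<^bsub>G\<^esub> h) v = \<pi> g (\<pi> h v))"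

definition irreducible_rep ::
  "('g, 'm) monoid_scheme \<Rightarrow> 'h::ab_group_add hilbert \<Rightarrow> ('g \<Rightarrow> 'h \<Rightarrow> 'h) \<Rightarrow> bool" where
  "irreducible_rep G H \<pi> \<longleftrightarrow> unitary_rep G H \<pi> \<and> carrier H \<noteq> {0} \<and>
     (\<forall>W. closed_subspace H W \<and> (\<forall>g\<in>carrier G. \<pi> g ` W \<subseteq> W) \<longrightarrow> W = {0} \<or> W = carrier H)"

definition unitarily_equivalent ::
  "('g, 'm) monoid_scheme \<Rightarrow> 'h::ab_group_add hilbert \<Rightarrow> ('g \<Rightarrow> 'h \<Rightarrow> 'h) \<Rightarrow>
   'k::ab_group_add hilbert \<Rightarrow> ('g \<Rightarrow> 'k \<Rightarrow> 'k) \<Rightarrow> bool" where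
  "unitarily_equivalent G H \<pi> K \<sigma> \<longleftrightarrow> (\<exists>T. unitary_map H K T \<and>
     (\<forall>g\<in>carrier G. \<forall>v\<in>carrier H. T (\<pi> g v) = \<sigma> g (T v)))"

definition orbit_span ::
  "('g, 'm) monoid_scheme \<Rightarrow> 'h::ab_group_add hilbert \<Rightarrow> ('g \<Rightarrow> 'h \<Rightarrow> 'h) \<Rightarrow> 'h \<Rightarrow> 'h set" where
  "orbit_span G H \<pi> x = module.span (smul H) ((\<lambda>g. \<pi> g x) ` carrier G)"

definition almost_invariant_vectors ::
  "('g, 'm) monoid_scheme \<Rightarrow> 'h::ab_group_add hilbert \<Rightarrow> ('g \<Rightarrow> 'h \<Rightarrow> 'h) \<Rightarrow> bool" where
  "almost_invariant_vectors G H \<pi> \<longleftrightarrow>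
     (\<forall>F \<epsilon>. finite F \<and> F \<subseteq> carrier G \<and> 0 < \<epsilon> \<longrightarrow>
        (\<exists>\<xi>\<in>carrier H. hnorm H \<xi> = 1 \<and> (\<forall>g\<in>F. hnorm H (\<pi> g \<xi> - \<xi>) < \<epsilon>)))"

definition has_invariant_vector ::
  "('g, 'm) monoid_scheme \<Rightarrow> 'h::ab_group_add hilbert \<Rightarrow> ('g \<Rightarrow> 'h \<Rightarrow> 'h) \<Rightarrow> bool" where
  "has_invariant_vector G H \<pi> \<longleftrightarrow> (\<exists>\<xi>\<in>carrier H. \<xi> \<noteq> 0 \<and> (\<forall>g\<in>carrier G. \<pi> g \<xi> = \<xi>))"

text \<open>
  HOL formulas cannot quantify over types, so "every Hilbert space" inside a formula means every
  Hilbert space carried by a subspace of the following type. Up to isometry these include all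
  Hilbert spaces of Hilbert dimension at most \<open>|G| \<cdot> \<aleph>\<^sub>0\<close>, as \<open>\<ell>\<^sup>2(G \<times> \<nat>)\<close> is such a subspace.
  For property (T) this is no restriction: a representation with almost invariant vectors has a
  subrepresentation of that dimension with almost invariant vectors (the closed span of the orbits
  of one unit vector for each finite \<open>F\<close> and each \<open>\<epsilon> = 1/n\<close>).
\<close>

type_synonym 'g universe = "'g \<times> nat \<Rightarrow> complex"

definition kazhdan_group :: "('g, 'm) monoid_scheme \<Rightarrow> bool" where
  "kazhdan_group G \<longleftrightarrow> group G \<and>
     (\<forall>(H :: 'g universe hilbert) \<pi>.
        unitary_rep G H \<pi> \<and> almost_invariant_vectors G H \<pi> \<longrightarrow> has_invariant_vector G H \<pi>)"

definition normalized_positive_definite ::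
  "('g, 'm) monoid_scheme \<Rightarrow> ('g \<Rightarrow> complex) \<Rightarrow> bool" where
  "normalized_positive_definite G \<phi> \<longleftrightarrow> \<phi> \<one>\<^bsub>G\<^esub> = 1 \<and>
     (\<forall>F c. finite F \<and> F \<subseteq> carrier G \<longrightarrow>
        (let q = (\<Sum>g\<in>F. \<Sum>h\<in>F. c g * cnj (c h) * \<phi> (inv\<^bsub>G\<^esub> h \<otimes>\<^bsub>G\<^esub> g)) in q \<in> \<real> \<and> 0 \<le> Re q))"

definition coeff_fun :: "'h hilbert \<Rightarrow> ('g \<Rightarrow> 'h \<Rightarrow> 'h) \<Rightarrow> 'h \<Rightarrow> 'g \<Rightarrow> complex" where
  "coeff_fun H \<pi> \<xi> g = ip H (\<pi> g \<xi>) \<xi>"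

definition associated_with ::
  "('g, 'm) monoid_scheme \<Rightarrow> ('g \<Rightarrow> complex) \<Rightarrow> 'h::ab_group_add hilbert \<Rightarrow> ('g \<Rightarrow> 'h \<Rightarrow> 'h) \<Rightarrow> bool"
  where
  "associated_with G \<phi> H \<sigma> \<longleftrightarrow> normalized_positive_definite G \<phi> \<and> unitary_rep G H \<sigma> \<and>
     (\<exists>v\<in>carrier H. hnorm H v = 1 \<and> (\<forall>g\<in>carrier G. \<phi> g = coeff_fun H \<sigma> v g))"

definition set_pow :: "('g, 'm) monoid_scheme \<Rightarrow> 'g set \<Rightarrow> nat \<Rightarrow> 'g set" where
  "set_pow G S k = ((\<lambda>A. S <#>\<^bsub>G\<^esub> A) ^^ k) {\<one>\<^bsub>G\<^esub>}"

definition symmetric_generating_set :: "('g, 'm) monoid_scheme \<Rightarrow> 'g set \<Rightarrow> bool" where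
  "symmetric_generating_set G S \<longleftrightarrow>
     S \<subseteq> carrier G \<and> (\<forall>s\<in>S. inv\<^bsub>G\<^esub> s \<in> S) \<and> generate G S = carrier G"

text \<open>
  In \<open>good_vector G S d \<phi> H \<pi> \<epsilon> \<xi>\<close> the number \<open>d\<close> is the dimension of the irreducible
  representation with which \<open>\<phi>\<close> is associated.
\<close>

definition good_vector ::
  "('g, 'm) monoid_scheme \<Rightarrow> 'g set \<Rightarrow> nat \<Rightarrow> ('g \<Rightarrow> complex) \<Rightarrow>
   'h::ab_group_add hilbert \<Rightarrow> ('g \<Rightarrow> 'h \<Rightarrow> 'h) \<Rightarrow> real \<Rightarrow> 'h \<Rightarrow> bool" where
  "good_vector G S d \<phi> H \<pi> \<epsilon> \<xi> \<longleftrightarrow> \<xi> \<in> carrier H \<and> hnorm H \<xi> = 1 \<and>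
     (\<forall>s\<in>set_pow G S (2 * d\<^sup>2 + 1). cmod (coeff_fun H \<pi> \<xi> s - \<phi> s) < \<epsilon>)"

text \<open>
  \<open>good_threshold TYPE('h) G S \<phi> K \<sigma> \<delta> \<epsilon>\<close> says that \<open>\<epsilon>\<close> has the property required of
  \<open>\<epsilon>\<^sub>\<phi>\<^sub>,\<^sub>\<delta>\<close> with respect to all representations on Hilbert spaces carried by subspaces of the type
  \<open>'h\<close>.
\<close>

definition good_threshold ::
  "'h::ab_group_add itself \<Rightarrow> ('g, 'm) monoid_scheme \<Rightarrow> 'g set \<Rightarrow> ('g \<Rightarrow> complex) \<Rightarrow>
   'k::ab_group_add hilbert \<Rightarrow> ('g \<Rightarrow> 'k \<Rightarrow> 'k) \<Rightarrow> real \<Rightarrow> real \<Rightarrow> bool" where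
  "good_threshold (_ :: 'h itself) G S \<phi> K \<sigma> \<delta> \<epsilon> \<longleftrightarrow>
     (\<forall>(H :: 'h hilbert) \<pi> x.
        unitary_rep G H \<pi> \<and> good_vector G S (hdim K) \<phi> H \<pi> \<epsilon> x \<longrightarrow>
        (\<exists>x'\<in>carrier H. hnorm H x' = 1 \<and> hnorm H (x - x') \<le> \<delta> \<and>
           unitarily_equivalent G (H\<lparr>carrier := orbit_span G H \<pi> x'\<rparr>) \<pi> K \<sigma>))"

end

theory Submission
  imports Defs "HOL-Computational_Algebra.Fundamental_Theorem_Algebra"
begin

text \<open>
  Let \<open>v\<close> be a unit vector of \<open>K\<close> with \<open>\<phi>(g) = \<langle>\<sigma>(g) v, v\<rangle>\<close>, and let \<open>d\<close> be the dimension of \<open>K\<close>. The idea is to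
  build from a good vector \<open>x\<close> a linear map \<open>A : K \<rightarrow> H\<close> with \<open>A v = x\<close> that almost intertwines \<open>\<sigma>\<close> and \<open>\<pi>\<close>, and
  to correct it to a true intertwiner with property (T), applied to the space of linear maps.
  
  The subspaces spanned by \<open>\<sigma>(S\<^sup>k) v\<close> grow strictly with \<open>k\<close> until they are invariant, hence equal to \<open>K\<close>.
  So the words of length at most \<open>d - 1\<close> already give a basis of \<open>K\<close> of the form \<open>b = \<sigma>(h b) v\<close>
  (\<open>span_ball_orbit\<close>), and \<open>A\<close> is defined by \<open>A b = \<pi>(h b) x\<close>. The defect of \<open>A\<close> with respect to a generator
  \<open>t\<close> is controlled by the linear relations that express \<open>\<sigma>(t h(b)) v\<close> in the basis. The norm of a
  combination of orbit vectors depends only on the values of the matrix coefficient on quotients of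
  words, here of length at most \<open>2 d\<close>. So these relations hold in \<open>H\<close> up to a small error if \<open>x\<close> is good
  (\<open>approximate_relation\<close>, \<open>orbit_map_displacement\<close>).
  
  The group acts unitarily on the linear maps \<open>K \<rightarrow> H\<close> by conjugation, for the Hilbert-Schmidt inner
  product, and its fixed points are the intertwiners. Property (T) in quantitative form
  (\<open>kazhdan_constant_exists\<close>) gives an intertwiner \<open>A'\<close> close to \<open>A\<close>. By Schur's lemma
  (\<open>schur_invariant_form\<close>) it is a multiple of an isometry, so the normalized \<open>x' = A' v / \<parallel>A' v\<parallel>\<close>, which
  is close to \<open>x\<close>, generates a copy of \<open>\<sigma>\<close> (\<open>intertwiner_orbit_equivalent\<close>).
  
  Two arguments exchange the type that carries a Hilbert space, since property (T) is given only for
  spaces of functions on \<open>G \<times> \<nat>\<close>. The quantitative form concerns a direct sum of cyclic representations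
  over an arbitrary type, and the last assertion of the theorem concerns the cyclic representation
  generated by \<open>x\<close>. In both cases matrix coefficients embed the space into such functions, and the
  Hilbert space structure is moved along the embedding (\<open>transport\<close>).
\<close>

section \<open>Hilbert spaces\<close>

context complex_hilbert_space
begin

lemma zero_mem [simp]: "0 \<in> carrier H"
  and add_mem [simp]: "u \<in> carrier H \<Longrightarrow> v \<in> carrier H \<Longrightarrow> u + v \<in> carrier H"
  and smul_mem [simp]: "u \<in> carrier H \<Longrightarrow> smul H c u \<in> carrier H"
  and diff_mem [simp]: "u \<in> carrier H \<Longrightarrow> v \<in> carrier H \<Longrightarrow> u - v \<in> carrier H"
  and uminus_mem [simp]: "u \<in> carrier H \<Longrightarrow> - u \<in> carrier H"
  and sum_mem: "(\<And>i. i \<in> A \<Longrightarrow> f i \<in> carrier H) \<Longrightarrow> sum f A \<in> carrier H"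
  using subspace_carrier
  by (auto simp: subspace_0 subspace_add subspace_scale subspace_diff subspace_neg subspace_sum)

lemma ip_zero_left [simp]: "v \<in> carrier H \<Longrightarrow> ip H 0 v = 0"
  using ip_smul_left[of 0 v 0] by simp

lemma ip_zero_right [simp]: "v \<in> carrier H \<Longrightarrow> ip H v 0 = 0"
  using ip_cnj[of 0 v] by simp

lemma ip_add_right:
  "u \<in> carrier H \<Longrightarrow> v \<in> carrier H \<Longrightarrow> w \<in> carrier H \<Longrightarrow> ip H w (u + v) = ip H w u + ip H w v"
  using ip_cnj[of "u + v" w] ip_cnj[of u w] ip_cnj[of v w] by (simp add: ip_add_left)

lemma ip_smul_right:
  "u \<in> carrier H \<Longrightarrow> w \<in> carrier H \<Longrightarrow> ip H w (smul H c u) = cnj c * ip H w u"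
  using ip_cnj[of "smul H c u" w] ip_cnj[of u w] by (simp add: ip_smul_left)

lemma ip_minus_left: "u \<in> carrier H \<Longrightarrow> w \<in> carrier H \<Longrightarrow> ip H (- u) w = - ip H u w"
  using ip_smul_left[of u w "-1"] by simp

lemma ip_minus_right: "u \<in> carrier H \<Longrightarrow> w \<in> carrier H \<Longrightarrow> ip H w (- u) = - ip H w u"
  using ip_smul_right[of u w "-1"] by simp

lemma ip_diff_left:
  "u \<in> carrier H \<Longrightarrow> v \<in> carrier H \<Longrightarrow> w \<in> carrier H \<Longrightarrow> ip H (u - v) w = ip H u w - ip H v w"
  using ip_add_left[of u "- v" w] by (simp add: ip_minus_left)

lemma ip_diff_right:
  "u \<in> carrier H \<Longrightarrow> v \<in> carrier H \<Longrightarrow> w \<in> carrier H \<Longrightarrow> ip H w (u - v) = ip H w u - ip H w v"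
  using ip_add_right[of u "- v" w] by (simp add: ip_minus_right)

lemma ip_sum_left:
  assumes "\<And>i. i \<in> A \<Longrightarrow> f i \<in> carrier H" "w \<in> carrier H"
  shows "ip H (sum f A) w = (\<Sum>i\<in>A. ip H (f i) w)"
  using assms by (induction A rule: infinite_finite_induct) (auto simp: ip_add_left sum_mem)

lemma ip_sum_right:
  assumes "\<And>i. i \<in> A \<Longrightarrow> f i \<in> carrier H" "w \<in> carrier H"
  shows "ip H w (sum f A) = (\<Sum>i\<in>A. ip H w (f i))"
  using assms by (induction A rule: infinite_finite_induct) (auto simp: ip_add_right sum_mem)

lemma Re_ip_self_nonneg: "v \<in> carrier H \<Longrightarrow> 0 \<le> Re (ip H v v)"
  using ip_pos[of v] by (cases "v = 0") (auto intro: less_imp_le)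

lemma hnorm_sq: "v \<in> carrier H \<Longrightarrow> (hnorm H v)\<^sup>2 = Re (ip H v v)"
  by (simp add: hnorm_def Re_ip_self_nonneg)

lemma ip_self: "v \<in> carrier H \<Longrightarrow> ip H v v = of_real ((hnorm H v)\<^sup>2)"
  using arg_cong[of _ _ Im, OF ip_cnj[of v v]] by (simp add: hnorm_sq complex_eq_iff)

lemma hnorm_nonneg [simp]: "v \<in> carrier H \<Longrightarrow> 0 \<le> hnorm H v"
  by (simp add: hnorm_def Re_ip_self_nonneg)

lemma hnorm_zero [simp]: "hnorm H 0 = 0"
  by (simp add: hnorm_def)

lemma hnorm_eq_0_iff: "v \<in> carrier H \<Longrightarrow> hnorm H v = 0 \<longleftrightarrow> v = 0"
  using ip_pos[of v] by (cases "v = 0") (auto simp: hnorm_def)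

lemma hnorm_smul: "v \<in> carrier H \<Longrightarrow> hnorm H (smul H c v) = cmod c * hnorm H v"
proof -
  assume v: "v \<in> carrier H"
  have "ip H (smul H c v) (smul H c v) = (c * cnj c) * ip H v v"
    using v by (simp add: ip_smul_left ip_smul_right)
  also have "\<dots> = of_real ((cmod c)\<^sup>2) * of_real ((hnorm H v)\<^sup>2)"
    by (simp only: complex_norm_square ip_self[OF v])
  finally have "ip H (smul H c v) (smul H c v) = of_real ((cmod c * hnorm H v)\<^sup>2)"
    by (simp add: power_mult_distrib)
  then show ?thesis
    using v by (simp add: hnorm_def[of H "smul H c v"])
qed

lemma hnorm_minus: "v \<in> carrier H \<Longrightarrow> hnorm H (- v) = hnorm H v"
  using hnorm_smul[of v "-1"] by simp

lemma hnorm_minus_commute: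
  "u \<in> carrier H \<Longrightarrow> v \<in> carrier H \<Longrightarrow> hnorm H (u - v) = hnorm H (v - u)"
  using hnorm_minus[of "u - v"] by simp

lemma hnorm_add_sq:
  "u \<in> carrier H \<Longrightarrow> v \<in> carrier H \<Longrightarrow>
    (hnorm H (u + v))\<^sup>2 = (hnorm H u)\<^sup>2 + (hnorm H v)\<^sup>2 + 2 * Re (ip H u v)"
  using ip_cnj[of u v] by (simp add: hnorm_sq ip_add_left ip_add_right)

lemma hnorm_diff_sq:
  "u \<in> carrier H \<Longrightarrow> v \<in> carrier H \<Longrightarrow>
    (hnorm H (u - v))\<^sup>2 = (hnorm H u)\<^sup>2 + (hnorm H v)\<^sup>2 - 2 * Re (ip H u v)"
  using ip_cnj[of u v] by (simp add: hnorm_sq ip_diff_left ip_diff_right)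

lemma cauchy_schwarz:
  assumes u: "u \<in> carrier H" and v: "v \<in> carrier H"
  shows "cmod (ip H u v) \<le> hnorm H u * hnorm H v"
proof (cases "v = 0")
  case True
  then show ?thesis using u by simp
next
  case False
  define a where "a = (hnorm H v)\<^sup>2"
  have a: "a > 0"
    using False v by (simp add: a_def hnorm_eq_0_iff)
  define z where "z = ip H u v / of_real a"
  have "0 \<le> (hnorm H (u - smul H z v))\<^sup>2" by simp
  also have "\<dots> = (hnorm H u)\<^sup>2 + (cmod z)\<^sup>2 * a - 2 * Re (cnj z * ip H u v)"
    using u v by (simp add: hnorm_diff_sq hnorm_smul ip_smul_right a_def power_mult_distrib)
  also have "cnj z * ip H u v = of_real ((cmod (ip H u v))\<^sup>2 / a)"
    unfolding z_def of_real_divide complex_norm_square by simp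
  also have "(cmod z)\<^sup>2 * a = (cmod (ip H u v))\<^sup>2 / a"
    using a by (simp add: z_def norm_divide power_divide power2_eq_square)
  finally have "(cmod (ip H u v))\<^sup>2 / a \<le> (hnorm H u)\<^sup>2" by simp
  then have "(cmod (ip H u v))\<^sup>2 \<le> (hnorm H u * hnorm H v)\<^sup>2"
    using a by (simp add: field_simps a_def)
  then show ?thesis
    by (rule power2_le_imp_le) (use u v in auto)
qed

lemma hnorm_triangle:
  assumes u: "u \<in> carrier H" and v: "v \<in> carrier H"
  shows "hnorm H (u + v) \<le> hnorm H u + hnorm H v"
proof -
  have "Re (ip H u v) \<le> hnorm H u * hnorm H v"
    using cauchy_schwarz[OF u v] complex_Re_le_cmod order_trans by blast
  then have "(hnorm H (u + v))\<^sup>2 \<le> (hnorm H u + hnorm H v)\<^sup>2"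
    using u v by (simp add: hnorm_add_sq power2_sum)
  then show ?thesis
    by (rule power2_le_imp_le) (use u v in auto)
qed

lemma hnorm_triangle_diff:
  assumes "u \<in> carrier H" "v \<in> carrier H" "w \<in> carrier H"
  shows "hnorm H (u - w) \<le> hnorm H (u - v) + hnorm H (v - w)"
  using hnorm_triangle[of "u - v" "v - w"] assms by simp

lemma hnorm_diff_abs:
  assumes "u \<in> carrier H" "v \<in> carrier H"
  shows "\<bar>hnorm H u - hnorm H v\<bar> \<le> hnorm H (u - v)"
  using hnorm_triangle[of "u - v" v] hnorm_triangle[of "v - u" u]
    hnorm_minus_commute[of u v] assms by auto

lemma hnorm_sum_le:
  assumes "\<And>i. i \<in> A \<Longrightarrow> f i \<in> carrier H"
  shows "hnorm H (sum f A) \<le> (\<Sum>i\<in>A. hnorm H (f i))"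
  using assms
proof (induction A rule: infinite_finite_induct)
  case (insert x F)
  then show ?case
    using hnorm_triangle[of "f x" "sum f F"] by (simp add: sum_mem)
qed auto

lemma tendsto_ip_left:
  assumes X: "\<And>n. X n \<in> carrier H" and l: "l \<in> carrier H" and w: "w \<in> carrier H"
    and lim: "(\<lambda>n. hnorm H (X n - l)) \<longlonglongrightarrow> 0"
  shows "(\<lambda>n. ip H (X n) w) \<longlonglongrightarrow> ip H l w"
proof -
  have "(\<lambda>n. hnorm H (X n - l) * hnorm H w) \<longlonglongrightarrow> 0"
    using tendsto_mult_right[OF lim, of "hnorm H w"] by simp
  then have "(\<lambda>n. ip H (X n) w - ip H l w) \<longlonglongrightarrow> 0"
    by (rule tendsto_0_le[where K=1])
       (auto intro!: always_eventually simp: X l w ip_diff_left[symmetric] cauchy_schwarz)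
  then show ?thesis
    by (simp add: LIM_zero_iff)
qed

lemma tendsto_hnorm:
  assumes X: "\<And>n. X n \<in> carrier H" and l: "l \<in> carrier H"
    and lim: "(\<lambda>n. hnorm H (X n - l)) \<longlonglongrightarrow> 0"
  shows "(\<lambda>n. hnorm H (X n)) \<longlonglongrightarrow> hnorm H l"
proof -
  have "(\<lambda>n. hnorm H (X n) - hnorm H l) \<longlonglongrightarrow> 0"
    by (rule tendsto_0_le[OF lim, where K=1])
       (auto intro!: always_eventually simp: X l hnorm_diff_abs)
  then show ?thesis
    by (simp add: LIM_zero_iff)
qed

text \<open>
  An orthogonal complement is a closed subspace whether or not the set is a subspace. The double
  complement therefore serves as the closed linear span of a set, and limits of sequences of linear
  combinations need not be handled.
\<close>

definition orthogonal_complement :: "'h set \<Rightarrow> 'h set" where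
  "orthogonal_complement X = {v \<in> carrier H. \<forall>x\<in>X. ip H v x = 0}"

lemma closed_subspace_orthogonal_complement:
  assumes "X \<subseteq> carrier H"
  shows "closed_subspace H (orthogonal_complement X)"
  unfolding closed_subspace_def
proof (intro conjI allI impI)
  show "subspace (orthogonal_complement X)"
    using assms
    by (auto simp: subspace_def orthogonal_complement_def ip_add_left ip_smul_left subset_iff)
  show "orthogonal_complement X \<subseteq> carrier H"
    by (auto simp: orthogonal_complement_def)
next
  fix Y l
  assume Y: "(\<forall>n. Y n \<in> orthogonal_complement X) \<and> l \<in> carrier H \<and>
    (\<lambda>n. hnorm H (Y n - l)) \<longlonglongrightarrow> 0"
  have "ip H l x = 0" if "x \<in> X" for x
  proof -
    have "(\<lambda>n. ip H (Y n) x) \<longlonglongrightarrow> ip H l x"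
      using Y that assms by (intro tendsto_ip_left) (auto simp: orthogonal_complement_def)
    then have "(\<lambda>n. 0) \<longlonglongrightarrow> ip H l x"
      using Y that by (simp add: orthogonal_complement_def)
    then show ?thesis
      by (simp add: LIMSEQ_const_iff)
  qed
  then show "l \<in> orthogonal_complement X"
    using Y by (simp add: orthogonal_complement_def)
qed

lemma hilbert_space_closed_subspace:
  assumes "closed_subspace H W"
  shows "complex_hilbert_space (H\<lparr>carrier := W\<rparr>)"
proof -
  have sub: "subspace W" and W: "W \<subseteq> carrier H"
    and cl: "\<And>X l. (\<And>n. X n \<in> W) \<Longrightarrow> l \<in> carrier H \<Longrightarrow> (\<lambda>n. hnorm H (X n - l)) \<longlonglongrightarrow> 0 \<Longrightarrow> l \<in> W"
    using assms by (auto simp: closed_subspace_def)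
  have nrm: "hnorm (H\<lparr>carrier := W\<rparr>) = hnorm H"
    by (auto simp: hnorm_def)
  have vs: "vector_space (smul (H\<lparr>carrier := W\<rparr>))"
    by (simp add: vector_space_axioms)
  show ?thesis
    unfolding complex_hilbert_space_def complex_hilbert_space_axioms_def
    using W
  proof (intro conjI allI impI)
    show "vector_space (smul (H\<lparr>carrier := W\<rparr>))" by (rule vs)
  next
    show "module.subspace (smul (H\<lparr>carrier := W\<rparr>)) (carrier (H\<lparr>carrier := W\<rparr>))"
      using sub by simp
  next
    fix X :: "nat \<Rightarrow> 'h"
    assume "\<forall>n. X n \<in> carrier (H\<lparr>carrier := W\<rparr>)"
      and "\<forall>e>0. \<exists>N. \<forall>m\<ge>N. \<forall>n\<ge>N. hnorm (H\<lparr>carrier := W\<rparr>) (X m - X n) < e"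
    then have X: "\<forall>n. X n \<in> W" "\<forall>e>0. \<exists>N. \<forall>m\<ge>N. \<forall>n\<ge>N. hnorm H (X m - X n) < e"
      by (simp_all add: nrm)
    then obtain l where "l \<in> carrier H" "(\<lambda>n. hnorm H (X n - l)) \<longlonglongrightarrow> 0"
      using complete[of X] W by blast
    then have "\<exists>l\<in>W. (\<lambda>n. hnorm H (X n - l)) \<longlonglongrightarrow> 0"
      using cl X by blast
    then show "\<exists>l\<in>carrier (H\<lparr>carrier := W\<rparr>).
        (\<lambda>n. hnorm (H\<lparr>carrier := W\<rparr>) (X n - l)) \<longlonglongrightarrow> 0"
      by (simp add: nrm)
  qed (auto simp: subset_iff ip_add_left ip_smul_left ip_pos intro: ip_cnj)
qed

text \<open>
  The parallelogram identity makes every sequence in \<open>W\<close> whose distances to \<open>x\<close> approach the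
  infimum a Cauchy sequence, and its limit is the nearest point.
\<close>

lemma projection_exists:
  assumes cl: "closed_subspace H W" and x: "x \<in> carrier H"
  obtains p where "p \<in> W" "\<And>w. w \<in> W \<Longrightarrow> ip H (x - p) w = 0"
proof -
  have sub: "subspace W" and W: "W \<subseteq> carrier H"
    and lim: "\<And>X l. (\<And>n. X n \<in> W) \<Longrightarrow> l \<in> carrier H \<Longrightarrow> (\<lambda>n. hnorm H (X n - l)) \<longlonglongrightarrow> 0 \<Longrightarrow> l \<in> W"
    using cl by (auto simp: closed_subspace_def)
  have WH: "\<And>w. w \<in> W \<Longrightarrow> w \<in> carrier H" using W by auto
  define D where "D = (\<lambda>w. (hnorm H (x - w))\<^sup>2) ` W"
  define m where "m = Inf D"
  have D0: "D \<noteq> {}" using subspace_0[OF sub] by (auto simp: D_def)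
  have bdd: "bdd_below D" by (auto simp: D_def intro!: bdd_belowI2[where m=0])
  have m_le: "m \<le> (hnorm H (x - w))\<^sup>2" if "w \<in> W" for w
    unfolding m_def using that bdd by (auto simp: D_def intro!: cInf_lower)
  have "\<exists>w\<in>W. (hnorm H (x - w))\<^sup>2 < m + 1 / real (Suc n)" for n
  proof -
    have "Inf D < m + 1 / real (Suc n)" by (simp add: m_def)
    then show ?thesis
      using cInf_less_iff[OF D0 bdd] by (auto simp: D_def)
  qed
  then obtain X where XW: "\<And>n. X n \<in> W" and X: "\<And>n. (hnorm H (x - X n))\<^sup>2 < m + 1 / real (Suc n)"
    by metis
  (* The parallelogram identity at the midpoint of two almost minimal points. *)
  have close: "(hnorm H (X i - X j))\<^sup>2 \<le> 2 / real (Suc i) + 2 / real (Suc j)" for i j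
  proof -
    define a b where "a = x - X i" and "b = x - X j"
    have ab: "a \<in> carrier H" "b \<in> carrier H"
      using WH XW x by (auto simp: a_def b_def)
    define c where "c = smul H (1/2) (X i + X j)"
    have c: "c \<in> W"
      using XW sub by (simp add: c_def subspace_scale subspace_add)
    have two: "smul H 2 u = u + u" for u
      using scale_left_distrib[of 1 1 u] by simp
    have "smul H 2 (x - c) = a + b"
      by (simp add: two scale_right_diff_distrib c_def a_def b_def scale_scale)
    then have "(hnorm H (a + b))\<^sup>2 = 4 * (hnorm H (x - c))\<^sup>2"
      using hnorm_smul[of "x - c" 2] c WH x by (simp add: power_mult_distrib)
    moreover have "(hnorm H (a + b))\<^sup>2 + (hnorm H (a - b))\<^sup>2 = 2 * (hnorm H a)\<^sup>2 + 2 * (hnorm H b)\<^sup>2"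
      using ab by (simp add: hnorm_add_sq hnorm_diff_sq)
    moreover have "hnorm H (a - b) = hnorm H (X i - X j)"
      using hnorm_minus_commute[of "X i" "X j"] WH XW by (simp add: a_def b_def)
    moreover have "(hnorm H a)\<^sup>2 < m + 1 / real (Suc i)" "(hnorm H b)\<^sup>2 < m + 1 / real (Suc j)"
      using X by (auto simp: a_def b_def)
    moreover have "2 / real (Suc k) = 2 * (1 / real (Suc k))" for k
      by simp
    ultimately show ?thesis
      using m_le[OF c] by (smt (verit))
  qed
  have "\<exists>N. \<forall>i\<ge>N. \<forall>j\<ge>N. hnorm H (X i - X j) < e" if e: "e > 0" for e
  proof -
    obtain N where N: "4 / e\<^sup>2 < real N"
      using reals_Archimedean2 by blast
    have "hnorm H (X i - X j) < e" if ij: "i \<ge> N" "j \<ge> N" for i j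
    proof -
      have Np: "0 < real (Suc N)" by simp
      have "2 / real (Suc i) \<le> 2 / real (Suc N)" "2 / real (Suc j) \<le> 2 / real (Suc N)"
        using ij by (auto intro!: divide_left_mono)
      then have "(hnorm H (X i - X j))\<^sup>2 \<le> 4 / real (Suc N)"
        using close[of i j] by simp
      also have "\<dots> < e\<^sup>2"
      proof -
        have "4 < real N * e\<^sup>2" using N e by (simp add: field_simps)
        also have "\<dots> \<le> real (Suc N) * e\<^sup>2" by (intro mult_right_mono) auto
        finally show ?thesis by (simp add: divide_less_eq mult.commute)
      qed
      finally show ?thesis
        using e by (rule power_less_imp_less_base[OF _ less_imp_le])
    qed
    then show ?thesis by blast
  qed
  then obtain p where p: "p \<in> carrier H" and Xp: "(\<lambda>n. hnorm H (X n - p)) \<longlonglongrightarrow> 0"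
    using complete[of X] WH XW by blast
  have pW: "p \<in> W" using lim XW p Xp by blast
  have "(\<lambda>n. hnorm H ((x - X n) - (x - p))) \<longlonglongrightarrow> 0"
    using Xp by (simp add: hnorm_minus_commute[OF WH[OF XW] p])
  then have "(\<lambda>n. (hnorm H (x - X n))\<^sup>2) \<longlonglongrightarrow> (hnorm H (x - p))\<^sup>2"
    by (intro tendsto_power tendsto_hnorm) (auto simp: x p WH XW)
  moreover have "(\<lambda>n. m + 1 / real (Suc n)) \<longlonglongrightarrow> m + 0"
    by (intro tendsto_add tendsto_const LIMSEQ_Suc[OF lim_1_over_n])
  ultimately have "(hnorm H (x - p))\<^sup>2 \<le> m + 0"
    using X by (intro LIMSEQ_le[of "\<lambda>n. (hnorm H (x - X n))\<^sup>2"]) (auto intro: less_imp_le)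
  then have pm: "(hnorm H (x - p))\<^sup>2 \<le> m" by simp
  have "ip H (x - p) w = 0" if w: "w \<in> W" for w
  proof (cases "w = 0")
    case True
    then show ?thesis using x p by simp
  next
    case False
    (* Moving p by the projection of x - p to the line of w would lower the distance. *)
    define a z where "a = (hnorm H w)\<^sup>2" and "z = ip H (x - p) w / of_real a"
    have a: "a > 0" using False WH[OF w] by (simp add: a_def hnorm_eq_0_iff)
    have "p + smul H z w \<in> W" using w pW sub by (simp add: subspace_add subspace_scale)
    then have "m \<le> (hnorm H ((x - p) - smul H z w))\<^sup>2"
      using m_le by (metis diff_diff_eq)
    also have "\<dots> = (hnorm H (x - p))\<^sup>2 + (cmod z)\<^sup>2 * a - 2 * Re (cnj z * ip H (x - p) w)"
      using x p WH[OF w] by (simp add: hnorm_diff_sq hnorm_smul ip_smul_right a_def power_mult_distrib)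
    also have "cnj z * ip H (x - p) w = of_real ((cmod (ip H (x - p) w))\<^sup>2 / a)"
      unfolding z_def of_real_divide complex_norm_square by simp
    also have "(cmod z)\<^sup>2 * a = (cmod (ip H (x - p) w))\<^sup>2 / a"
      using a by (simp add: z_def norm_divide power_divide power2_eq_square)
    finally have "(cmod (ip H (x - p) w))\<^sup>2 / a \<le> 0"
      using pm by simp
    then show ?thesis
      using a by (simp add: divide_le_0_iff)
  qed
  then show thesis using that pW by blast
qed

end

section \<open>Unitary representations\<close>

locale group_representation = complex_hilbert_space H + G: group G
  for G :: "('g, 'm) monoid_scheme" (structure) and H :: "'h::ab_group_add hilbert"
    and \<pi> :: "'g \<Rightarrow> 'h \<Rightarrow> 'h" +
  assumes rep: "unitary_rep G H \<pi>"
begin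

lemma rep_unitary: "g \<in> carrier G \<Longrightarrow> unitary_map H H (\<pi> g)"
  using rep by (simp add: unitary_rep_def)

lemma rep_mem [simp]: "g \<in> carrier G \<Longrightarrow> v \<in> carrier H \<Longrightarrow> \<pi> g v \<in> carrier H"
  using rep_unitary[of g] by (auto simp: unitary_map_def bij_betw_def)

lemma rep_add: "g \<in> carrier G \<Longrightarrow> u \<in> carrier H \<Longrightarrow> v \<in> carrier H \<Longrightarrow> \<pi> g (u + v) = \<pi> g u + \<pi> g v"
  using rep_unitary[of g] by (auto simp: unitary_map_def)

lemma rep_smul: "g \<in> carrier G \<Longrightarrow> v \<in> carrier H \<Longrightarrow> \<pi> g (smul H c v) = smul H c (\<pi> g v)"
  using rep_unitary[of g] by (auto simp: unitary_map_def)

lemma rep_ip: "g \<in> carrier G \<Longrightarrow> u \<in> carrier H \<Longrightarrow> v \<in> carrier H \<Longrightarrow> ip H (\<pi> g u) (\<pi> g v) = ip H u v"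
  using rep_unitary[of g] by (auto simp: unitary_map_def)

lemma rep_one [simp]: "v \<in> carrier H \<Longrightarrow> \<pi> \<one> v = v"
  using rep by (simp add: unitary_rep_def)

lemma rep_mult:
  "g \<in> carrier G \<Longrightarrow> h \<in> carrier G \<Longrightarrow> v \<in> carrier H \<Longrightarrow> \<pi> (g \<otimes> h) v = \<pi> g (\<pi> h v)"
  using rep by (simp add: unitary_rep_def)

lemma rep_zero [simp]: "g \<in> carrier G \<Longrightarrow> \<pi> g 0 = 0"
  using rep_smul[of g 0 0] by simp

lemma rep_diff:
  assumes "g \<in> carrier G" "u \<in> carrier H" "v \<in> carrier H"
  shows "\<pi> g (u - v) = \<pi> g u - \<pi> g v"
  using rep_add[of g "u - v" v] assms by (simp add: algebra_simps)

lemma rep_sum: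
  assumes "g \<in> carrier G" "\<And>i. i \<in> A \<Longrightarrow> f i \<in> carrier H"
  shows "\<pi> g (sum f A) = (\<Sum>i\<in>A. \<pi> g (f i))"
  using assms by (induction A rule: infinite_finite_induct) (auto simp: rep_add sum_mem)

lemma rep_hnorm: "g \<in> carrier G \<Longrightarrow> v \<in> carrier H \<Longrightarrow> hnorm H (\<pi> g v) = hnorm H v"
  by (simp add: hnorm_def rep_ip)

lemma rep_inv_left [simp]: "g \<in> carrier G \<Longrightarrow> v \<in> carrier H \<Longrightarrow> \<pi> (inv g) (\<pi> g v) = v"
  by (simp add: rep_mult[symmetric])

lemma rep_inv_right [simp]: "g \<in> carrier G \<Longrightarrow> v \<in> carrier H \<Longrightarrow> \<pi> g (\<pi> (inv g) v) = v"
  by (simp add: rep_mult[symmetric])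

lemma rep_adjoint:
  "g \<in> carrier G \<Longrightarrow> u \<in> carrier H \<Longrightarrow> v \<in> carrier H \<Longrightarrow> ip H (\<pi> g u) v = ip H u (\<pi> (inv g) v)"
  using rep_ip[of g u "\<pi> (inv g) v"] by simp

end

lemma unitary_rep_imp_group_representation:
  "group G \<Longrightarrow> unitary_rep G H \<pi> \<Longrightarrow> group_representation G H \<pi>"
  by (simp add: group_representation_def group_representation_axioms_def unitary_rep_def)

text \<open>
  Bijectivity of \<open>\<pi> g\<close> follows from the group laws, as \<open>\<pi> (inv g)\<close> is an inverse.
\<close>

lemma group_representationI:
  fixes G (structure)
  assumes G: "group G" and H: "complex_hilbert_space H"
    and mem: "\<And>g v. g \<in> carrier G \<Longrightarrow> v \<in> carrier H \<Longrightarrow> \<pi> g v \<in> carrier H"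
    and add: "\<And>g u v. g \<in> carrier G \<Longrightarrow> u \<in> carrier H \<Longrightarrow> v \<in> carrier H \<Longrightarrow> \<pi> g (u + v) = \<pi> g u + \<pi> g v"
    and smul: "\<And>g c v. g \<in> carrier G \<Longrightarrow> v \<in> carrier H \<Longrightarrow> \<pi> g (smul H c v) = smul H c (\<pi> g v)"
    and ip: "\<And>g u v. g \<in> carrier G \<Longrightarrow> u \<in> carrier H \<Longrightarrow> v \<in> carrier H \<Longrightarrow> ip H (\<pi> g u) (\<pi> g v) = ip H u v"
    and one: "\<And>v. v \<in> carrier H \<Longrightarrow> \<pi> \<one> v = v"
    and mult: "\<And>g h v. g \<in> carrier G \<Longrightarrow> h \<in> carrier G \<Longrightarrow> v \<in> carrier H \<Longrightarrow> \<pi> (g \<otimes> h) v = \<pi> g (\<pi> h v)"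
  shows "group_representation G H \<pi>"
proof -
  interpret G: group G by (rule G)
  have "bij_betw (\<pi> g) (carrier H) (carrier H)" if g: "g \<in> carrier G" for g
  proof (rule bij_betw_byWitness[where f' = "\<pi> (inv g)"])
    show "\<forall>v\<in>carrier H. \<pi> (inv g) (\<pi> g v) = v"
      using g by (simp add: mult[symmetric] one)
    show "\<forall>v\<in>carrier H. \<pi> g (\<pi> (inv g) v) = v"
      using g by (simp add: mult[symmetric] one)
  qed (use g mem in auto)
  then show ?thesis
    using assms by (intro unitary_rep_imp_group_representation)
      (auto simp: unitary_rep_def unitary_map_def)
qed

context group_representation
begin

lemma subrepresentation:
  assumes "closed_subspace H W" and inv: "\<And>g v. g \<in> carrier G \<Longrightarrow> v \<in> W \<Longrightarrow> \<pi> g v \<in> W"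
  shows "group_representation G (H\<lparr>carrier := W\<rparr>) \<pi>"
proof -
  have W: "w \<in> carrier H" if "w \<in> W" for w
    using assms that by (auto simp: closed_subspace_def)
  show ?thesis
    by (rule group_representationI)
      (auto simp: hilbert_space_closed_subspace assms W rep_add rep_smul rep_ip rep_mult G.is_group)
qed

definition invariants :: "'h set" where
  "invariants = {v \<in> carrier H. \<forall>g\<in>carrier G. \<pi> g v = v}"

lemma closed_subspace_invariants: "closed_subspace H invariants"
  unfolding closed_subspace_def
proof (intro conjI allI impI)
  show "subspace invariants"
    by (auto simp: subspace_def invariants_def rep_add rep_smul)
  show "invariants \<subseteq> carrier H" by (auto simp: invariants_def)
next
  fix X l
  assume X: "(\<forall>n. X n \<in> invariants) \<and> l \<in> carrier H \<and> (\<lambda>n. hnorm H (X n - l)) \<longlonglongrightarrow> 0"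
  then have XH: "X n \<in> carrier H" and Xinv: "g \<in> carrier G \<Longrightarrow> \<pi> g (X n) = X n" for n g
    by (auto simp: invariants_def)
  have l: "l \<in> carrier H" and lim: "(\<lambda>n. hnorm H (X n - l)) \<longlonglongrightarrow> 0" using X by auto
  have "\<pi> g l = l" if g: "g \<in> carrier G" for g
  proof -
    have le: "hnorm H (\<pi> g l - l) \<le> 2 * hnorm H (X n - l)" for n
    proof -
      have "hnorm H (\<pi> g l - l) \<le> hnorm H (\<pi> g l - X n) + hnorm H (X n - l)"
        using g l XH by (intro hnorm_triangle_diff) auto
      moreover have "hnorm H (\<pi> g l - X n) = hnorm H (X n - l)"
        using rep_hnorm[of g "l - X n"] g l XH[of n] Xinv[OF g, of n] hnorm_minus_commute[of l "X n"]
        by (simp add: rep_diff)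
      ultimately show ?thesis by simp
    qed
    have "(\<lambda>n. 2 * hnorm H (X n - l)) \<longlonglongrightarrow> 2 * 0"
      by (intro tendsto_mult tendsto_const lim)
    then have "hnorm H (\<pi> g l - l) \<le> 2 * 0"
      by (rule LIMSEQ_le_const) (use le in blast)
    moreover have "0 \<le> hnorm H (\<pi> g l - l)" using g l by simp
    ultimately show ?thesis
      using g l hnorm_eq_0_iff[of "\<pi> g l - l"] by simp
  qed
  then show "l \<in> invariants"
    using l by (simp add: invariants_def)
qed

text \<open>
  The closed linear span of the orbit.
\<close>

definition cyclic_space :: "'h \<Rightarrow> 'h set" where
  "cyclic_space x = orthogonal_complement (orthogonal_complement ((\<lambda>g. \<pi> g x) ` carrier G))"

lemma closed_subspace_cyclic_space: "x \<in> carrier H \<Longrightarrow> closed_subspace H (cyclic_space x)"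
  unfolding cyclic_space_def
  by (rule closed_subspace_orthogonal_complement) (auto simp: orthogonal_complement_def)

lemma cyclic_space_subset: "v \<in> cyclic_space x \<Longrightarrow> v \<in> carrier H"
  by (simp add: cyclic_space_def orthogonal_complement_def)

lemma orbit_in_cyclic_space:
  "x \<in> carrier H \<Longrightarrow> g \<in> carrier G \<Longrightarrow> \<pi> g x \<in> cyclic_space x"
  using ip_cnj[of _ "\<pi> g x"] by (auto simp: cyclic_space_def orthogonal_complement_def)

lemma generator_in_cyclic_space: "x \<in> carrier H \<Longrightarrow> x \<in> cyclic_space x"
  using orbit_in_cyclic_space[of x \<one>] by simp

lemma cyclic_space_invariant:
  assumes x: "x \<in> carrier H" and g: "g \<in> carrier G" and v: "v \<in> cyclic_space x"
  shows "\<pi> g v \<in> cyclic_space x"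
proof -
  let ?O = "orthogonal_complement ((\<lambda>g. \<pi> g x) ` carrier G)"
  have "\<pi> (inv g) w \<in> ?O" if "w \<in> ?O" for w
    using that g x rep_adjoint[of "inv g" w]
    by (auto simp: orthogonal_complement_def rep_mult[symmetric])
  then show ?thesis
    using v g by (auto simp: cyclic_space_def orthogonal_complement_def rep_adjoint)
qed

text \<open>
  Such a vector lies both in the orthogonal complement of the orbit and in its double complement.
  Hence the matrix coefficients with the orbit embed a cyclic space into the functions on the group,
  whatever type the Hilbert space is built on.
\<close>

lemma cyclic_space_eq_0:
  assumes "v \<in> cyclic_space x" "\<And>g. g \<in> carrier G \<Longrightarrow> ip H v (\<pi> g x) = 0"
  shows "v = 0"
proof -
  have "ip H v v = 0"
    using assms by (auto simp: cyclic_space_def orthogonal_complement_def)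
  then show ?thesis
    using ip_pos[of v] cyclic_space_subset[OF assms(1)] by auto
qed

lemma cyclic_subrepresentation:
  "x \<in> carrier H \<Longrightarrow> group_representation G (H\<lparr>carrier := cyclic_space x\<rparr>) \<pi>"
  by (intro subrepresentation closed_subspace_cyclic_space cyclic_space_invariant)

text \<open>
  A linear injection into any complex vector space carries the whole structure along, so the type
  that carries a Hilbert space can be exchanged.
\<close>

lemma transport:
  fixes J :: "'h \<Rightarrow> 'u::ab_group_add"
  assumes s: "vector_space s"
    and add: "\<And>u v. u \<in> carrier H \<Longrightarrow> v \<in> carrier H \<Longrightarrow> J (u + v) = J u + J v"
    and smul: "\<And>c v. v \<in> carrier H \<Longrightarrow> J (smul H c v) = s c (J v)"
    and ker: "\<And>v. v \<in> carrier H \<Longrightarrow> J v = 0 \<Longrightarrow> v = 0"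
  obtains H' \<pi>' where "group_representation G H' \<pi>'" "unitary_map H H' J"
    "\<And>g v. g \<in> carrier G \<Longrightarrow> v \<in> carrier H \<Longrightarrow> J (\<pi> g v) = \<pi>' g (J v)"
proof -
  have diff: "J (u - v) = J u - J v" if "u \<in> carrier H" "v \<in> carrier H" for u v
    using add[of "u - v" v] that by simp
  have inj: "inj_on J (carrier H)"
  proof (rule inj_onI)
    fix u v assume "u \<in> carrier H" "v \<in> carrier H" "J u = J v"
    then have "u - v = 0" by (intro ker) (simp_all add: diff)
    then show "u = v" by simp
  qed
  define I where "I = the_inv_into (carrier H) J"
  have IJ [simp]: "I (J v) = v" if "v \<in> carrier H" for v
    using that inj by (simp add: I_def the_inv_into_f_f)
  define H' where "H' = \<lparr>carrier = J ` carrier H, smul = s, ip = (\<lambda>a b. ip H (I a) (I b))\<rparr>"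
  define \<pi>' where "\<pi>' = (\<lambda>g a. J (\<pi> g (I a)))"
  have carr: "carrier H' = J ` carrier H" and sm: "smul H' = s"
    and ipJ: "\<And>u v. u \<in> carrier H \<Longrightarrow> v \<in> carrier H \<Longrightarrow> ip H' (J u) (J v) = ip H u v"
    by (auto simp: H'_def)
  have nrm: "hnorm H' (J v) = hnorm H v" if "v \<in> carrier H" for v
    using that by (simp add: hnorm_def ipJ)
  interpret S: vector_space s by (rule s)
  have J0: "J 0 = 0" using add[of 0 0] by simp
  have "complex_hilbert_space H'"
    unfolding complex_hilbert_space_def complex_hilbert_space_axioms_def sm carr
  proof (intro conjI allI impI)
    show "vector_space s" by (rule s)
    show "S.subspace (J ` carrier H)"
      unfolding S.subspace_def
    proof (intro conjI ballI allI)
      show "0 \<in> J ` carrier H" using J0 by (intro image_eqI[of _ _ 0]) auto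
    next
      fix a b assume "a \<in> J ` carrier H" "b \<in> J ` carrier H"
      then show "a + b \<in> J ` carrier H" by (auto simp: add[symmetric])
    next
      fix c a assume "a \<in> J ` carrier H"
      then show "s c a \<in> J ` carrier H" by (auto simp: smul[symmetric])
    qed
  next
    fix X :: "nat \<Rightarrow> 'u"
    assume X: "\<forall>n. X n \<in> J ` carrier H"
      and Cauchy: "\<forall>e>0. \<exists>N. \<forall>m\<ge>N. \<forall>n\<ge>N. hnorm H' (X m - X n) < e"
    then have "\<forall>n. \<exists>y. y \<in> carrier H \<and> X n = J y" by blast
    then obtain Y where Y: "\<And>n. Y n \<in> carrier H" "\<And>n. X n = J (Y n)"
      by metis
    have "\<forall>e>0. \<exists>N. \<forall>m\<ge>N. \<forall>n\<ge>N. hnorm H (Y m - Y n) < e"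
      using Cauchy Y by (simp add: diff[symmetric] nrm)
    then obtain l where "l \<in> carrier H" "(\<lambda>n. hnorm H (Y n - l)) \<longlonglongrightarrow> 0"
      using complete Y by blast
    then show "\<exists>l\<in>J ` carrier H. (\<lambda>n. hnorm H' (X n - l)) \<longlonglongrightarrow> 0"
      using Y by (intro bexI[of _ "J l"]) (auto simp: diff[symmetric] nrm)
  next
    fix a assume "a \<in> J ` carrier H" "a \<noteq> 0"
    then show "0 < Re (ip H' a a)" using J0 by (auto simp: ipJ intro!: ip_pos)
  qed (auto simp: add[symmetric] smul[symmetric] ipJ ip_add_left ip_smul_left intro: ip_cnj)
  then have "group_representation G H' \<pi>'"
    by (intro group_representationI)
      (auto simp: carr sm \<pi>'_def add[symmetric] smul[symmetric] ipJ rep_add rep_smul rep_ip rep_mult G.is_group)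
  moreover have "unitary_map H H' J"
    using inj by (auto simp: unitary_map_def bij_betw_def carr sm add smul ipJ)
  moreover have "J (\<pi> g v) = \<pi>' g (J v)" if "v \<in> carrier H" for g v
    using that by (simp add: \<pi>'_def)
  ultimately show thesis using that by blast
qed

end

lemma vector_space_pointwise: "vector_space (\<lambda>(c::complex) (f :: 'i \<Rightarrow> complex) i. c * f i)"
  by unfold_locales (auto simp: fun_eq_iff algebra_simps)

lemma unitary_map_hnorm: "unitary_map H K T \<Longrightarrow> v \<in> carrier H \<Longrightarrow> hnorm K (T v) = hnorm H v"
  by (simp add: unitary_map_def hnorm_def)

lemma unitary_map_mem: "unitary_map H K T \<Longrightarrow> v \<in> carrier H \<Longrightarrow> T v \<in> carrier K"
  by (auto simp: unitary_map_def bij_betw_def)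

lemma unitary_map_diff:
  assumes "unitary_map H K T" "complex_hilbert_space H" "u \<in> carrier H" "v \<in> carrier H"
  shows "T (u - v) = T u - T v"
proof -
  interpret complex_hilbert_space H by fact
  have "T ((u - v) + v) = T (u - v) + T v"
    using assms diff_mem[of u v] unfolding unitary_map_def by blast
  then show ?thesis by (simp add: algebra_simps)
qed

text \<open>
  Property (T) speaks about Hilbert spaces inside one type. It extends to a representation over any
  type as soon as its space embeds linearly into that type.
\<close>

lemma kazhdan_group_invariant_vector:
  fixes G :: "('g, 'm) monoid_scheme" and J :: "'h::ab_group_add \<Rightarrow> 'g universe"
  assumes T: "kazhdan_group G" and rep: "group_representation G H \<pi>"
    and add: "\<And>u v. u \<in> carrier H \<Longrightarrow> v \<in> carrier H \<Longrightarrow> J (u + v) = J u + J v"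
    and smul: "\<And>c v. v \<in> carrier H \<Longrightarrow> J (smul H c v) = (\<lambda>i. c * J v i)"
    and ker: "\<And>v. v \<in> carrier H \<Longrightarrow> J v = 0 \<Longrightarrow> v = 0"
    and ai: "almost_invariant_vectors G H \<pi>"
  shows "has_invariant_vector G H \<pi>"
proof -
  interpret group_representation G H \<pi> by (rule rep)
  obtain H' \<pi>' where rep': "group_representation G H' \<pi>'" and J: "unitary_map H H' J"
    and eq: "\<And>g v. g \<in> carrier G \<Longrightarrow> v \<in> carrier H \<Longrightarrow> J (\<pi> g v) = \<pi>' g (J v)"
    using transport[OF vector_space_pointwise, of J] add smul ker by blast
  interpret P: group_representation G H' \<pi>' by (rule rep')
  have HH: "complex_hilbert_space H" by (rule complex_hilbert_space_axioms)
  have "almost_invariant_vectors G H' \<pi>'"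
    unfolding almost_invariant_vectors_def
  proof (intro allI impI)
    fix F :: "'g set" and e :: real
    assume F: "finite F \<and> F \<subseteq> carrier G \<and> 0 < e"
    then obtain v where v: "v \<in> carrier H" "hnorm H v = 1" "\<forall>g\<in>F. hnorm H (\<pi> g v - v) < e"
      using ai unfolding almost_invariant_vectors_def by blast
    have "hnorm H' (\<pi>' g (J v) - J v) = hnorm H (\<pi> g v - v)" if "g \<in> carrier G" for g
    proof -
      have "\<pi>' g (J v) - J v = J (\<pi> g v - v)"
        using that v unitary_map_diff[OF J HH, of "\<pi> g v" v] by (simp add: eq)
      then show ?thesis
        using that v unitary_map_hnorm[OF J] by simp
    qed
    then show "\<exists>\<xi>\<in>carrier H'. hnorm H' \<xi> = 1 \<and> (\<forall>g\<in>F. hnorm H' (\<pi>' g \<xi> - \<xi>) < e)"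
      using v F unitary_map_hnorm[OF J] unitary_map_mem[OF J]
      by (intro bexI[of _ "J v"]) (auto simp: subset_iff)
  qed
  then have "has_invariant_vector G H' \<pi>'"
    using T P.rep by (auto simp: kazhdan_group_def)
  then obtain w where w: "w \<in> carrier H'" "w \<noteq> 0" "\<forall>g\<in>carrier G. \<pi>' g w = w"
    by (auto simp: has_invariant_vector_def)
  have "w \<in> J ` carrier H"
    using J w by (simp add: unitary_map_def bij_betw_def)
  then obtain v where v: "v \<in> carrier H" "w = J v"
    by blast
  have "\<pi> g v = v" if g: "g \<in> carrier G" for g
  proof -
    have "J (\<pi> g v) = J v" using eq[OF g v(1)] w(3) g v(2) by simp
    moreover have "inj_on J (carrier H)" using J by (simp add: unitary_map_def bij_betw_def)
    ultimately show ?thesis using g v by (auto dest: inj_onD)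
  qed
  moreover have "v \<noteq> 0"
  proof
    assume "v = 0"
    moreover have "J 0 = 0" using add[of 0 0] by simp
    ultimately show False using v w by simp
  qed
  ultimately show ?thesis
    using v by (auto simp: has_invariant_vector_def)
qed

section \<open>Direct sums\<close>

definition direct_sum :: "(nat \<Rightarrow> 't::ab_group_add hilbert) \<Rightarrow> (nat \<Rightarrow> 't) hilbert" where
  "direct_sum Hs =
     \<lparr>carrier = {f. (\<forall>n. f n \<in> carrier (Hs n)) \<and> summable (\<lambda>n. (hnorm (Hs n) (f n))\<^sup>2)},
      smul = (\<lambda>c f n. smul (Hs n) c (f n)),
      ip = (\<lambda>f g. \<Sum>n. ip (Hs n) (f n) (g n))\<rparr>"

lemma direct_sum_simps:
  "f \<in> carrier (direct_sum Hs) \<longleftrightarrow>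
     (\<forall>n. f n \<in> carrier (Hs n)) \<and> summable (\<lambda>n. (hnorm (Hs n) (f n))\<^sup>2)"
  "smul (direct_sum Hs) = (\<lambda>c f n. smul (Hs n) c (f n))"
  "ip (direct_sum Hs) f g = (\<Sum>n. ip (Hs n) (f n) (g n))"
  by (simp_all add: direct_sum_def)

lemma
  assumes Hs: "\<And>n. complex_hilbert_space (Hs n)" and f: "f \<in> carrier (direct_sum Hs)"
  shows direct_sum_hnorm_sq: "(hnorm (direct_sum Hs) f)\<^sup>2 = (\<Sum>n. (hnorm (Hs n) (f n))\<^sup>2)"
    and direct_sum_hnorm_nonneg: "0 \<le> hnorm (direct_sum Hs) f"
    and direct_sum_component_le: "hnorm (Hs n) (f n) \<le> hnorm (direct_sum Hs) f"
proof -
  have fn: "f n \<in> carrier (Hs n)" and sm: "summable (\<lambda>n. (hnorm (Hs n) (f n))\<^sup>2)" for n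
    using f by (auto simp: direct_sum_simps)
  have "ip (Hs n) (f n) (f n) = of_real ((hnorm (Hs n) (f n))\<^sup>2)" for n
    using complex_hilbert_space.ip_self[OF Hs fn] .
  then have "ip (direct_sum Hs) f f = of_real (\<Sum>n. (hnorm (Hs n) (f n))\<^sup>2)"
    using suminf_of_real[OF sm, where 'a=complex] by (simp add: direct_sum_simps)
  moreover have "0 \<le> (\<Sum>n. (hnorm (Hs n) (f n))\<^sup>2)"
    by (intro suminf_nonneg sm) auto
  ultimately show eq: "(hnorm (direct_sum Hs) f)\<^sup>2 = (\<Sum>n. (hnorm (Hs n) (f n))\<^sup>2)"
    by (simp add: hnorm_def)
  show nonneg: "0 \<le> hnorm (direct_sum Hs) f"
    using \<open>ip (direct_sum Hs) f f = _\<close> \<open>0 \<le> (\<Sum>n. (hnorm (Hs n) (f n))\<^sup>2)\<close>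
    by (simp add: hnorm_def)
  have "(hnorm (Hs n) (f n))\<^sup>2 = (\<Sum>k\<in>{n}. (hnorm (Hs k) (f k))\<^sup>2)"
    by simp
  also have "\<dots> \<le> (hnorm (direct_sum Hs) f)\<^sup>2"
    unfolding eq by (intro sum_le_suminf sm) auto
  finally show "hnorm (Hs n) (f n) \<le> hnorm (direct_sum Hs) f"
    by (rule power2_le_imp_le) (rule nonneg)
qed

lemma direct_sum_ip_summable:
  assumes Hs: "\<And>n. complex_hilbert_space (Hs n)"
    and f: "f \<in> carrier (direct_sum Hs)" and g: "g \<in> carrier (direct_sum Hs)"
  shows "summable (\<lambda>n. ip (Hs n) (f n) (g n))"
proof (rule summable_comparison_test')
  show "summable (\<lambda>n. (hnorm (Hs n) (f n))\<^sup>2 + (hnorm (Hs n) (g n))\<^sup>2)"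
    using f g by (intro summable_add) (auto simp: direct_sum_simps)
  fix n
  interpret complex_hilbert_space "Hs n" by (rule Hs)
  have fg: "f n \<in> carrier (Hs n)" "g n \<in> carrier (Hs n)"
    using f g by (auto simp: direct_sum_simps)
  have "cmod (ip (Hs n) (f n) (g n)) \<le> hnorm (Hs n) (f n) * hnorm (Hs n) (g n)"
    using fg by (rule cauchy_schwarz)
  also have "\<dots> \<le> (hnorm (Hs n) (f n))\<^sup>2 + (hnorm (Hs n) (g n))\<^sup>2"
    using sum_squares_bound[of "hnorm (Hs n) (f n)" "hnorm (Hs n) (g n)"] fg
      mult_nonneg_nonneg[OF hnorm_nonneg hnorm_nonneg, of "f n" "g n"] by linarith
  finally show "cmod (ip (Hs n) (f n) (g n)) \<le> (hnorm (Hs n) (f n))\<^sup>2 + (hnorm (Hs n) (g n))\<^sup>2" .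
qed

lemma direct_sum_add_mem:
  assumes Hs: "\<And>n. complex_hilbert_space (Hs n)"
    and f: "f \<in> carrier (direct_sum Hs)" and g: "g \<in> carrier (direct_sum Hs)"
  shows "f + g \<in> carrier (direct_sum Hs)"
proof -
  have fg: "f n \<in> carrier (Hs n)" "g n \<in> carrier (Hs n)" for n
    using f g by (auto simp: direct_sum_simps)
  have "summable (\<lambda>n. (hnorm (Hs n) (f n + g n))\<^sup>2)"
  proof (rule summable_comparison_test')
    show "summable (\<lambda>n. 2 * (hnorm (Hs n) (f n))\<^sup>2 + 2 * (hnorm (Hs n) (g n))\<^sup>2)"
      using f g by (intro summable_add summable_mult) (auto simp: direct_sum_simps)
    fix n
    interpret complex_hilbert_space "Hs n" by (rule Hs)
    have "(hnorm (Hs n) (f n + g n))\<^sup>2 + (hnorm (Hs n) (f n - g n))\<^sup>2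
        = 2 * (hnorm (Hs n) (f n))\<^sup>2 + 2 * (hnorm (Hs n) (g n))\<^sup>2"
      using fg by (simp add: hnorm_add_sq hnorm_diff_sq)
    then have "(hnorm (Hs n) (f n + g n))\<^sup>2
        \<le> 2 * (hnorm (Hs n) (f n))\<^sup>2 + 2 * (hnorm (Hs n) (g n))\<^sup>2"
      using zero_le_power2[of "hnorm (Hs n) (f n - g n)"] by linarith
    then show "norm ((hnorm (Hs n) (f n + g n))\<^sup>2)
        \<le> 2 * (hnorm (Hs n) (f n))\<^sup>2 + 2 * (hnorm (Hs n) (g n))\<^sup>2"
      by simp
  qed
  moreover have "f n + g n \<in> carrier (Hs n)" for n
    using complex_hilbert_space.add_mem[OF Hs] fg by blast
  ultimately show ?thesis by (simp add: direct_sum_simps)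
qed

lemma direct_sum_smul_mem:
  assumes Hs: "\<And>n. complex_hilbert_space (Hs n)" and f: "f \<in> carrier (direct_sum Hs)"
  shows "smul (direct_sum Hs) c f \<in> carrier (direct_sum Hs)"
proof -
  have fn: "f n \<in> carrier (Hs n)" for n
    using f by (auto simp: direct_sum_simps)
  have "summable (\<lambda>n. (cmod c)\<^sup>2 * (hnorm (Hs n) (f n))\<^sup>2)"
    using f by (intro summable_mult) (auto simp: direct_sum_simps)
  moreover have "smul (Hs n) c (f n) \<in> carrier (Hs n)" for n
    using complex_hilbert_space.smul_mem[OF Hs] fn by blast
  ultimately show ?thesis
    using complex_hilbert_space.hnorm_smul[OF Hs fn] by (simp add: direct_sum_simps power_mult_distrib)
qed

text \<open>
  Componentwise limits exist, and every partial sum of \<open>\<parallel>X\<^sub>i - l\<parallel>\<^sup>2\<close> is a limit of partial sums of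
  \<open>\<parallel>X\<^sub>i - X\<^sub>j\<parallel>\<^sup>2\<close>, so the Cauchy estimate passes to the limit.
\<close>

lemma direct_sum_complete:
  assumes Hs: "\<And>n. complex_hilbert_space (Hs n)"
    and X: "\<And>i. X i \<in> carrier (direct_sum Hs)"
    and Cauchy: "\<forall>e>0. \<exists>N. \<forall>i\<ge>N. \<forall>j\<ge>N. hnorm (direct_sum Hs) (X i - X j) < e"
  shows "\<exists>l\<in>carrier (direct_sum Hs). (\<lambda>i. hnorm (direct_sum Hs) (X i - l)) \<longlonglongrightarrow> 0"
proof -
  let ?D = "direct_sum Hs"
  have diff_mem: "f - g \<in> carrier ?D" if "f \<in> carrier ?D" "g \<in> carrier ?D" for f g
  proof -
    have "smul ?D (-1) g = - g"
      using module.scale_minus_left[of "smul (Hs n)" 1 "g n" for n] Hs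
      by (auto simp: direct_sum_simps fun_eq_iff complex_hilbert_space_def vector_space_def
          module_def module.scale_minus_left)
    then have "f + smul ?D (-1) g = f - g" by simp
    then show ?thesis
      using direct_sum_add_mem[OF Hs that(1) direct_sum_smul_mem[OF Hs that(2), of "-1"]] by simp
  qed
  have Xn: "X i n \<in> carrier (Hs n)" for i n using X by (auto simp: direct_sum_simps)
  have "\<exists>l\<in>carrier (Hs n). (\<lambda>i. hnorm (Hs n) (X i n - l)) \<longlonglongrightarrow> 0" for n
  proof (rule complex_hilbert_space.complete[OF Hs])
    show "X i n \<in> carrier (Hs n)" for i by (rule Xn)
    have "hnorm (Hs n) (X i n - X j n) \<le> hnorm ?D (X i - X j)" for i j
      using direct_sum_component_le[OF Hs diff_mem[OF X X], of n i j] by simp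
    then show "\<forall>e>0. \<exists>N. \<forall>i\<ge>N. \<forall>j\<ge>N. hnorm (Hs n) (X i n - X j n) < e"
      using Cauchy by (meson le_less_trans)
  qed
  then obtain l where l: "\<And>n. l n \<in> carrier (Hs n)"
    and lim: "\<And>n. (\<lambda>i. hnorm (Hs n) (X i n - l n)) \<longlonglongrightarrow> 0"
    by metis
  have tail: "X i - l \<in> carrier ?D \<and> hnorm ?D (X i - l) \<le> e"
    if e: "e > 0" and N: "\<forall>j\<ge>N. hnorm ?D (X i - X j) < e" for e N i
  proof -
    have part: "(\<Sum>n<M. (hnorm (Hs n) (X i n - l n))\<^sup>2) \<le> e\<^sup>2" for M
    proof (rule LIMSEQ_le_const2)
      have "(\<lambda>j. hnorm (Hs n) (X i n - X j n)) \<longlonglongrightarrow> hnorm (Hs n) (X i n - l n)" for n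
      proof -
        interpret complex_hilbert_space "Hs n" by (rule Hs)
        have "hnorm (Hs n) ((X i n - X j n) - (X i n - l n)) = hnorm (Hs n) (X j n - l n)" for j
          using hnorm_minus_commute[OF l Xn[of j]] by simp
        then show ?thesis
          by (intro tendsto_hnorm) (auto simp: lim l Xn)
      qed
      then show "(\<lambda>j. \<Sum>n<M. (hnorm (Hs n) (X i n - X j n))\<^sup>2)
          \<longlonglongrightarrow> (\<Sum>n<M. (hnorm (Hs n) (X i n - l n))\<^sup>2)"
        by (intro tendsto_sum tendsto_power)
      have "(\<Sum>n<M. (hnorm (Hs n) (X i n - X j n))\<^sup>2) \<le> e\<^sup>2" if "j \<ge> N" for j
      proof -
        have D: "X i - X j \<in> carrier ?D" by (intro diff_mem X)
        have "(\<Sum>n<M. (hnorm (Hs n) ((X i - X j) n))\<^sup>2) \<le> (hnorm ?D (X i - X j))\<^sup>2"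
          unfolding direct_sum_hnorm_sq[OF Hs D]
          using D by (intro sum_le_suminf) (auto simp: direct_sum_simps)
        also have "0 \<le> hnorm ?D (X i - X j)"
          by (rule direct_sum_hnorm_nonneg[OF Hs D])
        then have "(hnorm ?D (X i - X j))\<^sup>2 \<le> e\<^sup>2"
          using N that by (intro power_mono) (auto intro: less_imp_le)
        finally show ?thesis by simp
      qed
      then show "\<exists>N. \<forall>j\<ge>N. (\<Sum>n<M. (hnorm (Hs n) (X i n - X j n))\<^sup>2) \<le> e\<^sup>2" by blast
    qed
    have sm: "summable (\<lambda>n. (hnorm (Hs n) (X i n - l n))\<^sup>2)"
      by (rule summableI_nonneg_bounded[OF _ part]) auto
    have mem: "X i - l \<in> carrier ?D"
      using sm complex_hilbert_space.diff_mem[OF Hs Xn l] by (simp add: direct_sum_simps)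
    have "(hnorm ?D (X i - l))\<^sup>2 \<le> e\<^sup>2"
      unfolding direct_sum_hnorm_sq[OF Hs mem] using suminf_le_const[OF sm part] by simp
    then show ?thesis
      using mem e by (auto intro: power2_le_imp_le)
  qed
  have tail': "\<exists>N. \<forall>i\<ge>N. X i - l \<in> carrier ?D \<and> hnorm ?D (X i - l) \<le> e" if "e > 0" for e
    using Cauchy tail that by meson
  have "l \<in> carrier ?D"
  proof -
    obtain i where "X i - l \<in> carrier ?D" using tail'[of 1] by auto
    then show ?thesis using diff_mem[OF X, of "X i - l" i] by simp
  qed
  moreover have "(\<lambda>i. hnorm ?D (X i - l)) \<longlonglongrightarrow> 0"
  proof (rule LIMSEQ_I)
    fix e :: real assume "e > 0"
    then obtain N where N: "\<And>i. i \<ge> N \<Longrightarrow> X i - l \<in> carrier ?D \<and> hnorm ?D (X i - l) \<le> e / 2"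
      using tail'[of "e / 2"] by auto
    have "0 \<le> hnorm ?D (X i - l)" if "i \<ge> N" for i
      using direct_sum_hnorm_nonneg[of Hs, OF Hs] N[OF that] by blast
    then show "\<exists>N. \<forall>i\<ge>N. norm (hnorm ?D (X i - l) - 0) < e"
      using N \<open>e > 0\<close> by (intro exI[of _ N]) fastforce
  qed
  ultimately show ?thesis by blast
qed

lemma complex_hilbert_space_direct_sum:
  assumes Hs: "\<And>n. complex_hilbert_space (Hs n)"
  shows "complex_hilbert_space (direct_sum Hs)"
proof -
  let ?D = "direct_sum Hs"
  have mem: "f n \<in> carrier (Hs n)" if "f \<in> carrier ?D" for f n
    using that by (simp add: direct_sum_simps)
  have vs: "vector_space (smul (Hs n))" for n
    using Hs by (simp add: complex_hilbert_space_def)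
  have vsD: "vector_space (smul ?D)"
    unfolding vector_space_def direct_sum_simps
    using vs by (auto simp: fun_eq_iff vector_space_def)
  interpret V: vector_space "smul ?D" by (rule vsD)
  note sm = direct_sum_ip_summable[OF Hs]
  show ?thesis
    unfolding complex_hilbert_space_def complex_hilbert_space_axioms_def
  proof (intro conjI allI impI)
    show "vector_space (smul ?D)" by (rule vsD)
    have "0 \<in> carrier ?D"
      using complex_hilbert_space.zero_mem[OF Hs] complex_hilbert_space.hnorm_zero[OF Hs]
      by (simp add: direct_sum_simps)
    then show "V.subspace (carrier ?D)"
      by (simp add: V.subspace_def direct_sum_add_mem[OF Hs] direct_sum_smul_mem[OF Hs])
  next
    fix u v w assume u: "u \<in> carrier ?D" and v: "v \<in> carrier ?D" and w: "w \<in> carrier ?D"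
    then show "ip ?D (u + v) w = ip ?D u w + ip ?D v w"
      using suminf_add[OF sm[OF u w] sm[OF v w]] complex_hilbert_space.ip_add_left[OF Hs mem mem mem]
      by (simp add: direct_sum_simps(3))
  next
    fix c u v assume u: "u \<in> carrier ?D" and v: "v \<in> carrier ?D"
    then show "ip ?D (smul ?D c u) v = c * ip ?D u v"
      using suminf_mult[OF sm[OF u v], of c] complex_hilbert_space.ip_smul_left[OF Hs mem mem]
      by (simp add: direct_sum_simps(2,3))
  next
    fix u v assume u: "u \<in> carrier ?D" and v: "v \<in> carrier ?D"
    have "(\<lambda>n. cnj (ip (Hs n) (u n) (v n))) sums cnj (ip ?D u v)"
      using summable_sums[OF sm[OF u v]] by (simp add: sums_cnj direct_sum_simps(3))
    moreover have "cnj (ip (Hs n) (u n) (v n)) = ip (Hs n) (v n) (u n)" for n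
      using complex_hilbert_space.ip_cnj[OF Hs mem[OF u] mem[OF v], of n] by simp
    ultimately show "ip ?D v u = cnj (ip ?D u v)"
      by (simp add: direct_sum_simps(3) sums_iff)
  next
    fix v assume v: "v \<in> carrier ?D" and "v \<noteq> 0"
    then obtain n where n: "v n \<noteq> 0" by (auto simp: fun_eq_iff)
    interpret complex_hilbert_space "Hs n" by (rule Hs)
    have "0 < hnorm (Hs n) (v n)"
      using hnorm_eq_0_iff[OF mem[OF v]] hnorm_nonneg[OF mem[OF v]] n by (simp add: less_le)
    also have "\<dots> \<le> hnorm ?D v" by (rule direct_sum_component_le[OF Hs v])
    finally show "0 < Re (ip ?D v v)" by (simp add: hnorm_def)
  next
    fix X :: "nat \<Rightarrow> nat \<Rightarrow> 'a"
    assume "\<forall>n. X n \<in> carrier ?D"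
      "\<forall>e>0. \<exists>N. \<forall>m\<ge>N. \<forall>n\<ge>N. hnorm ?D (X m - X n) < e"
    then show "\<exists>l\<in>carrier ?D. (\<lambda>n. hnorm ?D (X n - l)) \<longlonglongrightarrow> 0"
      by (intro direct_sum_complete[OF Hs]) auto
  qed
qed

lemma group_representation_direct_sum:
  assumes reps: "\<And>n. group_representation G (Hs n) (\<pi>s n)"
  shows "group_representation G (direct_sum Hs) (\<lambda>g f n. \<pi>s n g (f n))"
proof -
  have Hs: "complex_hilbert_space (Hs n)" for n
    using reps[of n] by (simp add: group_representation_def)
  have mem: "f n \<in> carrier (Hs n)" if "f \<in> carrier (direct_sum Hs)" for f n
    using that by (simp add: direct_sum_simps)
  have "group G"
    using reps[of 0] by (simp add: group_representation_def)
  then show ?thesis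
    using group_representation.rep_hnorm[OF reps] group_representation.rep_mem[OF reps] mem
      group_representation.rep_add[OF reps] group_representation.rep_smul[OF reps]
      group_representation.rep_ip[OF reps] group_representation.rep_one[OF reps]
      group_representation.rep_mult[OF reps]
    by (intro group_representationI complex_hilbert_space_direct_sum[OF Hs])
      (auto simp: direct_sum_simps fun_eq_iff)
qed

section \<open>Kazhdan constants\<close>

text \<open>
  The constant is the length of a word for \<open>g\<close> in the generators, so it is the same for all
  representations.
\<close>

lemma generated_displacement_bound:
  fixes S :: "'g set" and G :: "('g, 'm) monoid_scheme"
  assumes S: "S \<subseteq> carrier G" and g: "g \<in> generate G S"
  shows "\<exists>C\<ge>0. \<forall>(H :: 'h::ab_group_add hilbert) \<pi> \<xi> r. group_representation G H \<pi> \<longrightarrow> \<xi> \<in> carrier H \<longrightarrow>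
           (\<forall>s\<in>S. hnorm H (\<pi> s \<xi> - \<xi>) \<le> r) \<longrightarrow> hnorm H (\<pi> g \<xi> - \<xi>) \<le> C * r"
  using g
proof (induction rule: generate.induct)
  case one
  show ?case
    by (intro exI[of _ 0]) (auto simp: group_representation.rep_one
        complex_hilbert_space.hnorm_zero group_representation_def)
next
  case (incl h)
  then show ?case by (intro exI[of _ 1]) auto
next
  case (inv h)
  have "hnorm H (\<pi> (inv\<^bsub>G\<^esub> h) \<xi> - \<xi>) \<le> 1 * r"
    if R: "group_representation G H \<pi>" and xi: "\<xi> \<in> carrier H"
      and b: "\<forall>s\<in>S. hnorm H (\<pi> s \<xi> - \<xi>) \<le> r" for H :: "'h hilbert" and \<pi> \<xi> r
  proof -
    interpret group_representation G H \<pi> by (rule R)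
    have h: "h \<in> carrier G" using inv S by auto
    have "hnorm H (\<pi> (inv\<^bsub>G\<^esub> h) \<xi> - \<xi>) = hnorm H (\<pi> h (\<pi> (inv\<^bsub>G\<^esub> h) \<xi> - \<xi>))"
      using h xi by (intro rep_hnorm[symmetric]) auto
    also have "\<pi> h (\<pi> (inv\<^bsub>G\<^esub> h) \<xi> - \<xi>) = \<xi> - \<pi> h \<xi>"
      using h xi by (simp add: rep_diff)
    also have "hnorm H \<dots> = hnorm H (\<pi> h \<xi> - \<xi>)"
      using h xi by (intro hnorm_minus_commute) auto
    finally show ?thesis using b inv by auto
  qed
  then show ?case by (intro exI[of _ 1]) auto
next
  case (eng h1 h2)
  obtain C1 where C1: "C1 \<ge> 0" "\<And>(H :: 'h hilbert) \<pi> \<xi> r. group_representation G H \<pi> \<Longrightarrow> \<xi> \<in> carrier H \<Longrightarrow>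
           (\<forall>s\<in>S. hnorm H (\<pi> s \<xi> - \<xi>) \<le> r) \<Longrightarrow> hnorm H (\<pi> h1 \<xi> - \<xi>) \<le> C1 * r"
    using eng.IH(1) by blast
  obtain C2 where C2: "C2 \<ge> 0" "\<And>(H :: 'h hilbert) \<pi> \<xi> r. group_representation G H \<pi> \<Longrightarrow> \<xi> \<in> carrier H \<Longrightarrow>
           (\<forall>s\<in>S. hnorm H (\<pi> s \<xi> - \<xi>) \<le> r) \<Longrightarrow> hnorm H (\<pi> h2 \<xi> - \<xi>) \<le> C2 * r"
    using eng.IH(2) by blast
  have "hnorm H (\<pi> (h1 \<otimes>\<^bsub>G\<^esub> h2) \<xi> - \<xi>) \<le> (C1 + C2) * r"
    if R: "group_representation G H \<pi>" and xi: "\<xi> \<in> carrier H"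
      and b: "\<forall>s\<in>S. hnorm H (\<pi> s \<xi> - \<xi>) \<le> r" for H :: "'h hilbert" and \<pi> \<xi> r
  proof -
    interpret group_representation G H \<pi> by (rule R)
    have h: "h1 \<in> carrier G" "h2 \<in> carrier G"
      using eng.hyps G.generate_in_carrier[OF S] by auto
    have "hnorm H (\<pi> (h1 \<otimes>\<^bsub>G\<^esub> h2) \<xi> - \<xi>)
        \<le> hnorm H (\<pi> (h1 \<otimes>\<^bsub>G\<^esub> h2) \<xi> - \<pi> h1 \<xi>) + hnorm H (\<pi> h1 \<xi> - \<xi>)"
      using h xi by (intro hnorm_triangle_diff) auto
    also have "\<pi> (h1 \<otimes>\<^bsub>G\<^esub> h2) \<xi> - \<pi> h1 \<xi> = \<pi> h1 (\<pi> h2 \<xi> - \<xi>)"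
      using h xi by (simp add: rep_diff rep_mult)
    also have "hnorm H \<dots> = hnorm H (\<pi> h2 \<xi> - \<xi>)"
      using h xi by (intro rep_hnorm) auto
    finally show ?thesis
      using C1(2)[OF R xi b] C2(2)[OF R xi b] by (simp add: algebra_simps)
  qed
  then show ?case using C1(1) C2(1) by (intro exI[of _ "C1 + C2"]) auto
qed

text \<open>
  A vector that the generators move little but that is far from the invariant vectors yields a unit
  vector, its component orthogonal to the invariants, which generates a cyclic representation
  without invariant vectors.
\<close>

lemma (in group_representation) far_from_invariants:
  assumes S: "S \<subseteq> carrier G" and xi: "\<xi> \<in> carrier H" and r: "0 \<le> r" and k: "0 < k"
    and small: "\<forall>s\<in>S. hnorm H (\<pi> s \<xi> - \<xi>) \<le> k * r"
    and far: "\<And>\<zeta>. \<zeta> \<in> invariants \<Longrightarrow> r < hnorm H (\<xi> - \<zeta>)"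
  obtains u where "u \<in> carrier H" "hnorm H u = 1" "\<forall>s\<in>S. hnorm H (\<pi> s u - u) \<le> k"
    "\<And>v. v \<in> cyclic_space u \<Longrightarrow> v \<in> invariants \<Longrightarrow> v = 0"
proof -
  obtain p where p: "p \<in> invariants" and orth: "\<And>w. w \<in> invariants \<Longrightarrow> ip H (\<xi> - p) w = 0"
    using projection_exists[OF closed_subspace_invariants xi] by blast
  have pH: "p \<in> carrier H" and pinv: "\<And>g. g \<in> carrier G \<Longrightarrow> \<pi> g p = p"
    using p by (auto simp: invariants_def)
  define w where "w = \<xi> - p"
  have w: "w \<in> carrier H" using xi pH by (simp add: w_def)
  have rw: "r < hnorm H w" using far[OF p] by (simp add: w_def)
  define a where "a = inverse (hnorm H w)"
  have a: "a > 0" and aw: "a * hnorm H w = 1" using rw r by (auto simp: a_def)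
  define u where "u = smul H (of_real a) w"
  have u: "u \<in> carrier H" using w by (simp add: u_def)
  have "hnorm H u = 1" using w a aw by (simp add: u_def hnorm_smul)
  moreover have "hnorm H (\<pi> s u - u) \<le> k" if s: "s \<in> S" for s
  proof -
    have sG: "s \<in> carrier G" using s S by auto
    have "\<pi> s w - w = \<pi> s \<xi> - \<xi>"
      using sG xi pH by (simp add: w_def rep_diff pinv)
    then have "\<pi> s u - u = smul H (of_real a) (\<pi> s \<xi> - \<xi>)"
      using sG w by (simp add: u_def rep_smul scale_right_diff_distrib[symmetric])
    then have "hnorm H (\<pi> s u - u) = a * hnorm H (\<pi> s \<xi> - \<xi>)"
      using a sG xi by (simp add: hnorm_smul)
    also have "\<dots> \<le> a * (k * hnorm H w)"
      using small[rule_format, OF s] rw k a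
      by (intro mult_left_mono) (auto intro: order_trans[OF _ mult_left_mono[of r "hnorm H w" k]])
    also have "\<dots> = k * (a * hnorm H w)" by simp
    finally show ?thesis by (simp add: aw)
  qed
  moreover have "v = 0" if v: "v \<in> cyclic_space u" and vi: "v \<in> invariants" for v
  proof (rule cyclic_space_eq_0[OF v])
    fix g assume g: "g \<in> carrier G"
    have vH: "v \<in> carrier H" using vi by (simp add: invariants_def)
    have "ip H v (\<pi> g u) = cnj (ip H (\<pi> g u) v)"
      using g u vH by (intro ip_cnj) auto
    also have "ip H (\<pi> g u) v = ip H u (\<pi> (inv g) v)"
      using g u vH by (simp add: rep_adjoint)
    also have "\<dots> = ip H u v"
      using g vi by (simp add: invariants_def)
    also have "\<dots> = 0"
      using orth[OF vi] w vH by (simp add: u_def w_def[symmetric] ip_smul_left)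
    finally show "ip H v (\<pi> g u) = 0" by simp
  qed
  ultimately show thesis using that u by blast
qed

text \<open>
  If no \<open>k\<close> worked, there would be for each \<open>n\<close> a cyclic representation without invariant vectors in
  which the generators move some unit vector by at most \<open>1/(n+1)\<close>. Their direct sum almost has
  invariant vectors, and its matrix coefficients with the cyclic vectors embed it into the functions
  on \<open>G \<times> \<nat>\<close>, so property (T) provides a non-zero invariant vector. One of its components is then a
  non-zero invariant vector of a summand. Homogeneity in \<open>r\<close> makes the statement applicable to
  vectors that are not normalized.
\<close>

theorem kazhdan_constant_exists:
  fixes G :: "('g, 'm) monoid_scheme" and S :: "'g set"
  assumes T: "kazhdan_group G" and S: "S \<subseteq> carrier G" and gen: "generate G S = carrier G"
  obtains k where "k > 0"
    "\<And>(H :: 'h::ab_group_add hilbert) \<pi> \<xi> r. group_representation G H \<pi> \<Longrightarrow> \<xi> \<in> carrier H \<Longrightarrow> 0 \<le> r \<Longrightarrow>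
       (\<forall>s\<in>S. hnorm H (\<pi> s \<xi> - \<xi>) \<le> k * r) \<Longrightarrow>
       \<exists>\<zeta>\<in>carrier H. (\<forall>g\<in>carrier G. \<pi> g \<zeta> = \<zeta>) \<and> hnorm H (\<xi> - \<zeta>) \<le> r"
proof -
  (* The last condition makes the matrix coefficients with u an embedding. *)
  define bad where "bad = (\<lambda>k (H :: 'h hilbert) \<pi> u. group_representation G H \<pi> \<and> u \<in> carrier H \<and>
      hnorm H u = 1 \<and> (\<forall>s\<in>S. hnorm H (\<pi> s u - u) \<le> k) \<and>
      (\<forall>v\<in>carrier H. (\<forall>g\<in>carrier G. \<pi> g v = v) \<longrightarrow> v = 0) \<and>
      (\<forall>v\<in>carrier H. (\<forall>g\<in>carrier G. ip H v (\<pi> g u) = 0) \<longrightarrow> v = 0))"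
  have "\<exists>k>0. \<forall>(H :: 'h hilbert) \<pi> \<xi> r. group_representation G H \<pi> \<longrightarrow> \<xi> \<in> carrier H \<longrightarrow> 0 \<le> r \<longrightarrow>
       (\<forall>s\<in>S. hnorm H (\<pi> s \<xi> - \<xi>) \<le> k * r) \<longrightarrow>
       (\<exists>\<zeta>\<in>carrier H. (\<forall>g\<in>carrier G. \<pi> g \<zeta> = \<zeta>) \<and> hnorm H (\<xi> - \<zeta>) \<le> r)"
  proof (rule ccontr)
    assume neg: "\<not> ?thesis"
    have "\<exists>(H :: 'h hilbert) \<pi> u. bad k H \<pi> u" if k: "k > 0" for k
    proof -
      obtain H :: "'h hilbert" and \<pi> \<xi> r where rep: "group_representation G H \<pi>"
        and xi: "\<xi> \<in> carrier H" and r: "0 \<le> r" and small: "\<forall>s\<in>S. hnorm H (\<pi> s \<xi> - \<xi>) \<le> k * r"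
        and far: "\<not> (\<exists>\<zeta>\<in>carrier H. (\<forall>g\<in>carrier G. \<pi> g \<zeta> = \<zeta>) \<and> hnorm H (\<xi> - \<zeta>) \<le> r)"
        using neg k by blast
      interpret group_representation G H \<pi> by (rule rep)
      have "r < hnorm H (\<xi> - \<zeta>)" if "\<zeta> \<in> invariants" for \<zeta>
        using far that by (auto simp: invariants_def not_le)
      then obtain u where u: "u \<in> carrier H" "hnorm H u = 1" "\<forall>s\<in>S. hnorm H (\<pi> s u - u) \<le> k"
        and no: "\<And>v. v \<in> cyclic_space u \<Longrightarrow> v \<in> invariants \<Longrightarrow> v = 0"
        using far_from_invariants[OF S xi r k small] by blast
      have "bad k (H\<lparr>carrier := cyclic_space u\<rparr>) \<pi> u"
        unfolding bad_def
        using u cyclic_subrepresentation generator_in_cyclic_space no cyclic_space_subset cyclic_space_eq_0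
        by (auto simp: hnorm_def invariants_def)
      then show ?thesis by blast
    qed
    then have "\<forall>n. \<exists>x :: 'h hilbert \<times> ('g \<Rightarrow> 'h \<Rightarrow> 'h) \<times> 'h.
        bad (1 / real (Suc n)) (fst x) (fst (snd x)) (snd (snd x))"
      by simp
    then obtain x where x: "\<And>n. bad (1 / real (Suc n)) (fst (x n)) (fst (snd (x n))) (snd (snd (x n)))"
      by metis
    define Hs \<pi>s us where "Hs = (\<lambda>n. fst (x n))" and "\<pi>s = (\<lambda>n. fst (snd (x n)))"
      and "us = (\<lambda>n. snd (snd (x n)))"
    have bad: "bad (1 / real (Suc n)) (Hs n) (\<pi>s n) (us n)" for n
      using x by (simp add: Hs_def \<pi>s_def us_def)
    have reps: "group_representation G (Hs n) (\<pi>s n)" for n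
      using bad by (simp add: bad_def)
    have us: "us n \<in> carrier (Hs n)" "hnorm (Hs n) (us n) = 1"
        "\<forall>s\<in>S. hnorm (Hs n) (\<pi>s n s (us n) - us n) \<le> 1 / real (Suc n)" for n
      using bad[of n] by (auto simp: bad_def)
    have noinv: "v = 0" if "v \<in> carrier (Hs n)" "\<forall>g\<in>carrier G. \<pi>s n g v = v" for v n
      using bad[of n] that by (auto simp: bad_def)
    have sep: "v = 0" if "v \<in> carrier (Hs n)" "\<forall>g\<in>carrier G. ip (Hs n) v (\<pi>s n g (us n)) = 0" for v n
      using bad[of n] that by (auto simp: bad_def)
    have Hs: "complex_hilbert_space (Hs n)" for n
      using reps[of n] by (simp add: group_representation_def)
    let ?D = "direct_sum Hs" and ?\<rho> = "\<lambda>g f n. \<pi>s n g (f n)"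
    have mem: "f n \<in> carrier (Hs n)" if "f \<in> carrier ?D" for f n
      using that by (simp add: direct_sum_simps)
    have rep: "group_representation G ?D ?\<rho>"
      by (rule group_representation_direct_sum[OF reps])
    define J where "J = (\<lambda>f (g, n). if g \<in> carrier G then ip (Hs n) (f n) (\<pi>s n g (us n)) else 0)"
    have orb: "\<pi>s n g (us n) \<in> carrier (Hs n)" if "g \<in> carrier G" for n g
      using group_representation.rep_mem[OF reps that us(1)] .
    have "almost_invariant_vectors G ?D ?\<rho>"
      unfolding almost_invariant_vectors_def
    proof (intro allI impI)
      fix F and e :: real
      assume F: "finite F \<and> F \<subseteq> carrier G \<and> 0 < e"
      have "\<forall>g\<in>F. \<exists>C\<ge>0. \<forall>n. hnorm (Hs n) (\<pi>s n g (us n) - us n) \<le> C * (1 / real (Suc n))"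
      proof
        fix g assume "g \<in> F"
        then have "g \<in> generate G S" using F gen by auto
        from generated_displacement_bound[OF S this, where 'h='h]
        obtain C where "C \<ge> 0" and C: "\<And>(H :: 'h hilbert) \<pi> \<xi> r. group_representation G H \<pi> \<Longrightarrow>
            \<xi> \<in> carrier H \<Longrightarrow> (\<forall>s\<in>S. hnorm H (\<pi> s \<xi> - \<xi>) \<le> r) \<Longrightarrow> hnorm H (\<pi> g \<xi> - \<xi>) \<le> C * r"
          by blast
        then show "\<exists>C\<ge>0. \<forall>n. hnorm (Hs n) (\<pi>s n g (us n) - us n) \<le> C * (1 / real (Suc n))"
          using C[OF reps us(1) us(3)] by blast
      qed
      then obtain C where C: "\<And>g. g \<in> F \<Longrightarrow> 0 \<le> C g"
        "\<And>g n. g \<in> F \<Longrightarrow> hnorm (Hs n) (\<pi>s n g (us n) - us n) \<le> C g * (1 / real (Suc n))"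
        by metis
      obtain n where n: "sum C F / e < real n" using reals_Archimedean2 by blast
      have small: "hnorm (Hs n) (\<pi>s n g (us n) - us n) < e" if g: "g \<in> F" for g
      proof -
        have "C g \<le> sum C F" using F g C(1) by (intro member_le_sum) auto
        also have "\<dots> < real n * e" using n F by (simp add: field_simps)
        also have "\<dots> \<le> real (Suc n) * e" using F by (intro mult_right_mono) auto
        finally have "C g * (1 / real (Suc n)) < e" by (simp add: field_simps)
        then show ?thesis using C(2)[OF g, of n] by simp
      qed
      define f where "f = (\<lambda>k. if k = n then us n else 0)"
      have single: "h \<in> carrier ?D \<and> hnorm ?D h = hnorm (Hs n) (h n)"
        if "h n \<in> carrier (Hs n)" "\<And>k. k \<noteq> n \<Longrightarrow> h k = 0" for h
      proof -
        have "(\<lambda>k. (hnorm (Hs k) (h k))\<^sup>2) = (\<lambda>k. if k = n then (hnorm (Hs n) (h n))\<^sup>2 else 0)"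
          using that complex_hilbert_space.hnorm_zero[OF Hs] by (auto simp: fun_eq_iff)
        then have s: "(\<lambda>k. (hnorm (Hs k) (h k))\<^sup>2) sums (hnorm (Hs n) (h n))\<^sup>2"
          using sums_single[of n "\<lambda>k. (hnorm (Hs n) (h n))\<^sup>2"] by simp
        have "h k \<in> carrier (Hs k)" for k
          using that complex_hilbert_space.zero_mem[OF Hs] by (cases "k = n") auto
        then have h: "h \<in> carrier ?D"
          using s by (auto simp: direct_sum_simps sums_iff)
        have "(hnorm ?D h)\<^sup>2 = (hnorm (Hs n) (h n))\<^sup>2"
          using direct_sum_hnorm_sq[OF Hs h] s by (simp add: sums_iff)
        from power2_eq_imp_eq[OF this direct_sum_hnorm_nonneg[OF Hs h]
            complex_hilbert_space.hnorm_nonneg[OF Hs that(1)]]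
        show ?thesis using h by blast
      qed
      have f: "f \<in> carrier ?D \<and> hnorm ?D f = 1"
        using single[of f] us by (simp add: f_def)
      have "hnorm ?D (?\<rho> g f - f) < e" if g: "g \<in> F" for g
      proof -
        have gG: "g \<in> carrier G" using g F by auto
        have "hnorm ?D (?\<rho> g f - f) = hnorm (Hs n) ((?\<rho> g f - f) n)"
          using single[of "?\<rho> g f - f"] gG group_representation.rep_zero[OF reps gG]
            complex_hilbert_space.diff_mem[OF Hs orb[OF gG] us(1)]
          by (simp add: f_def)
        then show ?thesis using small[OF g] by (simp add: f_def)
      qed
      then show "\<exists>\<xi>\<in>carrier ?D. hnorm ?D \<xi> = 1 \<and> (\<forall>g\<in>F. hnorm ?D (?\<rho> g \<xi> - \<xi>) < e)"
        using f by blast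
    qed
    have "has_invariant_vector G ?D ?\<rho>"
    proof (rule kazhdan_group_invariant_vector[OF T rep, of J])
      fix u v assume "u \<in> carrier ?D" "v \<in> carrier ?D"
      then show "J (u + v) = J u + J v"
        using orb mem complex_hilbert_space.ip_add_left[OF Hs]
        by (auto simp: J_def fun_eq_iff)
    next
      fix c v assume "v \<in> carrier ?D"
      then show "J (smul ?D c v) = (\<lambda>i. c * J v i)"
        using orb mem complex_hilbert_space.ip_smul_left[OF Hs]
        by (auto simp: J_def fun_eq_iff direct_sum_simps(2))
    next
      fix v assume v: "v \<in> carrier ?D" and J0: "J v = 0"
      have "v n = 0" for n
      proof (rule sep[OF mem[OF v]], intro ballI)
        fix g assume "g \<in> carrier G"
        then show "ip (Hs n) (v n) (\<pi>s n g (us n)) = 0"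
          using fun_cong[OF J0, of "(g, n)"] by (simp add: J_def)
      qed
      then show "v = 0" by (simp add: fun_eq_iff)
    next
      show "almost_invariant_vectors G ?D ?\<rho>" by fact
    qed
    then obtain f where f: "f \<in> carrier ?D" "f \<noteq> 0" "\<And>g. g \<in> carrier G \<Longrightarrow> ?\<rho> g f = f"
      unfolding has_invariant_vector_def by blast
    have "f n = 0" for n
      using noinv[OF mem[OF f(1)], of n] f(3) by (simp add: fun_eq_iff)
    then show False using f(2) by (simp add: fun_eq_iff)
  qed
  then show thesis using that by blast
qed

section \<open>Finite-dimensional Hilbert spaces and Schur's lemma\<close>

context complex_hilbert_space
begin

definition orthonormal_basis :: "'h set \<Rightarrow> 'h set \<Rightarrow> bool" where
  "orthonormal_basis W E \<longleftrightarrow> finite E \<and> E \<subseteq> W \<and>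
     (\<forall>a\<in>E. \<forall>b\<in>E. ip H a b = (if a = b then 1 else 0)) \<and>
     (\<forall>u\<in>W. u = (\<Sum>e\<in>E. smul H (ip H u e) e))"

lemma orthonormal_imp_independent:
  assumes "finite E" "E \<subseteq> carrier H" "\<forall>a\<in>E. \<forall>b\<in>E. ip H a b = (if a = b then 1 else 0)"
  shows "independent E"
proof (rule independent_if_scalars_zero[OF assms(1)])
  fix f x assume 0: "(\<Sum>y\<in>E. smul H (f y) y) = 0" and x: "x \<in> E"
  have "0 = ip H (\<Sum>y\<in>E. smul H (f y) y) x"
    using 0 x assms(2) by auto
  also have "\<dots> = (\<Sum>y\<in>E. f y * ip H y x)"
    using x assms(2) by (subst ip_sum_left) (auto simp: ip_smul_left subset_iff)
  also have "\<dots> = (\<Sum>y\<in>E. if y = x then f x else 0)"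
    using x assms(3) by (intro sum.cong) auto
  also have "\<dots> = f x"
    using x assms(1) by simp
  finally show "f x = 0" by simp
qed

text \<open>
  Orthonormal sets are linearly independent, hence of bounded size, and one of maximal size spans.
\<close>

lemma orthonormal_basis_exists:
  assumes W: "subspace W" "W \<subseteq> carrier H" and B: "finite B" "W \<subseteq> span B"
  obtains E where "orthonormal_basis W E"
proof -
  define P where "P = (\<lambda>E. finite E \<and> E \<subseteq> W \<and> (\<forall>a\<in>E. \<forall>b\<in>E. ip H a b = (if a = b then 1 else 0)))"
  have bound: "card E \<le> card B" if "P E" for E
    using independent_span_bound[OF B(1), of E] orthonormal_imp_independent[of E] that W B
    by (auto simp: P_def)
  have "P {}" by (simp add: P_def)
  then have "\<exists>E. P E \<and> (\<forall>F. P F \<longrightarrow> card F \<le> card E)"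
    by (rule ex_has_greatest_nat[where b = "Suc (card B)"]) (simp add: less_Suc_eq_le bound)
  then obtain E where E: "P E" and max: "\<And>F. P F \<Longrightarrow> card F \<le> card E"
    by blast
  have fin: "finite E" and EW: "E \<subseteq> W"
    and on: "\<And>a b. a \<in> E \<Longrightarrow> b \<in> E \<Longrightarrow> ip H a b = (if a = b then 1 else 0)"
    using E by (auto simp: P_def)
  have "u = (\<Sum>e\<in>E. smul H (ip H u e) e)" if u: "u \<in> W" for u
  proof (rule ccontr)
    (* Otherwise the normalized remainder would enlarge E. *)
    assume ne: "u \<noteq> (\<Sum>e\<in>E. smul H (ip H u e) e)"
    define r where "r = u - (\<Sum>e\<in>E. smul H (ip H u e) e)"
    have rW: "r \<in> W" and r0: "r \<noteq> 0"
      using u W EW ne by (auto simp: r_def intro!: subspace_diff subspace_sum subspace_scale)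
    have rH: "r \<in> carrier H" using rW W by auto
    have orth: "ip H r a = 0" if a: "a \<in> E" for a
    proof -
      have "ip H (\<Sum>e\<in>E. smul H (ip H u e) e) a = (\<Sum>e\<in>E. ip H u e * ip H e a)"
        using a EW W by (subst ip_sum_left) (auto simp: ip_smul_left subset_iff)
      also have "\<dots> = (\<Sum>e\<in>E. if e = a then ip H u a else 0)"
        using a by (intro sum.cong) (auto simp: on)
      also have "\<dots> = ip H u a" using a fin by simp
      finally show ?thesis
        using a u EW W by (simp add: r_def ip_diff_left sum_mem subset_iff)
    qed
    define t where "t = smul H (of_real (1 / hnorm H r)) r"
    have n: "hnorm H r > 0"
      using rH r0 hnorm_nonneg[OF rH] hnorm_eq_0_iff[OF rH] by (simp add: less_le)
    have tW: "t \<in> W" and tH: "t \<in> carrier H"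
      using rW rH W by (auto simp: t_def subspace_scale)
    have tt: "ip H t t = 1"
      using rH n by (simp add: ip_self[OF tH]) (simp add: t_def hnorm_smul norm_divide)
    have ta: "ip H t a = 0" "ip H a t = 0" if "a \<in> E" for a
    proof -
      show "ip H t a = 0"
        using orth[OF that] rH that EW W by (auto simp: t_def ip_smul_left)
      then show "ip H a t = 0"
        using ip_cnj[OF tH, of a] that EW W by auto
    qed
    have tE: "t \<notin> E" using ta tt by auto
    then have "card (insert t E) = Suc (card E)" using fin by simp
    moreover have "P (insert t E)"
      using fin EW tW on tt ta tE by (auto simp: P_def)
    ultimately show False using max[of "insert t E"] by simp
  qed
  then have "orthonormal_basis W E"
    using fin EW on by (simp add: orthonormal_basis_def)
  then show thesis by (rule that)
qed

text \<open>
  Let \<open>p\<close> be the orthogonal projection of the limit \<open>l\<close> to \<open>W\<close>. Then \<open>l - p\<close> is orthogonal to the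
  sequence, hence to \<open>l\<close>, and to \<open>p\<close>, so it is zero.
\<close>

lemma closed_subspace_finite_dimensional:
  assumes W: "subspace W" "W \<subseteq> carrier H" and B: "finite B" "W \<subseteq> span B"
  shows "closed_subspace H W"
  unfolding closed_subspace_def
proof (intro conjI allI impI W)
  fix X l
  assume X: "(\<forall>n. X n \<in> W) \<and> l \<in> carrier H \<and> (\<lambda>n. hnorm H (X n - l)) \<longlonglongrightarrow> 0"
  obtain E where E: "orthonormal_basis W E"
    using orthonormal_basis_exists[OF assms] .
  have fin: "finite E" and EW: "E \<subseteq> W" and ex: "\<And>u. u \<in> W \<Longrightarrow> u = (\<Sum>e\<in>E. smul H (ip H u e) e)"
    and on: "\<And>a b. a \<in> E \<Longrightarrow> b \<in> E \<Longrightarrow> ip H a b = (if a = b then 1 else 0)"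
    using E unfolding orthonormal_basis_def by blast+
  have EH: "e \<in> carrier H" if "e \<in> E" for e using that EW W by auto
  define p where "p = (\<Sum>e\<in>E. smul H (ip H l e) e)"
  have pW: "p \<in> W" using EW W by (auto simp: p_def intro!: subspace_sum subspace_scale)
  have pH: "p \<in> carrier H" using pW W by auto
  have lH: "l \<in> carrier H" using X by simp
  have XH: "X n \<in> carrier H" for n using X W by auto
  have orthE: "ip H e (l - p) = 0" if e: "e \<in> E" for e
  proof -
    have "ip H p e = (\<Sum>a\<in>E. ip H l a * ip H a e)"
      unfolding p_def using e EH by (subst ip_sum_left) (auto simp: ip_smul_left)
    also have "\<dots> = (\<Sum>a\<in>E. if a = e then ip H l e else 0)"
      using e by (intro sum.cong) (auto simp: on)
    also have "\<dots> = ip H l e" using e fin by simp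
    finally have "ip H (l - p) e = 0"
      using lH pH EH[OF e] by (simp add: ip_diff_left)
    then show ?thesis using ip_cnj[of "l - p" e] lH pH EH[OF e] by simp
  qed
  have orth: "ip H w (l - p) = 0" if w: "w \<in> W" for w
  proof -
    have "ip H w (l - p) = ip H (\<Sum>e\<in>E. smul H (ip H w e) e) (l - p)"
      using ex[OF w] by simp
    also have "\<dots> = (\<Sum>e\<in>E. ip H w e * ip H e (l - p))"
      using EH lH pH by (subst ip_sum_left) (auto simp: ip_smul_left)
    finally show ?thesis using orthE by simp
  qed
  have "(\<lambda>n. ip H (X n) (l - p)) \<longlonglongrightarrow> ip H l (l - p)"
    using X XH lH pH by (intro tendsto_ip_left) auto
  then have "ip H l (l - p) = 0"
    using orth X by (simp add: LIMSEQ_const_iff)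
  then have "ip H (l - p) (l - p) = 0"
    using orth[OF pW] lH pH by (simp add: ip_diff_left)
  then have "l - p = 0"
    using ip_pos[of "l - p"] lH pH by fastforce
  then show "l \<in> W" using pW by simp
qed

end

context vector_space
begin

text \<open>
  Since the coefficients belong to indices, a repetition in the sequence counts as a relation. For the
  powers of an operator applied to a vector such a relation is an annihilating polynomial.
\<close>

lemma span_relation_exists:
  fixes x :: "nat \<Rightarrow> 'b"
  assumes B: "finite B" and x: "\<And>i. x i \<in> span B"
  obtains c k where "k \<le> card B" "c k \<noteq> 0" "(\<Sum>i\<le>card B. scale (c i) (x i)) = 0"
proof (cases "inj_on x {..card B}")
  case True
  have "\<not> independent (x ` {..card B})"
  proof
    assume "independent (x ` {..card B})"
    then have "card (x ` {..card B}) \<le> card B"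
      using independent_span_bound[OF B] x by auto
    then show False using True by (simp add: card_image)
  qed
  then obtain f v where "v \<in> x ` {..card B}" "f v \<noteq> 0"
    and "(\<Sum>v\<in>x ` {..card B}. scale (f v) v) = 0"
    by (auto simp: dependent_finite)
  then show thesis
    using that[of _ "\<lambda>i. f (x i)"] True by (auto simp: sum.reindex)
next
  case False
  then obtain i j where ij: "i \<le> card B" "j \<le> card B" "x i = x j" "i \<noteq> j"
    by (auto simp: inj_on_def)
  define c where "c = (\<lambda>k. (if k = i then 1 else 0) - (if k = j then 1 else 0) :: 'a)"
  have delta: "(\<Sum>k\<le>card B. scale (if k = m then 1 else 0) (x k)) = x m" if "m \<le> card B" for m
  proof -
    have "(\<Sum>k\<le>card B. scale (if k = m then 1 else 0) (x k)) = (\<Sum>k\<le>card B. if k = m then x m else 0)"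
      by (intro sum.cong) auto
    then show ?thesis using that by simp
  qed
  have "(\<Sum>k\<le>card B. scale (c k) (x k)) = 0"
    using ij delta by (simp add: c_def scale_left_diff_distrib sum_subtractf)
  moreover have "c i \<noteq> 0" using ij by (simp add: c_def)
  ultimately show thesis using that ij by blast
qed

end

context complex_hilbert_space
begin

text \<open>
  Let \<open>p\<close> be of least degree among the non-zero polynomials with \<open>p(T) u = 0\<close>, for a fixed \<open>u \<noteq> 0\<close>. It has
  a root \<open>z\<close>, and with \<open>p = (X - z) q\<close> the vector \<open>q(T) u\<close> is an eigenvector.
\<close>

lemma eigenvector_exists:
  assumes fd: "finite_dimensional H" and ne: "carrier H \<noteq> {0}"
    and T: "\<And>v. v \<in> carrier H \<Longrightarrow> T v \<in> carrier H"
    and add: "\<And>u v. u \<in> carrier H \<Longrightarrow> v \<in> carrier H \<Longrightarrow> T (u + v) = T u + T v"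
    and smul: "\<And>c v. v \<in> carrier H \<Longrightarrow> T (smul H c v) = smul H c (T v)"
  obtains z w where "w \<in> carrier H" "w \<noteq> 0" "T w = smul H z w"
proof -
  obtain B where B: "finite B" "span B = carrier H"
    using fd by (auto simp: finite_dimensional_def)
  obtain u where u: "u \<in> carrier H" "u \<noteq> 0"
    using ne zero_mem by blast
  have T0 [simp]: "T 0 = 0" using smul[of 0 0] by simp
  (* ev p is the vector p(T) u. *)
  define ev where "ev = (\<lambda>p :: complex poly. fold_coeffs (\<lambda>a w. smul H a u + T w) p 0)"
  have ev0 [simp]: "ev 0 = 0" by (simp add: ev_def)
  have evC [simp]: "ev (pCons a p) = smul H a u + T (ev p)" for a p
    by (cases "p = 0 \<and> a = 0") (auto simp: ev_def)
  have evH [simp]: "ev p \<in> carrier H" for p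
    by (induction p) (auto simp: u T)
  have ev_add: "ev (p + q) = ev p + ev q" for p q
  proof (induction p arbitrary: q)
    case (pCons a p)
    obtain b r where "q = pCons b r" by (cases q)
    then show ?case
      by (simp add: pCons.IH add scale_left_distrib ac_simps)
  qed simp
  have ev_smult: "ev (Polynomial.smult c p) = smul H c (ev p)" for c p
    by (induction p) (auto simp: smul scale_right_distrib)
  have ev_sum: "ev (sum f A) = (\<Sum>i\<in>A. ev (f i))" for f :: "nat \<Rightarrow> complex poly" and A
    by (induction A rule: infinite_finite_induct) (auto simp: ev_add)
  obtain c k where ck: "k \<le> card B" "c k \<noteq> 0"
    and rel: "(\<Sum>i\<le>card B. smul H (c i) (ev (monom 1 i))) = 0"
    by (rule span_relation_exists[OF B(1), of "\<lambda>i. ev (monom 1 i)"]) (simp_all add: B(2))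
  define p0 where "p0 = (\<Sum>i\<le>card B. Polynomial.smult (c i) (monom 1 i))"
  have "ev p0 = 0" using rel by (simp add: p0_def ev_sum ev_smult)
  moreover have "coeff p0 k = c k"
    using ck by (simp add: p0_def coeff_sum if_distrib cong: if_cong)
  then have "p0 \<noteq> 0" using ck by auto
  ultimately have ex: "\<exists>p. p \<noteq> 0 \<and> ev p = 0" by blast
  define p where "p = arg_min degree (\<lambda>p. p \<noteq> 0 \<and> ev p = 0)"
  have p: "p \<noteq> 0" "ev p = 0"
    using arg_min_natI[of "\<lambda>p. p \<noteq> 0 \<and> ev p = 0"] ex by (auto simp: p_def)
  have min: "degree p \<le> degree q" if "q \<noteq> 0" "ev q = 0" for q
    unfolding p_def using arg_min_nat_le[of "\<lambda>p. p \<noteq> 0 \<and> ev p = 0" q degree] that by blast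
  have "degree p \<noteq> 0"
  proof
    assume "degree p = 0"
    then obtain a where a: "p = [:a:]" by (auto elim: degree_eq_zeroE)
    then show False using p u by simp
  qed
  then have "\<not> constant (poly p)" by (simp add: constant_degree)
  then obtain z where "poly p z = 0" using fundamental_theorem_of_algebra by blast
  then obtain q where q: "p = [:- z, 1:] * q" by (auto simp: poly_eq_0_iff_dvd)
  have q0: "q \<noteq> 0" using p q by auto
  have "degree p = Suc (degree q)"
    using q0 by (simp add: q degree_mult_eq del: mult_pCons_left)
  then have evq: "ev q \<noteq> 0" using min[of q] q0 by auto
  have "p = Polynomial.smult (- z) q + pCons 0 q" by (simp add: q)
  then have "ev p = ev (Polynomial.smult (- z) q + pCons 0 q)" by (rule arg_cong)
  then have "ev p = smul H (- z) (ev q) + T (ev q)" unfolding ev_add ev_smult evC by simp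
  then have "T (ev q) = smul H z (ev q)" using p by (simp add: add_eq_0_iff)
  then show thesis using that evq evH by blast
qed

end

text \<open>
  Schur's lemma for invariant sesquilinear forms: the operator that represents the form has an
  eigenvector, and its eigenspace is an invariant subspace.
\<close>

lemma schur_invariant_form:
  fixes f :: "'k::ab_group_add \<Rightarrow> 'k \<Rightarrow> complex"
  assumes G: "group G" and irr: "irreducible_rep G K \<sigma>" and fd: "finite_dimensional K"
    and add1: "\<And>u v w. u \<in> carrier K \<Longrightarrow> v \<in> carrier K \<Longrightarrow> w \<in> carrier K \<Longrightarrow> f (u + v) w = f u w + f v w"
    and smul1: "\<And>c u w. u \<in> carrier K \<Longrightarrow> w \<in> carrier K \<Longrightarrow> f (smul K c u) w = c * f u w"
    and add2: "\<And>u v w. u \<in> carrier K \<Longrightarrow> v \<in> carrier K \<Longrightarrow> w \<in> carrier K \<Longrightarrow> f w (u + v) = f w u + f w v"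
    and smul2: "\<And>c u w. u \<in> carrier K \<Longrightarrow> w \<in> carrier K \<Longrightarrow> f w (smul K c u) = cnj c * f w u"
    and inv: "\<And>g u w. g \<in> carrier G \<Longrightarrow> u \<in> carrier K \<Longrightarrow> w \<in> carrier K \<Longrightarrow> f (\<sigma> g u) (\<sigma> g w) = f u w"
  obtains z where "\<And>u w. u \<in> carrier K \<Longrightarrow> w \<in> carrier K \<Longrightarrow> f u w = z * ip K u w"
proof -
  interpret group_representation G K \<sigma>
    using G irr by (simp add: unitary_rep_imp_group_representation irreducible_rep_def)
  obtain B where B: "finite B" "span B = carrier K"
    using fd by (auto simp: finite_dimensional_def)
  obtain E where E: "orthonormal_basis (carrier K) E"
    using orthonormal_basis_exists[OF subspace_carrier order_refl B(1)] B(2) by blast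
  have fin: "finite E" and EK: "\<And>e. e \<in> E \<Longrightarrow> e \<in> carrier K"
    and ex: "\<And>u. u \<in> carrier K \<Longrightarrow> u = (\<Sum>e\<in>E. smul K (ip K u e) e)"
    using E unfolding orthonormal_basis_def by blast+
  define T where "T = (\<lambda>u. \<Sum>e\<in>E. smul K (f u e) e)"
  have TK: "T u \<in> carrier K" for u
    unfolding T_def by (intro sum_mem smul_mem EK)
  have f0: "f w 0 = 0" if "w \<in> carrier K" for w
    using smul2[of 0 w 0] that by simp
  have fsum: "f w (\<Sum>e\<in>A. smul K (c e) e) = (\<Sum>e\<in>A. cnj (c e) * f w e)"
    if w: "w \<in> carrier K" and A: "A \<subseteq> E" for w A c
    using finite_subset[OF A fin] A
  proof (induction A rule: finite_induct)
    case empty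
    then show ?case using f0 w by simp
  next
    case (insert a A)
    then have "(\<Sum>e\<in>A. smul K (c e) e) \<in> carrier K"
      by (intro sum_mem smul_mem EK) auto
    then show ?case using insert w EK by (simp add: add2 smul2)
  qed
  have Tf: "ip K (T u) w = f u w" if u: "u \<in> carrier K" and w: "w \<in> carrier K" for u w
  proof -
    have "ip K (T u) w = (\<Sum>e\<in>E. f u e * ip K e w)"
      unfolding T_def using EK w by (subst ip_sum_left) (auto simp: ip_smul_left)
    also have "\<dots> = (\<Sum>e\<in>E. cnj (ip K w e) * f u e)"
      using ip_cnj[OF w EK] by (intro sum.cong) auto
    also have "\<dots> = f u w"
      using fsum[OF u order_refl, of "ip K w"] ex[OF w] by simp
    finally show ?thesis .
  qed
  obtain z w0 where w0: "w0 \<in> carrier K" "w0 \<noteq> 0" "T w0 = smul K z w0"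
  proof (rule eigenvector_exists[OF fd, of T])
    show "carrier K \<noteq> {0}" using irr by (simp add: irreducible_rep_def)
    show "T (u + v) = T u + T v" if "u \<in> carrier K" "v \<in> carrier K" for u v
      using that EK by (simp add: T_def add1 scale_left_distrib sum.distrib)
    show "T (smul K c v) = smul K c (T v)" if "v \<in> carrier K" for c v
      using that EK by (simp add: T_def smul1 scale_sum_right)
  qed (use TK in auto)
  define W where "W = {u \<in> carrier K. \<forall>w\<in>carrier K. f u w = z * ip K u w}"
  have "w0 \<in> W"
    using w0 Tf[OF w0(1)] by (auto simp: W_def ip_smul_left)
  have "subspace W"
  proof -
    have "f 0 w = 0" if "w \<in> carrier K" for w
      using smul1[of 0 w 0] that by simp
    then show ?thesis
      by (auto simp: subspace_def W_def add1 smul1 ip_add_left ip_smul_left algebra_simps)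
  qed
  then have "closed_subspace K W"
    using B by (intro closed_subspace_finite_dimensional[of W B]) (auto simp: W_def)
  moreover have "\<sigma> g u \<in> W" if g: "g \<in> carrier G" and u: "u \<in> W" for g u
  proof -
    have uK: "u \<in> carrier K" using u by (simp add: W_def)
    have "f (\<sigma> g u) w = z * ip K (\<sigma> g u) w" if w: "w \<in> carrier K" for w
    proof -
      have "f (\<sigma> g u) w = f u (\<sigma> (inv\<^bsub>G\<^esub> g) w)"
        using inv[of g u "\<sigma> (inv\<^bsub>G\<^esub> g) w"] g uK w by simp
      also have "\<dots> = z * ip K u (\<sigma> (inv\<^bsub>G\<^esub> g) w)"
        using u g w by (simp add: W_def)
      finally show ?thesis using g uK w by (simp add: rep_adjoint)
    qed
    then show ?thesis using g uK by (simp add: W_def)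
  qed
  ultimately have "W = {0} \<or> W = carrier K"
    using irr by (auto simp: irreducible_rep_def)
  then have "W = carrier K" using \<open>w0 \<in> W\<close> w0 by blast
  then have "f u w = z * ip K u w" if "u \<in> carrier K" "w \<in> carrier K" for u w
    using that unfolding W_def by blast
  then show thesis by (rule that)
qed

section \<open>Linear maps between representations\<close>

definition linear_on :: "'k::ab_group_add hilbert \<Rightarrow> 'h::ab_group_add hilbert \<Rightarrow> ('k \<Rightarrow> 'h) \<Rightarrow> bool" where
  "linear_on K H A \<longleftrightarrow> (\<forall>u\<in>carrier K. A u \<in> carrier H) \<and>
     (\<forall>u\<in>carrier K. \<forall>v\<in>carrier K. A (u + v) = A u + A v) \<and>
     (\<forall>c. \<forall>u\<in>carrier K. A (smul K c u) = smul H c (A u))"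

lemma linear_onD:
  assumes "linear_on K H A"
  shows "u \<in> carrier K \<Longrightarrow> A u \<in> carrier H"
    and "u \<in> carrier K \<Longrightarrow> v \<in> carrier K \<Longrightarrow> A (u + v) = A u + A v"
    and "u \<in> carrier K \<Longrightarrow> A (smul K c u) = smul H c (A u)"
  using assms by (auto simp: linear_on_def)

locale hilbert_space_pair = H: complex_hilbert_space H + K: complex_hilbert_space K
  for H :: "'h::ab_group_add hilbert" and K :: "'k::ab_group_add hilbert"
begin

lemma linear_on_zero: "linear_on K H A \<Longrightarrow> A 0 = 0"
  using linear_onD(3)[of K H A 0 0] by simp

lemma linear_on_sum:
  assumes A: "linear_on K H A" and f: "\<And>i. i \<in> I \<Longrightarrow> f i \<in> carrier K"
  shows "A (sum f I) = (\<Sum>i\<in>I. A (f i))"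
  using f
  by (induction I rule: infinite_finite_induct)
    (auto simp: linear_on_zero[OF A] linear_onD[OF A] K.sum_mem)

lemma linear_on_span_image:
  assumes A: "linear_on K H A" and X: "X \<subseteq> carrier K"
  shows "A ` K.span X = H.span (A ` X)"
proof
  have span: "K.span X \<subseteq> carrier K"
    using X K.subspace_carrier by (rule K.span_minimal)
  have "u \<in> carrier K \<and> A u \<in> H.span (A ` X)" if "u \<in> K.span X" for u
    using that
  proof (induction rule: K.span_induct_alt)
    case base
    then show ?case by (simp add: linear_on_zero[OF A] H.span_zero)
  next
    case (step c x y)
    then have "x \<in> carrier K" "y \<in> carrier K" using X by auto
    then show ?case
      using step by (simp add: linear_onD[OF A] H.span_add H.span_scale H.span_base)
  qed
  then show "A ` K.span X \<subseteq> H.span (A ` X)" by auto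
  have "H.subspace (A ` K.span X)"
    unfolding H.subspace_def
  proof (intro conjI ballI allI)
    show "0 \<in> A ` K.span X"
      by (intro image_eqI[of _ _ 0]) (auto simp: linear_on_zero[OF A] K.span_zero)
  next
    fix a b assume "a \<in> A ` K.span X" "b \<in> A ` K.span X"
    then obtain u v where "u \<in> K.span X" "v \<in> K.span X" "a = A u" "b = A v" by auto
    then show "a + b \<in> A ` K.span X"
      by (intro image_eqI[of _ _ "u + v"]) (auto simp: linear_onD[OF A] K.span_add subsetD[OF span])
  next
    fix c a assume "a \<in> A ` K.span X"
    then obtain u where "u \<in> K.span X" "a = A u" by auto
    then show "smul H c a \<in> A ` K.span X"
      by (intro image_eqI[of _ _ "smul K c u"]) (auto simp: linear_onD[OF A] K.span_scale subsetD[OF span])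
  qed
  then show "H.span (A ` X) \<subseteq> A ` K.span X"
    by (intro H.span_minimal) (auto intro: K.span_base)
qed

lemma linear_on_representation:
  assumes A: "linear_on K H A" and E: "K.orthonormal_basis (carrier K) E" and u: "u \<in> carrier K"
  shows "A u = (\<Sum>e\<in>E. smul H (ip K u e) (A e))"
proof -
  have EK: "e \<in> carrier K" if "e \<in> E" for e
    using E that by (auto simp: K.orthonormal_basis_def)
  have "u = (\<Sum>e\<in>E. smul K (ip K u e) e)"
    using E u unfolding K.orthonormal_basis_def by blast
  then have "A u = A (\<Sum>e\<in>E. smul K (ip K u e) e)" by (rule arg_cong)
  also have "\<dots> = (\<Sum>e\<in>E. smul H (ip K u e) (A e))"
    using EK by (subst linear_on_sum[OF A]) (auto simp: linear_onD[OF A])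
  finally show ?thesis .
qed

text \<open>
  Each basis is expanded in the other one. This independence makes the action of the group on linear
  maps by conjugation unitary.
\<close>


lemma hilbert_schmidt_basis_independent:
  assumes A: "linear_on K H A" and B: "linear_on K H B"
    and E: "K.orthonormal_basis (carrier K) E" and F: "K.orthonormal_basis (carrier K) F"
  shows "(\<Sum>f\<in>F. ip H (A f) (B f)) = (\<Sum>e\<in>E. ip H (A e) (B e))"
proof -
  have EK: "e \<in> carrier K" if "e \<in> E" for e
    using E that by (auto simp: K.orthonormal_basis_def)
  have FK: "e \<in> carrier K" if "e \<in> F" for e
    using F that by (auto simp: K.orthonormal_basis_def)
  have "(\<Sum>f\<in>F. ip H (A f) (B f)) = (\<Sum>f\<in>F. \<Sum>e\<in>E. ip K f e * ip H (A e) (B f))"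
  proof (intro sum.cong refl)
    fix f assume f: "f \<in> F"
    have "ip H (A f) (B f) = ip H (\<Sum>e\<in>E. smul H (ip K f e) (A e)) (B f)"
      using linear_on_representation[OF A E FK[OF f]] by simp
    also have "\<dots> = (\<Sum>e\<in>E. ip K f e * ip H (A e) (B f))"
      using EK FK[OF f]
      by (subst H.ip_sum_left) (auto simp: linear_onD[OF A] linear_onD[OF B] H.ip_smul_left)
    finally show "ip H (A f) (B f) = (\<Sum>e\<in>E. ip K f e * ip H (A e) (B f))" .
  qed
  also have "\<dots> = (\<Sum>e\<in>E. \<Sum>f\<in>F. ip K f e * ip H (A e) (B f))"
    by (rule sum.swap)
  also have "\<dots> = (\<Sum>e\<in>E. ip H (A e) (B e))"
  proof (intro sum.cong refl)
    fix e assume e: "e \<in> E"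
    have "ip H (A e) (B e) = ip H (A e) (\<Sum>f\<in>F. smul H (ip K e f) (B f))"
      using linear_on_representation[OF B F EK[OF e]] by simp
    also have "\<dots> = (\<Sum>f\<in>F. cnj (ip K e f) * ip H (A e) (B f))"
      using EK[OF e] FK
      by (subst H.ip_sum_right) (auto simp: linear_onD[OF A] linear_onD[OF B] H.ip_smul_right)
    also have "\<dots> = (\<Sum>f\<in>F. ip K f e * ip H (A e) (B f))"
      using K.ip_cnj[OF EK[OF e] FK] by (intro sum.cong) auto
    finally show "(\<Sum>f\<in>F. ip K f e * ip H (A e) (B f)) = ip H (A e) (B e)" by simp
  qed
  finally show ?thesis .
qed

end

text \<open>
  The linear maps from a finite-dimensional space with orthonormal basis \<open>E\<close>, with the
  Hilbert-Schmidt inner product. The value zero outside the domain makes equality of maps coincide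
  with equality of functions.
\<close>

definition hom_space ::
  "'k::ab_group_add hilbert \<Rightarrow> 'k set \<Rightarrow> 'h::ab_group_add hilbert \<Rightarrow> ('k \<Rightarrow> 'h) hilbert" where
  "hom_space K E H =
     \<lparr>carrier = {A. linear_on K H A \<and> (\<forall>u. u \<notin> carrier K \<longrightarrow> A u = 0)},
      smul = (\<lambda>c A u. smul H c (A u)),
      ip = (\<lambda>A B. \<Sum>e\<in>E. ip H (A e) (B e))\<rparr>"

lemma hom_space_simps:
  "A \<in> carrier (hom_space K E H) \<longleftrightarrow> linear_on K H A \<and> (\<forall>u. u \<notin> carrier K \<longrightarrow> A u = 0)"
  "smul (hom_space K E H) = (\<lambda>c A u. smul H c (A u))"
  "ip (hom_space K E H) A B = (\<Sum>e\<in>E. ip H (A e) (B e))"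
  by (simp_all add: hom_space_def)

locale hom_space_setting = hilbert_space_pair H K
  for H :: "'h::ab_group_add hilbert" and K :: "'k::ab_group_add hilbert" +
  fixes E :: "'k set"
  assumes E: "K.orthonormal_basis (carrier K) E"
begin

abbreviation Hom :: "('k \<Rightarrow> 'h) hilbert" where "Hom \<equiv> hom_space K E H"

lemma finite_E: "finite E" and E_mem: "e \<in> E \<Longrightarrow> e \<in> carrier K"
  and E_orthonormal: "a \<in> E \<Longrightarrow> b \<in> E \<Longrightarrow> ip K a b = (if a = b then 1 else 0)"
  using E by (auto simp: K.orthonormal_basis_def)

lemma Hom_mem: "A \<in> carrier Hom \<Longrightarrow> u \<in> carrier K \<Longrightarrow> A u \<in> carrier H"
  by (simp add: hom_space_simps linear_on_def)

lemma Hom_hnorm_sq: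
  assumes "A \<in> carrier Hom"
  shows "(hnorm Hom A)\<^sup>2 = (\<Sum>e\<in>E. (hnorm H (A e))\<^sup>2)"
proof -
  have "Re (ip Hom A A) = (\<Sum>e\<in>E. (hnorm H (A e))\<^sup>2)"
    using Hom_mem[OF assms] E_mem by (simp add: hom_space_simps H.hnorm_sq)
  then show ?thesis by (simp add: hnorm_def[of Hom] sum_nonneg)
qed

lemma Hom_hnorm_nonneg: "A \<in> carrier Hom \<Longrightarrow> 0 \<le> hnorm Hom A"
  using Hom_mem E_mem H.Re_ip_self_nonneg by (auto simp: hnorm_def hom_space_simps intro!: sum_nonneg)

lemma hnorm_basis_le:
  assumes "A \<in> carrier Hom" "e \<in> E"
  shows "hnorm H (A e) \<le> hnorm Hom A"
proof (rule power2_le_imp_le)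
  show "(hnorm H (A e))\<^sup>2 \<le> (hnorm Hom A)\<^sup>2"
    unfolding Hom_hnorm_sq[OF assms(1)] using assms finite_E
    by (intro member_le_sum[where f = "\<lambda>e. (hnorm H (A e))\<^sup>2"]) auto
qed (rule Hom_hnorm_nonneg[OF assms(1)])

lemma hnorm_apply_le:
  assumes A: "A \<in> carrier Hom" and u: "u \<in> carrier K"
  shows "hnorm H (A u) \<le> real (card E) * hnorm Hom A * hnorm K u"
proof -
  have lin: "linear_on K H A" using A by (simp add: hom_space_simps)
  have "A u = (\<Sum>e\<in>E. smul H (ip K u e) (A e))"
    by (rule linear_on_representation[OF lin E u])
  then have "hnorm H (A u) \<le> (\<Sum>e\<in>E. hnorm H (smul H (ip K u e) (A e)))"
    using Hom_mem[OF A E_mem] by (auto intro: H.hnorm_sum_le)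
  also have "\<dots> \<le> (\<Sum>e\<in>E. hnorm K u * hnorm Hom A)"
  proof (rule sum_mono)
    fix e assume e: "e \<in> E"
    have "hnorm K e = 1" using E_orthonormal[OF e e] by (simp add: hnorm_def)
    then have "cmod (ip K u e) \<le> hnorm K u"
      using K.cauchy_schwarz[OF u E_mem[OF e]] by simp
    then show "hnorm H (smul H (ip K u e) (A e)) \<le> hnorm K u * hnorm Hom A"
      using Hom_mem[OF A E_mem[OF e]] hnorm_basis_le[OF A e] u
      by (auto simp: H.hnorm_smul intro!: mult_mono)
  qed
  finally show ?thesis by (simp add: algebra_simps)
qed

lemma Hom_hnorm_le:
  assumes A: "A \<in> carrier Hom" and t: "\<And>e. e \<in> E \<Longrightarrow> hnorm H (A e) \<le> t" and "0 \<le> t"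
  shows "hnorm Hom A \<le> real (card E) * t"
proof (rule power2_le_imp_le)
  have "(hnorm Hom A)\<^sup>2 \<le> (\<Sum>e\<in>E. t\<^sup>2)"
    unfolding Hom_hnorm_sq[OF A] using t Hom_mem[OF A E_mem] by (intro sum_mono power_mono) auto
  also have "\<dots> = real (card E) * t\<^sup>2" by simp
  also have "real (card E) \<le> (real (card E))\<^sup>2"
    by (cases "card E") (auto simp: power2_eq_square)
  then have "real (card E) * t\<^sup>2 \<le> (real (card E) * t)\<^sup>2"
    by (simp add: power_mult_distrib mult_right_mono)
  finally show "(hnorm Hom A)\<^sup>2 \<le> (real (card E) * t)\<^sup>2" .
qed (use assms in auto)

lemma Hom_diff: "A \<in> carrier Hom \<Longrightarrow> B \<in> carrier Hom \<Longrightarrow> A - B \<in> carrier Hom"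
  by (auto simp: hom_space_simps linear_on_def H.scale_right_diff_distrib)

sublocale Hom: complex_hilbert_space Hom
  unfolding complex_hilbert_space_def complex_hilbert_space_axioms_def
proof (intro conjI allI impI)
  show vs: "vector_space (smul Hom)"
    using H.vector_space_axioms unfolding hom_space_simps
    by (auto simp: vector_space_def fun_eq_iff)
  interpret V: vector_space "smul Hom" by (rule vs)
  show "V.subspace (carrier Hom)"
    unfolding V.subspace_def
    by (auto simp: hom_space_simps linear_on_def H.scale_right_distrib ac_simps)
next
  fix A B C assume "A \<in> carrier Hom" "B \<in> carrier Hom" "C \<in> carrier Hom"
  then show "ip Hom (A + B) C = ip Hom A C + ip Hom B C"
    using Hom_mem E_mem by (simp add: hom_space_simps(3) H.ip_add_left sum.distrib)
next
  fix c A B assume "A \<in> carrier Hom" "B \<in> carrier Hom"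
  then show "ip Hom (smul Hom c A) B = c * ip Hom A B"
    using Hom_mem E_mem by (simp add: hom_space_simps(2,3) H.ip_smul_left sum_distrib_left)
next
  fix A B assume A: "A \<in> carrier Hom" and B: "B \<in> carrier Hom"
  show "ip Hom B A = cnj (ip Hom A B)"
    using H.ip_cnj[OF Hom_mem[OF A E_mem] Hom_mem[OF B E_mem]]
    by (simp add: hom_space_simps(3))
next
  fix A assume A: "A \<in> carrier Hom" and "A \<noteq> 0"
  then obtain u where u: "A u \<noteq> 0" by (auto simp: fun_eq_iff)
  have lin: "linear_on K H A" and uK: "u \<in> carrier K"
    using A u by (auto simp: hom_space_simps)
  have "\<exists>e\<in>E. A e \<noteq> 0"
  proof (rule ccontr)
    assume "\<not> ?thesis"
    then have "A u = 0"
      using linear_on_representation[OF lin E uK] by simp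
    then show False using u by simp
  qed
  then obtain e where e: "e \<in> E" "A e \<noteq> 0" by blast
  have "0 < hnorm H (A e)"
    using e H.hnorm_eq_0_iff[OF Hom_mem[OF A E_mem]] H.hnorm_nonneg[OF Hom_mem[OF A E_mem]]
    by (simp add: less_le)
  also have "\<dots> \<le> hnorm Hom A" by (rule hnorm_basis_le[OF A e(1)])
  finally show "0 < Re (ip Hom A A)" by (simp add: hnorm_def)
next
  fix X :: "nat \<Rightarrow> 'k \<Rightarrow> 'h"
  assume X: "\<forall>n. X n \<in> carrier Hom"
    and Cauchy: "\<forall>e>0. \<exists>N. \<forall>m\<ge>N. \<forall>n\<ge>N. hnorm Hom (X m - X n) < e"
  have "\<exists>l\<in>carrier H. (\<lambda>n. hnorm H (X n e - l)) \<longlonglongrightarrow> 0" if e: "e \<in> E" for e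
  proof (rule H.complete)
    show "X n e \<in> carrier H" for n using Hom_mem X E_mem[OF e] by blast
    have "hnorm H (X m e - X n e) \<le> hnorm Hom (X m - X n)" for m n
      using hnorm_basis_le[OF Hom_diff e, of "X m" "X n"] X by simp
    then show "\<forall>d>0. \<exists>N. \<forall>m\<ge>N. \<forall>n\<ge>N. hnorm H (X m e - X n e) < d"
      using Cauchy by (meson le_less_trans)
  qed
  then obtain L where L: "\<And>e. e \<in> E \<Longrightarrow> L e \<in> carrier H"
    and lim: "\<And>e. e \<in> E \<Longrightarrow> (\<lambda>n. hnorm H (X n e - L e)) \<longlonglongrightarrow> 0"
    by metis
  define A where "A = (\<lambda>u. if u \<in> carrier K then \<Sum>e\<in>E. smul H (ip K u e) (L e) else 0)"
  have A: "A \<in> carrier Hom"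
    using L E_mem
    by (auto simp: hom_space_simps linear_on_def A_def K.ip_add_left K.ip_smul_left
        H.scale_left_distrib sum.distrib H.scale_sum_right intro!: H.sum_mem)
  have AE: "A e = L e" if e: "e \<in> E" for e
  proof -
    have "A e = (\<Sum>a\<in>E. smul H (ip K e a) (L a))"
      using E_mem[OF e] by (simp add: A_def)
    also have "\<dots> = (\<Sum>a\<in>E. if a = e then L e else 0)"
      using e by (intro sum.cong) (auto simp: E_orthonormal)
    finally show ?thesis using e finite_E by simp
  qed
  have "(\<lambda>n. sqrt (\<Sum>e\<in>E. (hnorm H (X n e - L e))\<^sup>2)) \<longlonglongrightarrow> sqrt (\<Sum>e\<in>E. 0\<^sup>2)"
    by (intro tendsto_real_sqrt tendsto_sum tendsto_power lim)
  moreover have "sqrt (\<Sum>e\<in>E. (hnorm H (X n e - L e))\<^sup>2) = hnorm Hom (X n - A)" for n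
  proof -
    have D: "X n - A \<in> carrier Hom" using X A by (simp add: Hom_diff)
    have "(\<Sum>e\<in>E. (hnorm H (X n e - L e))\<^sup>2) = (hnorm Hom (X n - A))\<^sup>2"
      unfolding Hom_hnorm_sq[OF D] by (simp add: AE)
    then show ?thesis using Hom_hnorm_nonneg[OF D] by simp
  qed
  ultimately have "(\<lambda>n. hnorm Hom (X n - A)) \<longlonglongrightarrow> 0" by simp
  then show "\<exists>A\<in>carrier Hom. (\<lambda>n. hnorm Hom (X n - A)) \<longlonglongrightarrow> 0"
    using A by blast
qed

end

context group_representation
begin

lemma rep_span_closed:
  assumes X: "X \<subseteq> carrier H" and g: "g \<in> carrier G"
    and inv: "\<And>u. u \<in> X \<Longrightarrow> \<pi> g u \<in> span X" and u: "u \<in> span X"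
  shows "\<pi> g u \<in> span X"
proof -
  have "u \<in> carrier H \<and> \<pi> g u \<in> span X"
    using u
  proof (induction rule: span_induct_alt)
    case base
    then show ?case using g by (simp add: span_zero)
  next
    case (step c x y)
    then have "x \<in> carrier H" "y \<in> carrier H" using X by auto
    then show ?case
      using step g inv by (simp add: rep_add rep_smul span_add span_scale)
  qed
  then show ?thesis by simp
qed

lemma irreducible_invariant_subspace:
  assumes irr: "irreducible_rep G H \<pi>" and fd: "finite_dimensional H"
    and W: "subspace W" "W \<subseteq> carrier H" and v: "v \<in> W" "v \<noteq> 0"
    and inv: "\<And>g u. g \<in> carrier G \<Longrightarrow> u \<in> W \<Longrightarrow> \<pi> g u \<in> W"
  shows "W = carrier H"
proof -
  obtain B where B: "finite B" "span B = carrier H"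
    using fd by (auto simp: finite_dimensional_def)
  have "closed_subspace H W"
    using W B by (intro closed_subspace_finite_dimensional[of _ B]) auto
  then have "W = {0} \<or> W = carrier H"
    using irr inv by (auto simp: irreducible_rep_def)
  then show ?thesis using v by blast
qed

end

text \<open>
  Conjugation of linear maps. Its fixed points are the maps that intertwine \<open>\<sigma>\<close> and \<open>\<pi>\<close>.
\<close>

definition hom_action ::
  "('g, 'm) monoid_scheme \<Rightarrow> 'k::ab_group_add hilbert \<Rightarrow> ('g \<Rightarrow> 'h \<Rightarrow> 'h) \<Rightarrow> ('g \<Rightarrow> 'k \<Rightarrow> 'k) \<Rightarrow>
   'g \<Rightarrow> ('k \<Rightarrow> 'h::ab_group_add) \<Rightarrow> 'k \<Rightarrow> 'h" where
  "hom_action G K \<pi> \<sigma> g A = (\<lambda>u. if u \<in> carrier K then \<pi> g (A (\<sigma> (inv\<^bsub>G\<^esub> g) u)) else 0)"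

locale representation_pair =
  H: group_representation G H \<pi> + K: group_representation G K \<sigma>
  for G :: "('g, 'm) monoid_scheme" (structure)
    and H :: "'h::ab_group_add hilbert" and \<pi>
    and K :: "'k::ab_group_add hilbert" and \<sigma>
begin

sublocale hilbert_space_pair H K ..

lemma hom_action_group_representation:
  assumes E: "K.orthonormal_basis (carrier K) E"
  shows "group_representation G (hom_space K E H) (hom_action G K \<pi> \<sigma>)"
proof -
  interpret hom_space_setting H K E by unfold_locales (rule E)
  let ?\<rho> = "hom_action G K \<pi> \<sigma>"
  have app: "?\<rho> g A u = \<pi> g (A (\<sigma> (inv g) u))" if "u \<in> carrier K" for g A u
    using that by (simp add: hom_action_def)
  have out: "?\<rho> g A u = 0" if "u \<notin> carrier K" for g A u
    using that by (simp add: hom_action_def)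
  have lin: "linear_on K H A" if "A \<in> carrier Hom" for A
    using that by (simp add: hom_space_simps)
  have basis: "K.orthonormal_basis (carrier K) (\<sigma> g ` E)" "inj_on (\<sigma> g) E"
    if g: "g \<in> carrier G" for g
  proof -
    show inj: "inj_on (\<sigma> g) E"
    proof (rule inj_onI)
      fix a b assume ab: "a \<in> E" "b \<in> E" "\<sigma> g a = \<sigma> g b"
      then have "\<sigma> (inv g) (\<sigma> g a) = \<sigma> (inv g) (\<sigma> g b)" by simp
      then show "a = b" using ab(1,2) g E_mem by simp
    qed
    have "u = (\<Sum>e\<in>\<sigma> g ` E. smul K (ip K u e) e)" if u: "u \<in> carrier K" for u
    proof -
      let ?w = "\<sigma> (inv g) u"
      have w: "?w \<in> carrier K" using g u by simp
      have "?w = (\<Sum>e\<in>E. smul K (ip K ?w e) e)"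
        using E w unfolding K.orthonormal_basis_def by blast
      then have "\<sigma> g ?w = \<sigma> g (\<Sum>e\<in>E. smul K (ip K ?w e) e)" by (rule arg_cong)
      also have "\<dots> = (\<Sum>e\<in>E. smul K (ip K ?w e) (\<sigma> g e))"
        using g E_mem by (subst K.rep_sum) (auto simp: K.rep_smul)
      also have "\<dots> = (\<Sum>e\<in>E. smul K (ip K u (\<sigma> g e)) (\<sigma> g e))"
        using g u E_mem K.rep_ip[OF g w] by (intro sum.cong) auto
      finally show ?thesis
        using g u inj by (simp add: sum.reindex)
    qed
    then show "K.orthonormal_basis (carrier K) (\<sigma> g ` E)"
      unfolding K.orthonormal_basis_def
      using g inj finite_E E_mem E_orthonormal
      by (auto simp: K.rep_ip inj_on_eq_iff)
  qed
  show ?thesis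
  proof (rule group_representationI)
    show "group G" by (rule H.G.is_group)
    show "complex_hilbert_space Hom" by (rule Hom.complex_hilbert_space_axioms)
  next
    fix g A assume "g \<in> carrier G" "A \<in> carrier Hom"
    then show "?\<rho> g A \<in> carrier Hom"
      by (auto simp: hom_space_simps linear_on_def app out K.rep_add K.rep_smul H.rep_add H.rep_smul)
  next
    fix g A B assume "g \<in> carrier G" "A \<in> carrier Hom" "B \<in> carrier Hom"
    then show "?\<rho> g (A + B) = ?\<rho> g A + ?\<rho> g B"
      using Hom_mem by (auto simp: fun_eq_iff hom_action_def H.rep_add)
  next
    fix g c A assume "g \<in> carrier G" "A \<in> carrier Hom"
    then show "?\<rho> g (smul Hom c A) = smul Hom c (?\<rho> g A)"
      using Hom_mem by (auto simp: fun_eq_iff hom_action_def H.rep_smul hom_space_simps(2))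
  next
    fix g A B assume g: "g \<in> carrier G" and A: "A \<in> carrier Hom" and B: "B \<in> carrier Hom"
    have g': "inv g \<in> carrier G" using g by simp
    have "ip Hom (?\<rho> g A) (?\<rho> g B) = (\<Sum>e\<in>E. ip H (A (\<sigma> (inv g) e)) (B (\<sigma> (inv g) e)))"
      using g E_mem Hom_mem[OF A] Hom_mem[OF B] by (simp add: hom_space_simps(3) app H.rep_ip)
    also have "\<dots> = (\<Sum>e\<in>\<sigma> (inv g) ` E. ip H (A e) (B e))"
      using basis(2)[OF g'] by (simp add: sum.reindex)
    also have "\<dots> = ip Hom A B"
      using hilbert_schmidt_basis_independent[OF lin[OF A] lin[OF B] E basis(1)[OF g']]
      by (simp add: hom_space_simps(3))
    finally show "ip Hom (?\<rho> g A) (?\<rho> g B) = ip Hom A B" .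
  next
    fix A assume A: "A \<in> carrier Hom"
    then show "?\<rho> \<one> A = A"
      using Hom_mem[OF A] by (auto simp: fun_eq_iff hom_action_def hom_space_simps(1))
  next
    fix g h A assume "g \<in> carrier G" "h \<in> carrier G" "A \<in> carrier Hom"
    then show "?\<rho> (g \<otimes> h) A = ?\<rho> g (?\<rho> h A)"
      using Hom_mem[of A]
      by (auto simp: fun_eq_iff hom_action_def H.rep_mult K.rep_mult H.G.inv_mult_group)
  qed
qed

text \<open>
  By Schur's lemma \<open>A\<close> is a multiple of an isometry. The rescaled \<open>A\<close> maps the orbit span of \<open>v\<close>, which is
  all of \<open>K\<close> by irreducibility, onto the orbit span of \<open>x'\<close>.
\<close>

lemma intertwiner_orbit_equivalent:
  assumes irr: "irreducible_rep G K \<sigma>" and fd: "finite_dimensional K"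
    and A: "linear_on K H A"
    and comm: "\<And>g u. g \<in> carrier G \<Longrightarrow> u \<in> carrier K \<Longrightarrow> \<pi> g (A u) = A (\<sigma> g u)"
    and v: "v \<in> carrier K" "hnorm K v = 1" and Av: "A v \<noteq> 0"
    and x': "x' = smul H (of_real (1 / hnorm H (A v))) (A v)"
  shows "unitarily_equivalent G (H\<lparr>carrier := orbit_span G H \<pi> x'\<rparr>) \<pi> K \<sigma>"
proof -
  note lin = linear_onD[OF A]
  obtain z where z: "\<And>u w. u \<in> carrier K \<Longrightarrow> w \<in> carrier K \<Longrightarrow> ip H (A u) (A w) = z * ip K u w"
  proof (rule schur_invariant_form[OF H.G.is_group irr fd, of "\<lambda>u w. ip H (A u) (A w)"])
    show "ip H (A (\<sigma> g u)) (A (\<sigma> g w)) = ip H (A u) (A w)"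
      if "g \<in> carrier G" "u \<in> carrier K" "w \<in> carrier K" for g u w
      using that by (simp add: comm[symmetric] H.rep_ip lin)
  qed (auto simp: lin H.ip_add_left H.ip_add_right H.ip_smul_left H.ip_smul_right)
  define n where "n = hnorm H (A v)"
  have n: "n > 0"
    using Av v H.hnorm_eq_0_iff[OF lin(1)] H.hnorm_nonneg[OF lin(1)] by (simp add: n_def less_le)
  have zn: "z = of_real (n\<^sup>2)"
    using z[OF v(1) v(1)] H.ip_self[OF lin(1)] K.ip_self[OF v(1)] v by (simp add: n_def)
  define U where "U = (\<lambda>u. smul H (of_real (1 / n)) (A u))"
  have U: "linear_on K H U"
    by (auto simp: U_def linear_on_def lin H.scale_right_distrib mult.commute)
  note ulin = linear_onD[OF U]
  have Uip: "ip H (U u) (U w) = ip K u w" if "u \<in> carrier K" "w \<in> carrier K" for u w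
    using that n by (simp add: U_def lin H.ip_smul_left H.ip_smul_right z zn power2_eq_square)
  have Ucomm: "\<pi> g (U u) = U (\<sigma> g u)" if "g \<in> carrier G" "u \<in> carrier K" for g u
    using that by (simp add: U_def H.rep_smul lin comm)
  have xU: "x' = U v" by (simp add: x' U_def n_def)
  have v0: "v \<noteq> 0" using v by auto
  have orbit: "(\<lambda>g. \<sigma> g v) ` carrier G \<subseteq> carrier K" using v by auto
  have span: "K.span ((\<lambda>g. \<sigma> g v) ` carrier G) = carrier K"
  proof (rule K.irreducible_invariant_subspace[OF irr fd _ _ _ v0])
    show "K.span ((\<lambda>g. \<sigma> g v) ` carrier G) \<subseteq> carrier K"
      using orbit K.subspace_carrier by (rule K.span_minimal)
    show "v \<in> K.span ((\<lambda>g. \<sigma> g v) ` carrier G)"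
      using v by (intro K.span_base image_eqI[of _ _ \<one>]) auto
  next
    fix g u assume g: "g \<in> carrier G" and u: "u \<in> K.span ((\<lambda>g. \<sigma> g v) ` carrier G)"
    show "\<sigma> g u \<in> K.span ((\<lambda>g. \<sigma> g v) ` carrier G)"
    proof (rule K.rep_span_closed[OF orbit g _ u])
      fix w assume "w \<in> (\<lambda>g. \<sigma> g v) ` carrier G"
      then obtain h where "h \<in> carrier G" "w = \<sigma> h v" by auto
      then show "\<sigma> g w \<in> K.span ((\<lambda>g. \<sigma> g v) ` carrier G)"
        using g v by (intro K.span_base image_eqI[of _ _ "g \<otimes> h"]) (auto simp: K.rep_mult)
    qed
  qed simp
  have "(\<lambda>g. \<pi> g x') ` carrier G = U ` (\<lambda>g. \<sigma> g v) ` carrier G"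
    using v by (auto simp: xU Ucomm image_image intro!: image_cong)
  then have os: "orbit_span G H \<pi> x' = U ` carrier K"
    using linear_on_span_image[OF U orbit] span by (simp add: orbit_span_def)
  have Uinj: "inj_on U (carrier K)"
  proof (rule inj_onI)
    fix a b assume ab: "a \<in> carrier K" "b \<in> carrier K" "U a = U b"
    then have "U (a - b) + U b = 0 + U b"
      using ulin(2)[of "a - b" b] by simp
    then have "U (a - b) = 0" by (simp only: add_right_cancel)
    then have "ip K (a - b) (a - b) = 0"
      using Uip[of "a - b" "a - b"] ab H.zero_mem by simp
    then have "a - b = 0" using K.ip_pos[of "a - b"] ab by fastforce
    then show "a = b" by simp
  qed
  define T where "T = the_inv_into (carrier K) U"
  have TU: "T (U u) = u" if "u \<in> carrier K" for u
    using Uinj that by (simp add: T_def the_inv_into_f_f)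
  have "bij_betw T (U ` carrier K) (carrier K)"
    using Uinj by (simp add: T_def bij_betw_the_inv_into inj_on_imp_bij_betw)
  then have "unitary_map (H\<lparr>carrier := orbit_span G H \<pi> x'\<rparr>) K T"
    by (auto simp: unitary_map_def os TU Uip ulin(2,3)[symmetric])
  moreover have "T (\<pi> g a) = \<sigma> g (T a)" if g: "g \<in> carrier G" and a: "a \<in> U ` carrier K" for g a
  proof -
    obtain u where "u \<in> carrier K" "a = U u" using a by auto
    then show ?thesis using g by (simp add: Ucomm TU)
  qed
  ultimately show ?thesis
    unfolding unitarily_equivalent_def by (intro exI[of _ T]) (simp add: os)
qed

end

section \<open>Orbits and words in the generators\<close>

context group
begin

lemma set_pow_Suc: "set_pow G S (Suc k) = {s \<otimes> a | s a. s \<in> S \<and> a \<in> set_pow G S k}"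
  by (auto simp: set_pow_def set_mult_def)

lemma set_pow_0: "set_pow G S 0 = {\<one>}"
  by (simp add: set_pow_def)

lemma set_pow_closed: "S \<subseteq> carrier G \<Longrightarrow> a \<in> set_pow G S k \<Longrightarrow> a \<in> carrier G"
  by (induction k arbitrary: a) (auto simp: set_pow_0 set_pow_Suc)

lemma set_pow_mono:
  assumes S: "S \<subseteq> carrier G" "\<one> \<in> S" and "k \<le> l"
  shows "set_pow G S k \<subseteq> set_pow G S l"
  using \<open>k \<le> l\<close>
proof (induction rule: dec_induct)
  case (step n)
  have "a \<in> set_pow G S (Suc n)" if "a \<in> set_pow G S n" for a
    using that S set_pow_closed[OF S(1) that] unfolding set_pow_Suc
    by (intro CollectI exI[of _ \<one>] exI[of _ a]) simp
  then show ?case using step by blast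
qed simp

lemma set_pow_mult:
  assumes S: "S \<subseteq> carrier G" and "a \<in> set_pow G S k" "b \<in> set_pow G S l"
  shows "a \<otimes> b \<in> set_pow G S (k + l)"
  using assms(2)
proof (induction k arbitrary: a)
  case 0
  then show ?case using assms set_pow_closed[OF S] by (simp add: set_pow_0)
next
  case (Suc k)
  then obtain s c where sc: "s \<in> S" "c \<in> set_pow G S k" "a = s \<otimes> c"
    by (auto simp: set_pow_Suc)
  then have "a \<otimes> b = s \<otimes> (c \<otimes> b)"
    using S set_pow_closed[OF S] assms(3) by (auto intro!: m_assoc)
  then show ?case using Suc.IH[OF sc(2)] sc(1) by (auto simp: set_pow_Suc)
qed

lemma set_pow_1: "S \<subseteq> carrier G \<Longrightarrow> set_pow G S (Suc 0) = S"
  by (force simp: set_pow_Suc set_pow_0)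

lemma set_pow_inv:
  assumes S: "S \<subseteq> carrier G" and sym: "\<And>s. s \<in> S \<Longrightarrow> inv s \<in> S" and "a \<in> set_pow G S k"
  shows "inv a \<in> set_pow G S k"
  using assms(3)
proof (induction k arbitrary: a)
  case 0
  then show ?case by (simp add: set_pow_0)
next
  case (Suc k)
  then obtain s c where sc: "s \<in> S" "c \<in> set_pow G S k" "a = s \<otimes> c"
    by (auto simp: set_pow_Suc)
  then have "inv a = inv c \<otimes> inv s"
    using S set_pow_closed[OF S] by (auto intro!: inv_mult_group)
  moreover have "inv c \<otimes> inv s \<in> set_pow G S (k + Suc 0)"
    using Suc.IH[OF sc(2)] sym[OF sc(1)] set_pow_1[OF S] by (intro set_pow_mult[OF S]) auto
  ultimately show ?case by simp
qed

end

context group_representation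
begin

text \<open>
  The spans of \<open>\<pi>(S\<^sup>k) v\<close> increase with \<open>k\<close>, and once two consecutive ones coincide they are
  invariant under the group. By irreducibility the dimension grows in each step until the whole
  space is reached.
\<close>

lemma span_ball_orbit:
  assumes irr: "irreducible_rep G H \<pi>" and fd: "finite_dimensional H"
    and S: "symmetric_generating_set G S" "\<one> \<in> S" and v: "v \<in> carrier H" "v \<noteq> 0"
  shows "span ((\<lambda>g. \<pi> g v) ` set_pow G S (hdim H - 1)) = carrier H"
proof -
  have SG: "S \<subseteq> carrier G" and sym: "\<And>s. s \<in> S \<Longrightarrow> inv s \<in> S" and gen: "generate G S = carrier G"
    using S by (auto simp: symmetric_generating_set_def)
  define V where "V = (\<lambda>k. (\<lambda>g. \<pi> g v) ` set_pow G S k)"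
  have VH: "V k \<subseteq> carrier H" for k
    using v G.set_pow_closed[OF SG] by (auto simp: V_def)
  have spanH: "span (V k) \<subseteq> carrier H" for k
    using VH subspace_carrier by (rule span_minimal)
  have Vmono: "V k \<subseteq> V (Suc k)" for k
    using G.set_pow_mono[OF SG S(2), of k "Suc k"] by (auto simp: V_def)
  have vV: "v \<in> V k" for k
  proof -
    have "\<one> \<in> set_pow G S k"
      using G.set_pow_mono[OF SG S(2), of 0 k] by (simp add: G.set_pow_0)
    then show ?thesis using v by (auto simp: V_def intro!: image_eqI[of _ _ \<one>])
  qed
  have grow: "\<exists>x\<in>V (Suc k). x \<notin> span (V k)" if ne: "span (V k) \<noteq> carrier H" for k
  proof (rule ccontr)
    assume "\<not> ?thesis"
    then have sub: "V (Suc k) \<subseteq> span (V k)" by blast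
    have stepS: "\<pi> s u \<in> span (V k)" if s: "s \<in> S" and u: "u \<in> span (V k)" for s u
    proof (rule rep_span_closed[OF VH _ _ u])
      show sG: "s \<in> carrier G" using s SG by auto
      fix w assume "w \<in> V k"
      then obtain a where a: "a \<in> set_pow G S k" "w = \<pi> a v" by (auto simp: V_def)
      then have "\<pi> s w = \<pi> (s \<otimes> a) v"
        using sG v G.set_pow_closed[OF SG] by (simp add: rep_mult)
      moreover have "s \<otimes> a \<in> set_pow G S (Suc k)" using s a by (auto simp: G.set_pow_Suc)
      ultimately have "\<pi> s w \<in> V (Suc k)" by (auto simp: V_def)
      then show "\<pi> s w \<in> span (V k)" using sub by blast
    qed
    have "\<pi> g u \<in> span (V k)" if "g \<in> generate G S" and u: "u \<in> span (V k)" for g u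
      using that
    proof (induction arbitrary: u rule: generate.induct)
      case one
      then have "u \<in> carrier H" using spanH by blast
      then show ?case using one by simp
    next
      case (eng h1 h2)
      then have "h1 \<in> carrier G" "h2 \<in> carrier G"
        using G.generate_in_carrier[OF SG] by auto
      moreover have "u \<in> carrier H" using eng.prems spanH by blast
      ultimately show ?case using eng by (simp add: rep_mult)
    qed (use stepS sym in auto)
    then have "span (V k) = carrier H"
      using gen v vV[of k] spanH by (intro irreducible_invariant_subspace[OF irr fd]) (auto intro: span_base)
    then show False using ne by blast
  qed
  have ind: "span (V k) = carrier H \<or> (\<exists>C. C \<subseteq> V k \<and> finite C \<and> independent C \<and> card C = Suc k)" for k
  proof (induction k)
    case 0
    show ?case using v vV[of 0] by (intro disjI2 exI[of _ "{v}"]) auto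
  next
    case (Suc k)
    show ?case
    proof (cases "span (V k) = carrier H")
      case True
      then show ?thesis using span_mono[OF Vmono[of k]] spanH[of "Suc k"] by blast
    next
      case False
      then obtain C where C: "C \<subseteq> V k" "finite C" "independent C" "card C = Suc k"
        using Suc by blast
      obtain x where x: "x \<in> V (Suc k)" "x \<notin> span (V k)"
        using grow[OF False] by blast
      have xC: "x \<notin> span C" using x span_mono[OF C(1)] by blast
      have "independent (insert x C)" "x \<notin> C"
        using independent_insertI[OF xC C(3)] xC span_base by auto
      then show ?thesis
        using C x Vmono[of k] by (intro disjI2 exI[of _ "insert x C"]) auto
    qed
  qed
  obtain B where B: "finite B" "span B = carrier H"
    using fd by (auto simp: finite_dimensional_def)
  obtain D where D: "D \<subseteq> carrier H" "independent D" "carrier H \<subseteq> span D" "card D = hdim H"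
    using basis_exists[of "carrier H"] by blast
  have finD: "finite D" using independent_span_bound[OF B(1) D(2)] B D by auto
  have "D \<noteq> {}" using D v by auto
  then have pos: "hdim H > 0" using finD D(4) by (metis card_gt_0_iff)
  have "span (V (hdim H - 1)) = carrier H"
  proof (rule ccontr)
    assume ne: "span (V (hdim H - 1)) \<noteq> carrier H"
    then obtain C where C: "C \<subseteq> V (hdim H - 1)" "finite C" "independent C" "card C = hdim H"
      using ind[of "hdim H - 1"] pos by auto
    obtain x where x: "x \<in> carrier H" "x \<notin> span (V (hdim H - 1))"
      using ne spanH by blast
    have xC: "x \<notin> span C" using x span_mono[OF C(1)] by blast
    have "independent (insert x C)" "x \<notin> C"
      using independent_insertI[OF xC C(3)] xC span_base by auto
    moreover have "insert x C \<subseteq> span D" using C(1) VH x D(3) by blast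
    ultimately have "card (insert x C) \<le> card D"
      using independent_span_bound[OF finD] by blast
    then show False using C \<open>x \<notin> C\<close> D(4) by simp
  qed
  then show ?thesis by (simp add: V_def)
qed

lemma hnorm_orbit_combination:
  assumes "finite J" and p: "\<And>j. j \<in> J \<Longrightarrow> p j \<in> carrier G" and x: "x \<in> carrier H"
  shows "complex_of_real ((hnorm H (\<Sum>j\<in>J. smul H (c j) (\<pi> (p j) x)))\<^sup>2) =
    (\<Sum>i\<in>J. \<Sum>j\<in>J. c i * cnj (c j) * coeff_fun H \<pi> x (inv (p j) \<otimes> p i))"
proof -
  let ?y = "\<Sum>j\<in>J. smul H (c j) (\<pi> (p j) x)"
  have mem: "smul H (c j) (\<pi> (p j) x) \<in> carrier H" if "j \<in> J" for j
    using p[OF that] x by simp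
  have y: "?y \<in> carrier H" by (intro sum_mem mem)
  have "ip H ?y ?y = (\<Sum>i\<in>J. ip H (smul H (c i) (\<pi> (p i) x)) ?y)"
    by (rule ip_sum_left[OF mem y])
  also have "\<dots> = (\<Sum>i\<in>J. \<Sum>j\<in>J. c i * cnj (c j) * coeff_fun H \<pi> x (inv (p j) \<otimes> p i))"
  proof (intro sum.cong refl)
    fix i assume i: "i \<in> J"
    have "ip H (smul H (c i) (\<pi> (p i) x)) ?y =
        (\<Sum>j\<in>J. ip H (smul H (c i) (\<pi> (p i) x)) (smul H (c j) (\<pi> (p j) x)))"
      by (rule ip_sum_right[OF mem mem[OF i]])
    also have "\<dots> = (\<Sum>j\<in>J. c i * cnj (c j) * coeff_fun H \<pi> x (inv (p j) \<otimes> p i))"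
    proof (intro sum.cong refl)
      fix j assume j: "j \<in> J"
      have "ip H (\<pi> (p i) x) (\<pi> (p j) x) = coeff_fun H \<pi> x (inv (p j) \<otimes> p i)"
        using p[OF i] p[OF j] x rep_adjoint[of "inv (p j)" "\<pi> (p i) x" x]
        by (simp add: coeff_fun_def rep_mult)
      then show "ip H (smul H (c i) (\<pi> (p i) x)) (smul H (c j) (\<pi> (p j) x)) =
          c i * cnj (c j) * coeff_fun H \<pi> x (inv (p j) \<otimes> p i)"
        using p[OF i] p[OF j] x by (simp add: ip_smul_left ip_smul_right)
    qed
    finally show "ip H (smul H (c i) (\<pi> (p i) x)) ?y =
        (\<Sum>j\<in>J. c i * cnj (c j) * coeff_fun H \<pi> x (inv (p j) \<otimes> p i))" .
  qed
  finally show ?thesis using ip_self[OF y] by simp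
qed

end

context representation_pair
begin

text \<open>
  The squared norm of a combination of orbit vectors is a quadratic form in the values of the matrix
  coefficient. It vanishes for \<open>v\<close>, and for \<open>x\<close> it differs by at most \<open>e\<^sup>2 \<Sum> |c\<^sub>i| |c\<^sub>j|\<close>.
\<close>

lemma approximate_relation:
  assumes J: "finite J" and p: "\<And>j. j \<in> J \<Longrightarrow> p j \<in> carrier G"
    and x: "x \<in> carrier H" and v: "v \<in> carrier K" and e: "0 \<le> e"
    and rel: "(\<Sum>j\<in>J. smul K (c j) (\<sigma> (p j) v)) = 0"
    and close: "\<And>i j. i \<in> J \<Longrightarrow> j \<in> J \<Longrightarrow>
      cmod (coeff_fun H \<pi> x (inv (p j) \<otimes> p i) - coeff_fun K \<sigma> v (inv (p j) \<otimes> p i)) \<le> e\<^sup>2"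
  shows "hnorm H (\<Sum>j\<in>J. smul H (c j) (\<pi> (p j) x)) \<le> e * (\<Sum>j\<in>J. cmod (c j))"
proof (rule power2_le_imp_le)
  let ?D = "\<lambda>i j. coeff_fun H \<pi> x (inv (p j) \<otimes> p i) - coeff_fun K \<sigma> v (inv (p j) \<otimes> p i)"
  let ?n = "hnorm H (\<Sum>j\<in>J. smul H (c j) (\<pi> (p j) x))"
  have "(\<Sum>i\<in>J. \<Sum>j\<in>J. c i * cnj (c j) * coeff_fun K \<sigma> v (inv (p j) \<otimes> p i)) = 0"
    using K.hnorm_orbit_combination[where p = p and c = c, OF J p v] rel by simp
  then have eq: "complex_of_real (?n\<^sup>2) = (\<Sum>i\<in>J. \<Sum>j\<in>J. c i * cnj (c j) * ?D i j)"
    using H.hnorm_orbit_combination[where p = p and c = c, OF J p x]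
    by (simp add: right_diff_distrib sum_subtractf)
  have "?n\<^sup>2 = cmod (complex_of_real (?n\<^sup>2))"
    unfolding norm_of_real by simp
  also have "\<dots> = cmod (\<Sum>i\<in>J. \<Sum>j\<in>J. c i * cnj (c j) * ?D i j)"
    unfolding eq ..
  also have "\<dots> \<le> (\<Sum>i\<in>J. \<Sum>j\<in>J. cmod (c i) * cmod (c j) * e\<^sup>2)"
  proof (intro sum_norm_le)
    fix i j assume "i \<in> J" "j \<in> J"
    then have "cmod (c i) * cmod (c j) * cmod (?D i j) \<le> cmod (c i) * cmod (c j) * e\<^sup>2"
      by (intro mult_left_mono close) auto
    then show "cmod (c i * cnj (c j) * ?D i j) \<le> cmod (c i) * cmod (c j) * e\<^sup>2"
      by (simp add: norm_mult)
  qed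
  also have "\<dots> = e\<^sup>2 * ((\<Sum>j\<in>J. cmod (c j)) * (\<Sum>j\<in>J. cmod (c j)))"
    unfolding sum_product by (simp add: sum_distrib_left mult.commute)
  also have "\<dots> = (e * (\<Sum>j\<in>J. cmod (c j)))\<^sup>2"
    by (simp only: power2_eq_square mult_ac)
  finally show "?n\<^sup>2 \<le> (e * (\<Sum>j\<in>J. cmod (c j)))\<^sup>2" .
qed (use e in \<open>auto intro!: mult_nonneg_nonneg sum_nonneg\<close>)

text \<open>
  A unitary intertwiner maps orbit spans onto orbit spans, so a description of one of them holds for
  the other.
\<close>

lemma orbit_equivalent_pullback:
  assumes T: "unitary_map K H T"
    and comm: "\<And>g u. g \<in> carrier G \<Longrightarrow> u \<in> carrier K \<Longrightarrow> T (\<sigma> g u) = \<pi> g (T u)"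
    and x: "x \<in> carrier K"
    and eq: "unitarily_equivalent G (H\<lparr>carrier := orbit_span G H \<pi> (T x)\<rparr>) \<pi> L \<tau>"
  shows "unitarily_equivalent G (K\<lparr>carrier := orbit_span G K \<sigma> x\<rparr>) \<sigma> L \<tau>"
proof -
  have lin: "linear_on K H T"
    using T by (auto simp: linear_on_def unitary_map_def bij_betw_def)
  note l = linear_onD[OF lin]
  have inj: "inj_on T (carrier K)" and Tip: "\<And>u w. u \<in> carrier K \<Longrightarrow> w \<in> carrier K \<Longrightarrow> ip H (T u) (T w) = ip K u w"
    using T by (auto simp: unitary_map_def bij_betw_def)
  have orb: "(\<lambda>g. \<sigma> g x) ` carrier G \<subseteq> carrier K" using x by auto
  have sub: "u \<in> carrier K" if "u \<in> orbit_span G K \<sigma> x" for u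
    using K.span_minimal[OF orb K.subspace_carrier] that by (auto simp: orbit_span_def)
  have "(\<lambda>g. \<pi> g (T x)) ` carrier G = T ` (\<lambda>g. \<sigma> g x) ` carrier G"
    using x by (auto simp: comm image_image intro!: image_cong)
  then have os: "orbit_span G H \<pi> (T x) = T ` orbit_span G K \<sigma> x"
    using linear_on_span_image[OF lin orb] by (simp add: orbit_span_def)
  obtain R where R: "unitary_map (H\<lparr>carrier := T ` orbit_span G K \<sigma> x\<rparr>) L R"
    and Rc: "\<And>g a. g \<in> carrier G \<Longrightarrow> a \<in> T ` orbit_span G K \<sigma> x \<Longrightarrow> R (\<pi> g a) = \<tau> g (R a)"
    using eq unfolding os unitarily_equivalent_def by auto
  have bij: "bij_betw (R \<circ> T) (orbit_span G K \<sigma> x) (carrier L)"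
  proof (rule bij_betw_trans)
    show "bij_betw T (orbit_span G K \<sigma> x) (T ` orbit_span G K \<sigma> x)"
      using inj sub by (meson inj_on_imp_bij_betw inj_on_subset subsetI)
    show "bij_betw R (T ` orbit_span G K \<sigma> x) (carrier L)"
      using R by (simp add: unitary_map_def)
  qed
  have "unitary_map (K\<lparr>carrier := orbit_span G K \<sigma> x\<rparr>) L (R \<circ> T)"
    using R bij by (auto simp: unitary_map_def sub l Tip)
  moreover have "(R \<circ> T) (\<sigma> g u) = \<tau> g ((R \<circ> T) u)"
    if "g \<in> carrier G" "u \<in> orbit_span G K \<sigma> x" for g u
    using that by (simp add: comm sub Rc)
  ultimately show ?thesis
    unfolding unitarily_equivalent_def by (intro exI[of _ "R \<circ> T"]) simp
qed

end

text \<open>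
  The locale fixes a basis \<open>B\<close> of \<open>K\<close> that consists of vectors \<open>\<sigma>(h b) v\<close> with words \<open>h b\<close> of length at most
  \<open>k\<close>. These data do not mention the other representation, so constants defined from them are uniform
  in it.
\<close>

locale orbit_basis = K: group_representation G K \<sigma>
  for G :: "('g, 'm) monoid_scheme" (structure) and K :: "'k::ab_group_add hilbert" and \<sigma> +
  fixes S :: "'g set" and v :: 'k and B :: "'k set" and h :: "'k \<Rightarrow> 'g" and E :: "'k set" and k :: nat
  assumes S: "finite S" "S \<subseteq> carrier G" "\<And>s. s \<in> S \<Longrightarrow> inv s \<in> S" "\<one> \<in> S"
    and v: "v \<in> carrier K"
    and B: "finite B" "K.independent B" "K.span B = carrier K"
    and h: "\<And>b. b \<in> B \<Longrightarrow> h b \<in> set_pow G S k" "\<And>b. b \<in> B \<Longrightarrow> \<sigma> (h b) v = b"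
    and vB: "v \<in> B" "h v = \<one>"
    and E: "K.orthonormal_basis (carrier K) E"
begin

abbreviation coord :: "'k \<Rightarrow> 'k \<Rightarrow> complex" where "coord \<equiv> K.representation B"

definition relation_weight :: real where
  "relation_weight = 1 + (\<Sum>t\<in>S. \<Sum>b\<in>B. \<Sum>b'\<in>B. cmod (coord (\<sigma> t b) b'))"

definition displacement_constant :: real where
  "displacement_constant =
     real (card E) * ((\<Sum>e\<in>E. \<Sum>b\<in>B. cmod (coord e b)) * relation_weight)"

text \<open>
  The linear map that sends \<open>\<sigma>(h b) v\<close> to \<open>\<pi>(h b) x\<close> for \<open>b \<in> B\<close>.
\<close>

definition orbit_map :: "'h::ab_group_add hilbert \<Rightarrow> ('g \<Rightarrow> 'h \<Rightarrow> 'h) \<Rightarrow> 'h \<Rightarrow> 'k \<Rightarrow> 'h" where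
  "orbit_map H \<pi> x u = (if u \<in> carrier K then \<Sum>b\<in>B. smul H (coord u b) (\<pi> (h b) x) else 0)"

lemma B_mem: "b \<in> B \<Longrightarrow> b \<in> carrier K"
  using B(3) K.span_base by blast

lemma hG: "b \<in> B \<Longrightarrow> h b \<in> carrier G"
  using K.G.set_pow_closed[OF S(2) h(1)] .

lemma coord_expansion: "u \<in> carrier K \<Longrightarrow> (\<Sum>b\<in>B. smul K (coord u b) b) = u"
  using K.sum_representation_eq[OF B(2) _ B(1) order_refl] B(3) by blast

lemma displacement_constant_nonneg: "0 \<le> displacement_constant"
  by (auto simp: displacement_constant_def relation_weight_def
      intro!: mult_nonneg_nonneg add_nonneg_nonneg sum_nonneg)

text \<open>
  If \<open>x\<close> had exactly the matrix coefficient of \<open>v\<close>, the orbit map would intertwine the representations.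
  It fails to commute with a generator \<open>t\<close> on \<open>b\<close> by the failure of a single linear relation, which
  expresses \<open>\<sigma>(t h(b)) v\<close> in the basis. The words in it have length at most \<open>k + 1\<close>, so only the
  coefficients on the ball of radius \<open>2 (k + 1)\<close> matter.
\<close>

lemma orbit_map_displacement:
  assumes rep: "group_representation G H \<pi>" and x: "x \<in> carrier H"
    and eta: "0 \<le> \<eta>"
    and close: "\<And>g. g \<in> set_pow G S (2 * Suc k) \<Longrightarrow>
      cmod (coeff_fun H \<pi> x g - coeff_fun K \<sigma> v g) \<le> \<eta>\<^sup>2"
  shows "orbit_map H \<pi> x \<in> carrier (hom_space K E H)" (is "?A \<in> _")
    and "orbit_map H \<pi> x v = x"
    and "s \<in> S \<Longrightarrow> hnorm (hom_space K E H) (hom_action G K \<pi> \<sigma> s (orbit_map H \<pi> x) - orbit_map H \<pi> x)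
           \<le> displacement_constant * \<eta>"
proof -
  interpret H: group_representation G H \<pi> by (rule rep)
  interpret P: representation_pair G H \<pi> K \<sigma> ..
  interpret HS: hom_space_setting H K E by unfold_locales (rule E)
  interpret \<rho>: group_representation G "hom_space K E H" "hom_action G K \<pi> \<sigma>"
    by (rule P.hom_action_group_representation[OF E])
  have xb: "\<pi> (h b) x \<in> carrier H" if "b \<in> B" for b using hG[OF that] x by simp
  have Ku: "u \<in> K.span B" if "u \<in> carrier K" for u using that B(3) by simp
  have A_eq: "?A u = (\<Sum>b\<in>B. smul H (coord u b) (\<pi> (h b) x))" if "u \<in> carrier K" for u
    using that by (simp add: orbit_map_def)
  have lin: "linear_on K H ?A"
    unfolding linear_on_def
    using xb
    by (auto simp: A_eq K.representation_add[OF B(2) Ku Ku] K.representation_scale[OF B(2) Ku]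
        H.scale_left_distrib sum.distrib H.scale_sum_right intro!: H.sum_mem)
  show A: "?A \<in> carrier (hom_space K E H)"
    using lin by (simp add: hom_space_simps) (simp add: orbit_map_def)
  have Ab: "?A b = \<pi> (h b) x" if b: "b \<in> B" for b
  proof -
    have "?A b = (\<Sum>a\<in>B. if a = b then \<pi> (h b) x else 0)"
      unfolding A_eq[OF B_mem[OF b]] using b
      by (intro sum.cong) (auto simp: K.representation_basis[OF B(2) b])
    then show ?thesis using b B(1) by simp
  qed
  show "?A v = x" using Ab[OF vB(1)] vB(2) x by simp
  have basis_step: "hnorm H (?A (\<sigma> t b) - \<pi> t (?A b)) \<le> \<eta> * relation_weight"
    if t: "t \<in> S" and b: "b \<in> B" for t b
  proof -
    have tG: "t \<in> carrier G" using t S by auto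
    (* None indexes the vector sigma(t h(b)) v; an option index avoids assuming that the word
       t h(b) differs from the words of the basis. *)
    define J where "J = insert None (Some ` B)"
    define c where "c = case_option (-1) (coord (\<sigma> t b))"
    define p where "p = case_option (t \<otimes> h b) h"
    have finJ: "finite J" using B(1) by (simp add: J_def)
    have sumJ: "sum f J = f None + (\<Sum>b'\<in>B. f (Some b'))" for f :: "'k option \<Rightarrow> 'c::comm_monoid_add"
      using B(1) by (simp add: J_def sum.reindex)
    have "t \<otimes> h b \<in> set_pow G S (Suc k)"
      using t h(1)[OF b] by (auto simp: K.G.set_pow_Suc)
    moreover have "h b' \<in> set_pow G S (Suc k)" if "b' \<in> B" for b'
      using h(1)[OF that] K.G.set_pow_mono[OF S(2,4), of k "Suc k"] by auto
    ultimately have pS: "p j \<in> set_pow G S (Suc k)" if "j \<in> J" for j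
      using that by (auto simp: J_def p_def)
    have pG: "p j \<in> carrier G" if "j \<in> J" for j
      using K.G.set_pow_closed[OF S(2) pS[OF that]] .
    have tb: "\<sigma> t b \<in> carrier K" using tG B_mem[OF b] by simp
    have "\<sigma> (t \<otimes> h b) v = \<sigma> t b"
      using tG hG[OF b] v h(2)[OF b] by (simp add: K.rep_mult)
    then have rel: "(\<Sum>j\<in>J. smul K (c j) (\<sigma> (p j) v)) = 0"
      using coord_expansion[OF tb] h(2) by (simp add: sumJ c_def p_def)
    have small: "cmod (coeff_fun H \<pi> x (inv (p j) \<otimes> p i) - coeff_fun K \<sigma> v (inv (p j) \<otimes> p i)) \<le> \<eta>\<^sup>2"
      if "i \<in> J" "j \<in> J" for i j
    proof (rule close)
      have "inv (p j) \<otimes> p i \<in> set_pow G S (Suc k + Suc k)"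
        using pS that K.G.set_pow_inv[OF S(2,3)] by (intro K.G.set_pow_mult[OF S(2)]) auto
      then show "inv (p j) \<otimes> p i \<in> set_pow G S (2 * Suc k)" by (simp add: mult_2)
    qed
    have "hnorm H (\<Sum>j\<in>J. smul H (c j) (\<pi> (p j) x)) \<le> \<eta> * (\<Sum>j\<in>J. cmod (c j))"
      by (rule P.approximate_relation[where p = p and c = c, OF finJ pG x v eta rel small])
    also have "(\<Sum>j\<in>J. smul H (c j) (\<pi> (p j) x)) = ?A (\<sigma> t b) - \<pi> t (?A b)"
      using tG hG[OF b] x A_eq[OF tb] Ab[OF b] by (simp add: sumJ c_def p_def H.rep_mult)
    also have "(\<Sum>j\<in>J. cmod (c j)) = 1 + (\<Sum>b'\<in>B. cmod (coord (\<sigma> t b) b'))"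
      by (simp add: sumJ c_def)
    also have "(\<Sum>b'\<in>B. cmod (coord (\<sigma> t b) b')) \<le> (\<Sum>b\<in>B. \<Sum>b'\<in>B. cmod (coord (\<sigma> t b) b'))"
      using b B(1) by (intro member_le_sum[where f = "\<lambda>b. \<Sum>b'\<in>B. cmod (coord (\<sigma> t b) b')"] sum_nonneg) auto
    also have "\<dots> \<le> (\<Sum>t\<in>S. \<Sum>b\<in>B. \<Sum>b'\<in>B. cmod (coord (\<sigma> t b) b'))"
      using t S(1)
      by (intro member_le_sum[where f = "\<lambda>t. \<Sum>b\<in>B. \<Sum>b'\<in>B. cmod (coord (\<sigma> t b) b')"] sum_nonneg) auto
    finally show ?thesis
      using eta by (simp add: relation_weight_def mult_left_mono)
  qed
  have step: "hnorm H (?A (\<sigma> t u) - \<pi> t (?A u)) \<le> (\<Sum>b\<in>B. cmod (coord u b)) * (\<eta> * relation_weight)"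
    if t: "t \<in> S" and u: "u \<in> carrier K" for t u
  proof -
    have tG: "t \<in> carrier G" using t S by auto
    have AH: "?A w \<in> carrier H" if "w \<in> carrier K" for w
      using linear_onD(1)[OF lin that] .
    have "\<sigma> t u = \<sigma> t (\<Sum>b\<in>B. smul K (coord u b) b)"
      using coord_expansion[OF u] by simp
    also have "\<dots> = (\<Sum>b\<in>B. smul K (coord u b) (\<sigma> t b))"
      using tG B_mem by (subst K.rep_sum) (auto simp: K.rep_smul)
    finally have "?A (\<sigma> t u) = (\<Sum>b\<in>B. smul H (coord u b) (?A (\<sigma> t b)))"
      using tG B_mem by (simp add: P.linear_on_sum[OF lin] linear_onD(3)[OF lin])
    moreover have "\<pi> t (?A u) = (\<Sum>b\<in>B. smul H (coord u b) (\<pi> t (?A b)))"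
      using tG u xb by (simp add: A_eq[OF u] Ab H.rep_sum H.rep_smul)
    ultimately have "?A (\<sigma> t u) - \<pi> t (?A u) = (\<Sum>b\<in>B. smul H (coord u b) (?A (\<sigma> t b) - \<pi> t (?A b)))"
      by (simp add: H.scale_right_diff_distrib sum_subtractf)
    also have "hnorm H \<dots> \<le> (\<Sum>b\<in>B. hnorm H (smul H (coord u b) (?A (\<sigma> t b) - \<pi> t (?A b))))"
      using tG B_mem AH by (intro H.hnorm_sum_le) auto
    also have "\<dots> \<le> (\<Sum>b\<in>B. cmod (coord u b) * (\<eta> * relation_weight))"
      using tG B_mem AH basis_step[OF t]
      by (intro sum_mono) (auto simp: H.hnorm_smul intro!: mult_left_mono)
    finally show ?thesis by (simp add: sum_distrib_right)
  qed
  assume s: "s \<in> S"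
  have sG: "s \<in> carrier G" and t: "inv s \<in> S" using s S by auto
  have w: "0 \<le> relation_weight"
    by (auto simp: relation_weight_def intro!: add_nonneg_nonneg sum_nonneg)
  let ?N = "\<Sum>e\<in>E. \<Sum>b\<in>B. cmod (coord e b)"
  have "hnorm (hom_space K E H) (hom_action G K \<pi> \<sigma> s ?A - ?A) \<le> real (card E) * (?N * (\<eta> * relation_weight))"
  proof (rule HS.Hom_hnorm_le)
    show "hom_action G K \<pi> \<sigma> s ?A - ?A \<in> carrier (hom_space K E H)"
      using sG A by simp
    show "0 \<le> ?N * (\<eta> * relation_weight)"
      using eta w by (intro mult_nonneg_nonneg sum_nonneg) auto
    fix e assume e: "e \<in> E"
    have eK: "e \<in> carrier K" by (rule HS.E_mem[OF e])
    have AH: "?A e \<in> carrier H" "?A (\<sigma> (inv s) e) \<in> carrier H"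
      using linear_onD(1)[OF lin] eK sG by auto
    have "(hom_action G K \<pi> \<sigma> s ?A - ?A) e = \<pi> s (?A (\<sigma> (inv s) e) - \<pi> (inv s) (?A e))"
      using sG AH eK by (simp add: hom_action_def H.rep_diff)
    then have "hnorm H ((hom_action G K \<pi> \<sigma> s ?A - ?A) e) = hnorm H (?A (\<sigma> (inv s) e) - \<pi> (inv s) (?A e))"
      using sG AH by (simp add: H.rep_hnorm)
    also have "\<dots> \<le> (\<Sum>b\<in>B. cmod (coord e b)) * (\<eta> * relation_weight)"
      by (rule step[OF t eK])
    also have "\<dots> \<le> ?N * (\<eta> * relation_weight)"
      using eta w e HS.finite_E
      by (intro mult_right_mono member_le_sum[where f = "\<lambda>e. \<Sum>b\<in>B. cmod (coord e b)"] sum_nonneg) auto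
    finally show "hnorm H ((hom_action G K \<pi> \<sigma> s ?A - ?A) e) \<le> ?N * (\<eta> * relation_weight)" .
  qed
  then show "hnorm (hom_space K E H) (hom_action G K \<pi> \<sigma> s ?A - ?A) \<le> displacement_constant * \<eta>"
    by (simp add: displacement_constant_def algebra_simps)
qed

end

section \<open>Good vectors\<close>

text \<open>
  A good \<open>x\<close> makes the orbit map almost invariant under conjugation by the generators. The Kazhdan
  constant, applied to the space of linear maps, gives an intertwiner \<open>A'\<close> nearby, and evaluation at \<open>v\<close>
  gives \<open>A' v\<close> near \<open>x\<close>. The vector \<open>x'\<close> is \<open>A' v\<close> normalized.
\<close>

lemma good_threshold_exists:
  fixes G :: "('g, 'm) monoid_scheme" (structure)
    and K :: "'k::ab_group_add hilbert"
  assumes T: "kazhdan_group G"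
    and S: "finite S" "symmetric_generating_set G S" "\<one> \<in> S"
    and irr: "irreducible_rep G K \<sigma>" and fd: "finite_dimensional K"
    and assoc: "associated_with G \<phi> K \<sigma>"
    and \<delta>: "0 < \<delta>" "\<delta> < 1"
  shows "\<exists>\<epsilon>>0. good_threshold TYPE('h::ab_group_add) G S \<phi> K \<sigma> \<delta> \<epsilon>"
proof -
  have G: "group G" using T by (simp add: kazhdan_group_def)
  interpret K: group_representation G K \<sigma>
    using G irr by (simp add: unitary_rep_imp_group_representation irreducible_rep_def)
  have SG: "S \<subseteq> carrier G" and sym: "\<And>s. s \<in> S \<Longrightarrow> inv s \<in> S" and gen: "generate G S = carrier G"
    using S by (auto simp: symmetric_generating_set_def)
  obtain v where v: "v \<in> carrier K" "hnorm K v = 1"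
    and \<phi>: "\<And>g. g \<in> carrier G \<Longrightarrow> \<phi> g = coeff_fun K \<sigma> v g"
    using assoc by (auto simp: associated_with_def)
  have v0: "v \<noteq> 0" using v by auto
  obtain D where D: "finite D" "K.span D = carrier K"
    using fd by (auto simp: finite_dimensional_def)
  define k where "k = hdim K - 1"
  define X where "X = (\<lambda>g. \<sigma> g v) ` set_pow G S k"
  have spanX: "K.span X = carrier K"
    unfolding X_def k_def by (rule K.span_ball_orbit[OF irr fd S(2,3) v(1) v0])
  have one: "\<one> \<in> set_pow G S k"
    using K.G.set_pow_mono[OF SG S(3), of 0 k] by (simp add: K.G.set_pow_0)
  have "v \<in> X" using one v by (auto simp: X_def intro!: image_eqI[of _ _ \<one>])
  then obtain B where B: "v \<in> B" "B \<subseteq> X" "K.independent B" "X \<subseteq> K.span B"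
    using K.maximal_independent_subset_extend[of "{v}" X] v0 by auto
  have spanB: "K.span B = carrier K"
    using K.span_mono[OF B(2)] K.span_minimal[OF B(4)] spanX by auto
  have finB: "finite B"
    using K.independent_span_bound[OF D(1) B(3)] K.span_superset[of B] spanB D(2) by simp
  have "card B = hdim K"
    using K.basis_card_eq_dim[OF _ _ B(3)] K.span_superset[of B] spanB by simp
  then have dpos: "hdim K > 0" using B(1) finB card_gt_0_iff[of B] by auto
  have "\<forall>b\<in>B. \<exists>g. g \<in> set_pow G S k \<and> \<sigma> g v = b" using B(2) by (auto simp: X_def)
  then obtain h0 where h0: "\<And>b. b \<in> B \<Longrightarrow> h0 b \<in> set_pow G S k \<and> \<sigma> (h0 b) v = b" by metis
  define h where "h = h0(v := \<one>)"
  obtain E where E: "K.orthonormal_basis (carrier K) E"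
    using K.orthonormal_basis_exists[OF K.subspace_carrier order_refl D(1)] D(2) by blast
  interpret OB: orbit_basis G K \<sigma> S v B h E k
    using S(1,3) SG sym v(1) finB B(1,3) spanB h0 one E
    by unfold_locales (auto simp: h_def)
  obtain \<kappa> where \<kappa>: "\<kappa> > 0"
    and inv_near: "\<And>(L :: ('k \<Rightarrow> 'h) hilbert) \<rho> \<xi> r. group_representation G L \<rho> \<Longrightarrow> \<xi> \<in> carrier L \<Longrightarrow> 0 \<le> r \<Longrightarrow>
       (\<forall>s\<in>S. hnorm L (\<rho> s \<xi> - \<xi>) \<le> \<kappa> * r) \<Longrightarrow>
       \<exists>\<zeta>\<in>carrier L. (\<forall>g\<in>carrier G. \<rho> g \<zeta> = \<zeta>) \<and> hnorm L (\<xi> - \<zeta>) \<le> r"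
    using kazhdan_constant_exists[OF T SG gen, where 'h = "'k \<Rightarrow> 'h"] by blast
  (* r is the distance allowed between the orbit map and the intertwiner. Evaluation at v costs the
     factor card E. One half of \<delta> is spent on the distance of x to A' v, the other on normalizing. *)
  define r where "r = \<delta> / (2 * (real (card E) + 1))"
  have r: "r > 0" and rE: "real (card E) * r \<le> \<delta> / 2"
    using \<delta> by (auto simp: r_def field_simps)
  define \<eta> where "\<eta> = \<kappa> * r / (OB.displacement_constant + 1)"
  have \<eta>: "\<eta> > 0" and C\<eta>: "OB.displacement_constant * \<eta> \<le> \<kappa> * r"
    using \<kappa> r OB.displacement_constant_nonneg by (auto simp: \<eta>_def field_simps)
  have "good_threshold TYPE('h) G S \<phi> K \<sigma> \<delta> (\<eta>\<^sup>2)"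
    unfolding good_threshold_def
  proof (intro allI impI)
    fix H :: "'h hilbert" and \<pi> x
    assume hyp: "unitary_rep G H \<pi> \<and> good_vector G S (hdim K) \<phi> H \<pi> (\<eta>\<^sup>2) x"
    then have rep: "group_representation G H \<pi>"
      using G by (simp add: unitary_rep_imp_group_representation)
    have x: "x \<in> carrier H" "hnorm H x = 1"
      and good: "\<And>g. g \<in> set_pow G S (2 * (hdim K)\<^sup>2 + 1) \<Longrightarrow> cmod (coeff_fun H \<pi> x g - \<phi> g) < \<eta>\<^sup>2"
      using hyp by (auto simp: good_vector_def)
    interpret H: group_representation G H \<pi> by (rule rep)
    interpret P: representation_pair G H \<pi> K \<sigma> ..
    interpret HS: hom_space_setting H K E by unfold_locales (rule E)
    define A where "A = OB.orbit_map H \<pi> x"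
    (* By the choice k = d - 1 the relevant ball has radius 2 d, and d is not zero. *)
    have len: "2 * Suc k \<le> 2 * (hdim K)\<^sup>2 + 1"
      using dpos by (cases "hdim K") (auto simp: k_def power2_eq_square)
    have close: "cmod (coeff_fun H \<pi> x g - coeff_fun K \<sigma> v g) \<le> \<eta>\<^sup>2" if g: "g \<in> set_pow G S (2 * Suc k)" for g
    proof -
      have "g \<in> set_pow G S (2 * (hdim K)\<^sup>2 + 1)"
        using g K.G.set_pow_mono[OF SG S(3) len] by blast
      then show ?thesis
        using good \<phi> K.G.set_pow_closed[OF SG] by (metis less_imp_le)
    qed
    note disp = OB.orbit_map_displacement[OF rep x(1) less_imp_le[OF \<eta>] close, folded A_def]
    have "\<forall>s\<in>S. hnorm HS.Hom (hom_action G K \<pi> \<sigma> s A - A) \<le> \<kappa> * r"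
      using disp(3) C\<eta> by (meson order_trans)
    then obtain A' where A': "A' \<in> carrier HS.Hom" and fixed: "\<And>g. g \<in> carrier G \<Longrightarrow> hom_action G K \<pi> \<sigma> g A' = A'"
      and near: "hnorm HS.Hom (A - A') \<le> r"
      using inv_near[OF P.hom_action_group_representation[OF E] disp(1), of r] r by auto
    have lin: "linear_on K H A'" using A' by (simp add: hom_space_simps)
    have comm: "\<pi> g (A' u) = A' (\<sigma> g u)" if "g \<in> carrier G" "u \<in> carrier K" for g u
      using fun_cong[OF fixed[OF that(1)], of "\<sigma> g u"] that by (simp add: hom_action_def)
    define y where "y = A' v"
    have y: "y \<in> carrier H" using linear_onD(1)[OF lin v(1)] by (simp add: y_def)
    have "hnorm H ((A - A') v) \<le> real (card E) * hnorm HS.Hom (A - A') * hnorm K v"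
      using HS.Hom_diff[OF disp(1) A'] v(1) by (rule HS.hnorm_apply_le)
    also have "\<dots> \<le> real (card E) * r"
      using near v(2) by (simp add: mult_left_mono)
    finally have xy: "hnorm H (x - y) \<le> \<delta> / 2"
      using rE disp(2) by (simp add: y_def)
    define n where "n = hnorm H y"
    have n1: "\<bar>1 - n\<bar> \<le> \<delta> / 2"
      using H.hnorm_diff_abs[OF x(1) y] xy x(2) by (simp add: n_def)
    then have n: "n > 0" using \<delta> by linarith
    define x' where "x' = smul H (of_real (1 / n)) y"
    have x'H: "x' \<in> carrier H" using y by (simp add: x'_def)
    have "hnorm H x' = 1"
      using y n by (simp add: x'_def H.hnorm_smul norm_divide n_def[symmetric])
    moreover have "hnorm H (x - x') \<le> \<delta>"
    proof -
      have "y - x' = smul H (of_real (1 - 1 / n)) y"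
        by (simp add: x'_def H.scale_left_diff_distrib)
      then have "hnorm H (y - x') = \<bar>1 - 1 / n\<bar> * n"
        using y by (simp only: H.hnorm_smul norm_of_real n_def)
      also have "\<dots> = \<bar>(1 - 1 / n) * n\<bar>" using n by (simp add: abs_mult)
      also have "(1 - 1 / n) * n = n - 1" using n by (simp add: field_simps)
      finally have "hnorm H (y - x') \<le> \<delta> / 2" using n1 by (simp add: abs_minus_commute)
      then show ?thesis
        using H.hnorm_triangle_diff[OF x(1) y x'H] xy by simp
    qed
    moreover have "unitarily_equivalent G (H\<lparr>carrier := orbit_span G H \<pi> x'\<rparr>) \<pi> K \<sigma>"
    proof (rule P.intertwiner_orbit_equivalent[OF irr fd lin comm v])
      show "A' v \<noteq> 0" using n by (auto simp: n_def y_def)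
      show "x' = smul H (of_real (1 / hnorm H (A' v))) (A' v)"
        by (simp add: x'_def n_def y_def)
    qed
    ultimately show "\<exists>x'\<in>carrier H. hnorm H x' = 1 \<and> hnorm H (x - x') \<le> \<delta> \<and>
        unitarily_equivalent G (H\<lparr>carrier := orbit_span G H \<pi> x'\<rparr>) \<pi> K \<sigma>"
      using x'H by blast
  qed
  then show ?thesis using \<eta> by (intro exI[of _ "\<eta>\<^sup>2"]) simp
qed

text \<open>
  The vector \<open>x\<close> is still good in the cyclic representation that it generates, and it suffices to find
  \<open>x'\<close> there. Matrix coefficients embed that representation into the functions on the group.
\<close>

lemma good_threshold_universe:
  fixes G :: "('g, 'm) monoid_scheme" (structure)
    and K :: "'k::ab_group_add hilbert"
  assumes G: "group G" and S: "S \<subseteq> carrier G"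
    and thr: "good_threshold TYPE('g universe) G S \<phi> K \<sigma> \<delta> \<epsilon>"
  shows "good_threshold TYPE('h::ab_group_add) G S \<phi> K \<sigma> \<delta> \<epsilon>"
  unfolding good_threshold_def
proof (intro allI impI)
  fix H :: "'h hilbert" and \<pi> x
  assume hyp: "unitary_rep G H \<pi> \<and> good_vector G S (hdim K) \<phi> H \<pi> \<epsilon> x"
  interpret H: group_representation G H \<pi>
    using G hyp by (simp add: unitary_rep_imp_group_representation)
  have x: "x \<in> carrier H" "hnorm H x = 1"
    and good: "\<And>g. g \<in> set_pow G S (2 * (hdim K)\<^sup>2 + 1) \<Longrightarrow> cmod (coeff_fun H \<pi> x g - \<phi> g) < \<epsilon>"
    using hyp by (auto simp: good_vector_def)
  let ?C = "H\<lparr>carrier := H.cyclic_space x\<rparr>"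
  interpret C: group_representation G ?C \<pi>
    by (rule H.cyclic_subrepresentation[OF x(1)])
  define J :: "'h \<Rightarrow> 'g universe" where
    "J = (\<lambda>v (g, n). if g \<in> carrier G \<and> n = 0 then ip H v (\<pi> g x) else 0)"
  have CH: "v \<in> carrier H" if "v \<in> H.cyclic_space x" for v
    using H.cyclic_space_subset[OF that] .
  have add: "J (u + v) = J u + J v" if "u \<in> carrier ?C" "v \<in> carrier ?C" for u v
    using that x CH by (auto simp: J_def fun_eq_iff H.ip_add_left)
  have smul: "J (smul ?C c v) = (\<lambda>i. c * J v i)" if "v \<in> carrier ?C" for c v
    using that x CH by (auto simp: J_def fun_eq_iff H.ip_smul_left)
  have ker: "v = 0" if "v \<in> carrier ?C" "J v = 0" for v
  proof (rule H.cyclic_space_eq_0)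
    show "v \<in> H.cyclic_space x" using that by simp
    show "ip H v (\<pi> g x) = 0" if "g \<in> carrier G" for g
      using fun_cong[OF \<open>J v = 0\<close>, of "(g, 0)"] that by (simp add: J_def)
  qed
  obtain H' \<pi>' where rep': "group_representation G H' \<pi>'" and J: "unitary_map ?C H' J"
    and comm: "\<And>g v. g \<in> carrier G \<Longrightarrow> v \<in> carrier ?C \<Longrightarrow> J (\<pi> g v) = \<pi>' g (J v)"
    using C.transport[OF vector_space_pointwise, of J] add smul ker by blast
  interpret H': group_representation G H' \<pi>' by (rule rep')
  interpret P: representation_pair G H' \<pi>' ?C \<pi> ..
  have nrm: "hnorm ?C = hnorm H" by (simp add: hnorm_def fun_eq_iff)
  have xC: "x \<in> carrier ?C" using H.generator_in_cyclic_space[OF x(1)] by simp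
  have coeff: "coeff_fun H' \<pi>' (J x) g = coeff_fun H \<pi> x g" if g: "g \<in> carrier G" for g
  proof -
    have "ip H' (J (\<pi> g x)) (J x) = ip ?C (\<pi> g x) x"
      using J xC C.rep_mem[OF g xC] by (simp add: unitary_map_def)
    then show ?thesis by (simp add: coeff_fun_def comm[OF g xC])
  qed
  have "good_vector G S (hdim K) \<phi> H' \<pi>' \<epsilon> (J x)"
    using good coeff H.G.set_pow_closed[OF S] unitary_map_mem[OF J xC] unitary_map_hnorm[OF J xC] x(2)
    by (auto simp: good_vector_def nrm)
  then obtain y where y: "y \<in> carrier H'" "hnorm H' y = 1" "hnorm H' (J x - y) \<le> \<delta>"
    and eq: "unitarily_equivalent G (H'\<lparr>carrier := orbit_span G H' \<pi>' y\<rparr>) \<pi>' K \<sigma>"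
    using thr H'.rep unfolding good_threshold_def by blast
  have "y \<in> J ` carrier ?C" using y(1) J by (simp add: unitary_map_def bij_betw_def)
  then obtain x' where x': "x' \<in> carrier ?C" "y = J x'" by blast
  have x'H: "x' \<in> carrier H" using x'(1) CH by simp
  have "J (x - x') = J x - J x'"
    using unitary_map_diff[OF J C.complex_hilbert_space_axioms xC x'(1)] .
  then have "hnorm H (x - x') \<le> \<delta>"
    using y(3) x'(2) unitary_map_hnorm[OF J C.diff_mem[OF xC x'(1)]] by (simp add: nrm)
  moreover have "hnorm H x' = 1"
    using y(2) x' unitary_map_hnorm[OF J x'(1)] by (simp add: nrm)
  moreover have "unitarily_equivalent G (?C\<lparr>carrier := orbit_span G ?C \<pi> x'\<rparr>) \<pi> K \<sigma>"
    by (rule P.orbit_equivalent_pullback[OF J comm x'(1) eq[unfolded x'(2)]])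
  moreover have "?C\<lparr>carrier := orbit_span G ?C \<pi> x'\<rparr> = H\<lparr>carrier := orbit_span G H \<pi> x'\<rparr>"
    by (simp add: orbit_span_def)
  ultimately show "\<exists>x'\<in>carrier H. hnorm H x' = 1 \<and> hnorm H (x - x') \<le> \<delta> \<and>
      unitarily_equivalent G (H\<lparr>carrier := orbit_span G H \<pi> x'\<rparr>) \<pi> K \<sigma>"
    using x'H by (intro bexI[of _ x']) auto
qed

(* The threshold must not depend on the Hilbert space, hence not on the type 'h carrying it. A bare
   "EX eps > 0. good_threshold TYPE('h) ... eps" with free 'h would allow such a dependence. So the
   threshold is found for one fixed type not mentioning 'h, and the second conjunct says that the
   same threshold works for representations on Hilbert spaces carried by an arbitrary type 'h. *)
theorem theorem1p3:
  fixes G :: "('g, 'm) monoid_scheme" (structure)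
    and S :: "'g set"
    and \<phi> :: "'g \<Rightarrow> complex"
    and K :: "'k::ab_group_add hilbert"
    and \<sigma> :: "'g \<Rightarrow> 'k \<Rightarrow> 'k"
    and \<delta> :: real
  assumes "kazhdan_group G"
    and "finite S" and "symmetric_generating_set G S" and "\<one> \<in> S"
    and "irreducible_rep G K \<sigma>" and "finite_dimensional K"
    and "associated_with G \<phi> K \<sigma>"
    and "0 < \<delta>" and "\<delta> < 1"
  shows "(\<exists>\<epsilon>>0. good_threshold TYPE('g universe) G S \<phi> K \<sigma> \<delta> \<epsilon>) \<and>
         (\<forall>\<epsilon>>0. good_threshold TYPE('g universe) G S \<phi> K \<sigma> \<delta> \<epsilon> \<longrightarrow>
            good_threshold TYPE('h::ab_group_add) G S \<phi> K \<sigma> \<delta> \<epsilon>)"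
proof (intro conjI allI impI)
  show "\<exists>\<epsilon>>0. good_threshold TYPE('g universe) G S \<phi> K \<sigma> \<delta> \<epsilon>"
    using assms by (rule good_threshold_exists)
next
  fix \<epsilon> :: real
  assume "good_threshold TYPE('g universe) G S \<phi> K \<sigma> \<delta> \<epsilon>"
  with _ _ show "good_threshold TYPE('h) G S \<phi> K \<sigma> \<delta> \<epsilon>"
    by (rule good_threshold_universe)
      (use assms in \<open>auto simp: kazhdan_group_def symmetric_generating_set_def\<close>)
qed

end
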